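(* Let $X$ be a finite-dimensional Alexandrov space with curvature bounded from below, say $X\in \mathrm{Alex}^n(\kappa)$, and let $f:X\to\mathbb{R}$ be an affine function that is measurable with respect to the $n$-dimensional Hausdorff measure on $X$. Then $f$ is Lipschitz continuous.
   Context: $\mathrm{Alex}^n(\kappa)$ denotes the class of complete geodesic metric spaces of Hausdorff dimension $n<\infty$ with curvature $\geq\kappa$ in the sense of Alexandrov (triangles are not thinner than comparison triangles in the model plane of constant curvature $\kappa$). A geodesic is a length-minimizing curve parametrized proportionally to arclength. A function $f:X\to\mathbb{R}$ on a geodesic metric space is affine if for every geodesic $\gamma:[a,b]\to X$ the function $f\circ\gamma$ is affine, i.e. $(f\circ\gamma)''=0$. *)

theory Defs
  imports "HOL-Analysis.Analysis"
begin

definition geodesic :: "(real \<Rightarrow> 'a::metric_space) \<Rightarrow> real \<Rightarrow> real \<Rightarrow> bool" where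
  "geodesic g a b \<longleftrightarrow> a \<le> b \<and>
     (\<exists>c. \<forall>s\<in>{a..b}. \<forall>t\<in>{a..b}. dist (g s) (g t) = c * \<bar>s - t\<bar>)"

definition geodesic_space :: "'a::metric_space itself \<Rightarrow> bool" where
  "geodesic_space _ \<longleftrightarrow> (\<forall>x y::'a. \<exists>g. geodesic g 0 1 \<and> g 0 = x \<and> g 1 = y)"

definition affine_fun :: "('a::metric_space \<Rightarrow> real) \<Rightarrow> bool" where
  "affine_fun f \<longleftrightarrow> (\<forall>g a b. geodesic g a b \<longrightarrow>
     (\<forall>s\<in>{a..b}. \<forall>t\<in>{a..b}. \<forall>u\<in>{0..1}.
        f (g ((1 - u) * s + u * t)) = (1 - u) * f (g s) + u * f (g t)))"

text \<open>Comparison distance in the model plane of curvature k: for a triangle with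
  side lengths x = |pq|, y = |pr|, z = |qr| (z > 0) and the point m on side [qr] with
  |qm| = s, this is the distance from the vertex p to m in the comparison triangle.\<close>
definition model_cmp :: "real \<Rightarrow> real \<Rightarrow> real \<Rightarrow> real \<Rightarrow> real \<Rightarrow> real" where
  "model_cmp k x y z s =
    (if k = 0 then sqrt (((z - s) * x\<^sup>2 + s * y\<^sup>2) / z - s * (z - s))
     else if k > 0 then
       arccos ((sin (sqrt k * (z - s)) * cos (sqrt k * x) + sin (sqrt k * s) * cos (sqrt k * y))
               / sin (sqrt k * z)) / sqrt k
     else
       arcosh ((sinh (sqrt (- k) * (z - s)) * cosh (sqrt (- k) * x)
                + sinh (sqrt (- k) * s) * cosh (sqrt (- k) * y))
               / sinh (sqrt (- k) * z)) / sqrt (- k))"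

definition curv_ge :: "'a::metric_space itself \<Rightarrow> real \<Rightarrow> bool" where
  "curv_ge _ k \<longleftrightarrow> (\<forall>(p::'a) q r g.
     geodesic g 0 1 \<and> g 0 = q \<and> g 1 = r \<and> q \<noteq> r \<and>
     (k > 0 \<longrightarrow> dist p q + dist p r + dist q r < 2 * pi / sqrt k) \<longrightarrow>
     (\<forall>t\<in>{0..1}. model_cmp k (dist p q) (dist p r) (dist q r) (t * dist q r) \<le> dist p (g t)))"

definition hterm :: "real \<Rightarrow> 'a::metric_space set \<Rightarrow> ennreal" where
  "hterm s S = (if S = {} then 0 else if s = 0 then 1 else ennreal (diameter S powr s))"

definition hausdorff_pre :: "real \<Rightarrow> real \<Rightarrow> 'a::metric_space set \<Rightarrow> ennreal" where
  "hausdorff_pre s \<delta> A =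
     (INF C\<in>{C::nat \<Rightarrow> 'a set. A \<subseteq> (\<Union>i. C i) \<and> (\<forall>i. bounded (C i) \<and> diameter (C i) \<le> \<delta>)}.
        (\<Sum>i. hterm s (C i)))"

text \<open>s-dimensional Hausdorff (outer) measure (without normalising constant).\<close>
definition hausdorff_measure :: "real \<Rightarrow> 'a::metric_space set \<Rightarrow> ennreal" where
  "hausdorff_measure s A = (SUP \<delta>\<in>{0<..}. hausdorff_pre s \<delta> A)"

definition hausdorff_dim :: "'a::metric_space set \<Rightarrow> ereal" where
  "hausdorff_dim A = Inf {ereal s | s. 0 \<le> s \<and> hausdorff_measure s A = 0}"

text \<open>Measurability of f w.r.t. the s-dimensional Hausdorff measure: preimages of Borel
  sets are Caratheodory measurable for the outer measure.\<close>
definition hausdorff_measurable_fun :: "real \<Rightarrow> ('a::metric_space \<Rightarrow> real) \<Rightarrow> bool" where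
  "hausdorff_measurable_fun s f \<longleftrightarrow>
     (\<forall>B\<in>sets borel. f -` B \<in> lambda_system UNIV UNIV (hausdorff_measure s))"

end

theory Submission
  imports Defs
begin

text \<open>Homotheties \<open>x \<mapsto> x\<^sub>t\<close>, where \<open>x\<^sub>t\<close> divides a geodesic from a centre \<open>v\<close> to \<open>x\<close> in the ratio \<open>t\<close>, almost
  expand distances by the factor \<open>t\<close> because of the curvature bound, and an affine function satisfies
  \<open>f x\<^sub>t = (1 - t) f v + t f x\<close>. Hence Hausdorff measure cannot be lost under homotheties, and volume
  replaces the missing upper bounds for distances.

  A maximal strainer provides a ball that is bi-Lipschitz to a subset of \<open>\<real>\<^sup>n\<close> whose image contains a box,
  so that all small balls have positive finite \<open>n\<close>-dimensional measure. If \<open>{\<bar>f\<bar> \<le> M}\<close> almost fills a ball,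
  every \<open>z\<close> near the centre admits \<open>y, m\<close> in this set with \<open>m\<close> the midpoint of \<open>z\<close> and \<open>y\<close>, and
  \<open>f z = 2 f m - f y\<close> is bounded. The same argument applied to the homothetic copies of a ball
  whose volume ratio is almost maximal makes \<open>f\<close> Lipschitz on some ball. Finally the copies of that
  ball under homotheties centred at a nearby point \<open>q\<close> transport the Lipschitz constant to \<open>q\<close> with a
  loss that is quadratic in the distance; along a chain of short steps the loss disappears, so that the
  constant is global.\<close>

section \<open>Comparison geometry on small scales\<close>

text \<open>The curvature bound acts in one direction only: a homothety may spread points by an
  uncontrolled amount, so it shows that sets are large, never that they are small. Upper bounds for
  volumes must come from elsewhere. Strainers give \<open>C * r ^ n\<close> inside one ball. Hence
  \<open>vol (ball q r) / r ^ n\<close> has a finite supremum there, and where this is nearly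
  attained at radius \<open>r0\<close>, the copy of the ball at ratio \<open>t\<close> has almost
  the largest volume that any ball of radius \<open>t * r0\<close> can have. The second obstacle is
  that \<open>f\<close> is not known to be continuous anywhere. A statement about a set of almost
  full volume says nothing about a given point unless an affine relation ties the point to that set;
  midpoints provide the relation. The loss along a short step is quadratic because comparison on
  scale \<open>r\<close> is Euclidean up to a relative error of order \<open>K * r\<^sup>2\<close>;
  \<open>N\<close> steps of length \<open>D / N\<close> then cost in total a multiple of
  \<open>1 / N\<close>. Dividing points are described by distances alone: geodesics are not unique,
  so homotheties are relations rather than maps.\<close>

definition between :: "real \<Rightarrow> 'a::metric_space \<Rightarrow> 'a \<Rightarrow> 'a \<Rightarrow> bool" where
  "between t x m y \<longleftrightarrow> dist x m = t * dist x y \<and> dist m y = (1 - t) * dist x y"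

lemma between_same_iff [simp]: "between t x m x \<longleftrightarrow> m = x"
  unfolding between_def by (metis dist_self mult_zero_right zero_less_dist_iff less_irrefl)

lemma geodesic_on_unit_interval:
  assumes "geodesic g 0 1" "s \<in> {0..1}" "t \<in> {0..1}"
  shows "dist (g s) (g t) = dist (g 0) (g 1) * \<bar>s - t\<bar>"
proof -
  obtain c where c: "\<forall>s\<in>{0..1}. \<forall>t\<in>{0..1}. dist (g s) (g t) = c * \<bar>s - t\<bar>"
    using assms unfolding geodesic_def by blast
  then have "dist (g 0) (g 1) = c" by simp
  then show ?thesis using c assms by simp
qed

lemma between_exists:
  assumes "geodesic_space TYPE('a::metric_space)" "0 \<le> t" "t \<le> 1"
  shows "\<exists>m. between t x m (y::'a)"
proof -
  obtain g where g: "geodesic g 0 1" "g 0 = x" "g 1 = y"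
    using assms unfolding geodesic_space_def by blast
  have "between t x (g t) y"
    using geodesic_on_unit_interval[OF g(1), of 0 t] geodesic_on_unit_interval[OF g(1), of t 1] g assms
    unfolding between_def by (simp add: algebra_simps)
  then show ?thesis by blast
qed

text \<open>Geodesics from \<open>x\<close> to \<open>m\<close> and from \<open>m\<close> to
  \<open>y\<close> concatenate to a geodesic: across \<open>m\<close> the triangle inequality bounds
  distances from above, and the total length bounds them from below. So the curvature bound and
  affinity, which are stated for geodesics, apply to every dividing point.\<close>

lemma between_on_geodesic:
  assumes gs: "geodesic_space TYPE('a::metric_space)" and t: "0 \<le> t" "t \<le> 1"
    and b: "between t x m (y::'a)"
  shows "\<exists>g. geodesic g 0 1 \<and> g 0 = x \<and> g 1 = y \<and> g t = m"
proof -
  consider "t = 0" | "t = 1" | "0 < t" "t < 1" using t by fastforce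
  then show ?thesis
  proof cases
    case 1
    then have "m = x" using b unfolding between_def by simp
    then show ?thesis using gs 1 unfolding geodesic_space_def by blast
  next
    case 2
    then have "m = y" using b unfolding between_def by simp
    then show ?thesis using gs 2 unfolding geodesic_space_def by blast
  next
    case 3
    obtain g1 where g1: "geodesic g1 0 1" "g1 0 = x" "g1 1 = m"
      using gs unfolding geodesic_space_def by blast
    obtain g2 where g2: "geodesic g2 0 1" "g2 0 = m" "g2 1 = y"
      using gs unfolding geodesic_space_def by blast
    define g where "g s = (if s \<le> t then g1 (s / t) else g2 ((s - t) / (1 - t)))" for s
    define Z where "Z = dist x y"
    have Z1: "dist x m = t * Z" and Z2: "dist m y = (1 - t) * Z"
      using b unfolding between_def Z_def by auto
    have d1: "dist (g a) (g c) = Z * \<bar>a - c\<bar>" if "0 \<le> a" "a \<le> t" "0 \<le> c" "c \<le> t" for a c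
    proof -
      have "dist (g a) (g c) = t * Z * \<bar>a / t - c / t\<bar>"
        using geodesic_on_unit_interval[OF g1(1), of "a/t" "c/t"] that 3 g1 Z1 unfolding g_def by simp
      also have "\<dots> = Z * \<bar>a - c\<bar>"
        using 3 by (simp add: diff_divide_distrib[symmetric] abs_divide)
      finally show ?thesis .
    qed
    have gt2: "g s = g2 ((s - t) / (1 - t))" if "t \<le> s" for s
      using that g1 g2 3 unfolding g_def by (cases "s = t") auto
    have d2: "dist (g a) (g c) = Z * \<bar>a - c\<bar>" if "t \<le> a" "a \<le> 1" "t \<le> c" "c \<le> 1" for a c
    proof -
      have "dist (g a) (g c) = (1 - t) * Z * \<bar>(a - t) / (1 - t) - (c - t) / (1 - t)\<bar>"
        using geodesic_on_unit_interval[OF g2(1), of "(a-t)/(1-t)" "(c-t)/(1-t)"] that 3 g2 Z2 gt2 by simp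
      also have "\<dots> = Z * \<bar>a - c\<bar>"
        using 3 by (simp add: diff_divide_distrib[symmetric] abs_divide)
      finally show ?thesis .
    qed
    have g01: "g 0 = x" "g 1 = y" "g t = m" using 3 g1 g2 unfolding g_def by auto
    have d3: "dist (g a) (g c) = Z * (c - a)" if "0 \<le> a" "a \<le> t" "t \<le> c" "c \<le> 1" for a c
    proof -
      have "dist (g a) (g c) \<le> dist (g a) (g t) + dist (g t) (g c)" by (rule dist_triangle)
      also have "\<dots> = Z * (c - a)"
        using d1[of a t] d2[of t c] that 3 by (simp add: algebra_simps)
      finally have up: "dist (g a) (g c) \<le> Z * (c - a)" .
      have "Z \<le> dist (g 0) (g a) + dist (g a) (g c) + dist (g c) (g 1)"
        unfolding Z_def g01(1,2)[symmetric]
        using dist_triangle[of "g 0" "g 1" "g a"] dist_triangle[of "g a" "g 1" "g c"] by linarith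
      also have "\<dots> = Z * a + dist (g a) (g c) + Z * (1 - c)"
        using d1[of 0 a] d2[of c 1] that 3 by simp
      finally show ?thesis using up by (simp add: algebra_simps)
    qed
    have "dist (g a) (g c) = Z * \<bar>a - c\<bar>" if "a \<in> {0..1}" "c \<in> {0..1}" for a c
    proof -
      consider "a \<le> t" "c \<le> t" | "t \<le> a" "t \<le> c" | "a \<le> t" "t \<le> c" | "c \<le> t" "t \<le> a" by linarith
      then show ?thesis
      proof cases
        case 1 then show ?thesis using d1 that by auto
      next
        case 2 then show ?thesis using d2 that by auto
      next
        case 3 then show ?thesis using d3[of a c] that by auto
      next
        case 4 then show ?thesis using d3[of c a] that by (auto simp: dist_commute)
      qed
    qed
    then have "geodesic g 0 1" unfolding geodesic_def by auto
    then show ?thesis using g01 by blast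
  qed
qed

lemma affine_fun_between:
  assumes "geodesic_space TYPE('a::metric_space)" "affine_fun f" "0 \<le> t" "t \<le> 1" "between t x m (y::'a)"
  shows "f m = (1 - t) * f x + t * f y"
proof -
  obtain g where g: "geodesic g 0 1" "g 0 = x" "g 1 = y" "g t = m"
    using between_on_geodesic[OF assms(1,3,4,5)] by blast
  have "f (g ((1 - t) * 0 + t * 1)) = (1 - t) * f (g 0) + t * f (g 1)"
    using assms(2,3,4) g(1) unfolding affine_fun_def by (meson atLeastAtMost_iff order_refl zero_le_one)
  then show ?thesis using g by simp
qed

lemma curv_ge_between:
  assumes "geodesic_space TYPE('a::metric_space)" "curv_ge TYPE('a) k" "0 \<le> t" "t \<le> 1"
    "between t q m (r::'a)" "q \<noteq> r" "k > 0 \<longrightarrow> dist p q + dist p r + dist q r < 2 * pi / sqrt k"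
  shows "model_cmp k (dist p q) (dist p r) (dist q r) (t * dist q r) \<le> dist p m"
proof -
  obtain g where g: "geodesic g 0 1" "g 0 = q" "g 1 = r" "g t = m"
    using between_on_geodesic[OF assms(1,3,4,5)] by blast
  show ?thesis using assms g unfolding curv_ge_def by (metis atLeastAtMost_iff)
qed

lemma scaled_triangle:
  assumes "0 < c"
  shows "\<bar>c * dist p q - c * dist q r\<bar> \<le> c * dist p r"
proof -
  have "\<bar>dist p q - dist q r\<bar> \<le> dist p r"
    using dist_triangle[of p q r] dist_triangle[of q r p] by (simp add: abs_le_iff dist_commute)
  then have "c * \<bar>dist p q - dist q r\<bar> \<le> c * dist p r" using assms by simp
  then show ?thesis using assms by (simp add: abs_mult flip: right_diff_distrib)
qed

section \<open>The comparison inequality in a form uniform in the sign of the curvature\<close>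

lemma cosh_le_quadratic:
  fixes y :: real
  assumes "\<bar>y\<bar> \<le> 1"
  shows "cosh y \<le> 1 + y\<^sup>2"
proof -
  have *: "cosh z \<le> 1 + z\<^sup>2" if "0 \<le> z" "z \<le> 1" for z :: real
  proof -
    have "exp z \<le> 1 + z + z\<^sup>2" using exp_bound that by blast
    moreover have "exp (-z) \<le> 1 - z + z\<^sup>2"
    proof -
      have "exp (-z) = 1 / exp z" by (simp add: exp_minus field_simps)
      also have "\<dots> \<le> 1 / (1 + z)"
        using exp_ge_add_one_self[of z] that by (intro divide_left_mono) (auto simp: add_pos_nonneg)
      also have "\<dots> \<le> 1 - z + z\<^sup>2"
      proof -
        have "1 \<le> (1 - z + z\<^sup>2) * (1 + z)"
          using that zero_le_power[of z 3] by (simp add: algebra_simps power2_eq_square power3_eq_cube)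
        then show ?thesis using that by (simp add: divide_le_eq)
      qed
      finally show ?thesis .
    qed
    ultimately show ?thesis unfolding cosh_def by simp
  qed
  show ?thesis using *[of "\<bar>y\<bar>"] assms by (simp add: abs_if split: if_splits)
qed

text \<open>The function \<open>md\<close> is the second integral of the generalised cosine \<open>cn\<close>. The comparison
  distance is encoded in the form that treats the three signs of the curvature uniformly and
  contains no division by the generalised sine of a side that may vanish.\<close>

definition model_functions :: "real \<Rightarrow> real \<Rightarrow> (real \<Rightarrow> real) \<Rightarrow> (real \<Rightarrow> real) \<Rightarrow> (real \<Rightarrow> real) \<Rightarrow> bool" where
  "model_functions K R md sn cn \<longleftrightarrow> 0 < R \<and> 0 \<le> K \<and>
     (\<forall>x. (md has_real_derivative sn x) (at x)) \<and> (\<forall>x. (sn has_real_derivative cn x) (at x)) \<and>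
     md 0 = 0 \<and> sn 0 = 0 \<and> (\<forall>x. md (- x) = md x) \<and> (\<forall>x. \<bar>x\<bar> \<le> R \<longrightarrow> \<bar>cn x - 1\<bar> \<le> K * x\<^sup>2)"

text \<open>In the model plane \<open>md\<close> of the distance to \<open>p\<close>, as a function
  \<open>h\<close> of the arclength \<open>s\<close> along the side from \<open>q\<close>, solves
  \<open>h'' + k h = 1\<close>. So does \<open>md (dist p q - s)\<close>, with the same value at
  \<open>s = 0\<close>. Their difference solves the homogeneous equation and vanishes at 0, hence is
  a multiple of \<open>sn s\<close>; the value at the endpoint \<open>r\<close> fixes the
  factor.\<close>

definition model_comparison ::
  "'a::metric_space itself \<Rightarrow> real \<Rightarrow> (real \<Rightarrow> real) \<Rightarrow> (real \<Rightarrow> real) \<Rightarrow> bool" where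
  "model_comparison _ R md sn \<longleftrightarrow> (\<forall>(p::'a) q r m t. 0 \<le> t \<and> t \<le> 1 \<and> between t q m r \<and> q \<noteq> r \<and>
     dist p q \<le> R \<and> dist p r \<le> R \<and> dist q r \<le> R \<longrightarrow>
     md (dist p m) \<ge> md (dist p q - t * dist q r)
       + sn (t * dist q r) / sn (dist q r) * (md (dist p r) - md (dist p q - dist q r)))"

lemma model_comparison_flat:
  assumes "geodesic_space TYPE('a::metric_space)" "curv_ge TYPE('a) 0"
  shows "model_functions 0 1 (\<lambda>x. x\<^sup>2 / 2) (\<lambda>x. x) (\<lambda>x. 1)"
    and "model_comparison TYPE('a) 1 (\<lambda>x. x\<^sup>2 / 2) (\<lambda>x. x)"
proof -
  show "model_functions 0 1 (\<lambda>x. x\<^sup>2 / 2) (\<lambda>x. x) (\<lambda>x. 1)"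
    unfolding model_functions_def by (auto intro!: derivative_eq_intros)
  show "model_comparison TYPE('a) 1 (\<lambda>x. x\<^sup>2 / 2) (\<lambda>x. x)"
    unfolding model_comparison_def
  proof (intro allI impI, elim conjE)
    fix p q r m :: 'a and t :: real
    assume t: "0 \<le> t" "t \<le> 1" and b: "between t q m r" "q \<noteq> r"
    define X Y Z where "X = dist p q" and "Y = dist p r" and "Z = dist q r"
    have Z: "Z > 0" unfolding Z_def using b by simp
    have "sqrt (((Z - t * Z) * X\<^sup>2 + t * Z * Y\<^sup>2) / Z - t * Z * (Z - t * Z)) \<le> dist p m"
      using curv_ge_between[OF assms t b, of p] unfolding model_cmp_def X_def Y_def Z_def by simp
    then have "((Z - t * Z) * X\<^sup>2 + t * Z * Y\<^sup>2) / Z - t * Z * (Z - t * Z) \<le> (dist p m)\<^sup>2"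
      using sqrt_le_D by blast
    moreover have "((Z - t * Z) * X\<^sup>2 + t * Z * Y\<^sup>2) / Z = (1 - t) * X\<^sup>2 + t * Y\<^sup>2"
      using Z by (simp add: field_simps)
    moreover have "(X - t * Z)\<^sup>2 / 2 + t * Z / Z * (Y\<^sup>2 / 2 - (X - Z)\<^sup>2 / 2) =
        ((1 - t) * X\<^sup>2 + t * Y\<^sup>2 - t * Z * (Z - t * Z)) / 2"
      using Z by (simp add: field_simps power2_eq_square)
    ultimately show "(X - t * Z)\<^sup>2 / 2 + t * Z / Z * (Y\<^sup>2 / 2 - (X - Z)\<^sup>2 / 2) \<le> (dist p m)\<^sup>2 / 2"
      by simp
  qed
qed

lemma model_comparison_hyperbolic:
  assumes gs: "geodesic_space TYPE('a::metric_space)" and cu: "curv_ge TYPE('a) k" and k: "k < 0"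
  defines "c \<equiv> sqrt (- k)"
  shows "model_functions (c\<^sup>2) (1 / c) (\<lambda>x. (cosh (c * x) - 1) / c\<^sup>2) (\<lambda>x. sinh (c * x) / c) (\<lambda>x. cosh (c * x))"
    and "model_comparison TYPE('a) (1 / c) (\<lambda>x. (cosh (c * x) - 1) / c\<^sup>2) (\<lambda>x. sinh (c * x) / c)"
proof -
  have c: "c > 0" unfolding c_def using k by simp
  have "\<bar>cosh (c * x) - 1\<bar> \<le> c\<^sup>2 * x\<^sup>2" if "\<bar>x\<bar> \<le> 1 / c" for x
  proof -
    have "\<bar>c * x\<bar> \<le> 1" using that c by (simp add: abs_mult field_simps)
    then show ?thesis using cosh_le_quadratic[of "c * x"] cosh_real_ge_1[of "c * x"]
      by (simp add: power_mult_distrib)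
  qed
  then show "model_functions (c\<^sup>2) (1 / c) (\<lambda>x. (cosh (c * x) - 1) / c\<^sup>2) (\<lambda>x. sinh (c * x) / c) (\<lambda>x. cosh (c * x))"
    unfolding model_functions_def using c
    by (auto intro!: derivative_eq_intros simp: power2_eq_square)
  show "model_comparison TYPE('a) (1 / c) (\<lambda>x. (cosh (c * x) - 1) / c\<^sup>2) (\<lambda>x. sinh (c * x) / c)"
    unfolding model_comparison_def
  proof (intro allI impI, elim conjE)
    fix p q r m :: 'a and t :: real
    assume t: "0 \<le> t" "t \<le> 1" and b: "between t q m r" "q \<noteq> r"
    define X Y Z s where "X = c * dist p q" and "Y = c * dist p r" and "Z = c * dist q r"
      and "s = t * Z"
    have Z: "Z > 0" unfolding Z_def using b c by simp
    have s: "0 \<le> s" "s \<le> Z" unfolding s_def using t Z by (auto simp: mult_left_le_one_le)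
    have tri: "\<bar>X - Z\<bar> \<le> Y"
      unfolding X_def Y_def Z_def using scaled_triangle[OF c] .
    define A where "A = (sinh (Z - s) * cosh X + sinh s * cosh Y) / sinh Z"
    have shZ: "sinh Z > 0" using Z by simp
    \<comment> \<open>The addition theorem behind the encoding: for the degenerate triangle with
      third side \<open>\<bar>X - Z\<bar>\<close> the model formula gives
      \<open>cosh (X - s)\<close>. The rewritten form also shows \<open>1 \<le> A\<close>, which is
      required to undo \<open>arcosh\<close>.\<close>
    have id: "sinh (Z - s) * cosh X + sinh s * cosh (X - Z) = sinh Z * cosh (X - s)"
    proof -
      have "sinh (Z - s) * cosh X + sinh s * cosh (X - Z) - sinh Z * cosh (X - s)
= 0"
        by (simp add: sinh_diff cosh_diff algebra_simps)
      then show ?thesis by simp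
    qed
    have A: "A = cosh (X - s) + sinh s / sinh Z * (cosh Y - cosh (X - Z))"
      unfolding A_def using id shZ by (simp add: field_simps)
    have "cosh (X - Z) \<le> cosh Y"
      using tri cosh_real_nonneg_le_iff[of "\<bar>X - Z\<bar>" Y] by (simp add: abs_if split: if_splits)
        (metis cosh_minus minus_diff_eq)
    then have "A \<ge> cosh (X - s)" unfolding A using s shZ by simp
    then have A1: "A \<ge> 1" using cosh_real_ge_1[of "X - s"] by linarith
    have "model_cmp k (dist p q) (dist p r) (dist q r) (t * dist q r) \<le> dist p m"
      using curv_ge_between[OF gs cu t b] k by simp
    moreover have "model_cmp k (dist p q) (dist p r) (dist q r) (t * dist q r) = arcosh A / c"
      using k unfolding model_cmp_def A_def X_def Y_def Z_def s_def c_def by (simp add: algebra_simps)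
    ultimately have "arcosh A \<le> c * dist p m" using c by (simp add: field_simps)
    moreover have "0 \<le> arcosh A" using A1 by simp
    ultimately have "cosh (arcosh A) \<le> cosh (c * dist p m)"
      using c by (intro cosh_real_nonneg_le_iff[THEN iffD2]) auto
    then have "A \<le> cosh (c * dist p m)" using A1 by (simp add: cosh_arcosh_real)
    then have "(A - 1) / c\<^sup>2 \<le> (cosh (c * dist p m) - 1) / c\<^sup>2" using c by (simp add: divide_right_mono)
    moreover have "(A - 1) / c\<^sup>2 = (cosh (c * (dist p q - t * dist q r)) - 1) / c\<^sup>2 + sinh (c * (t * dist q r)) / c /
        (sinh (c * dist q r) / c) * ((cosh (c * dist p r) - 1) / c\<^sup>2 - (cosh (c * (dist p q - dist q r)) - 1) / c\<^sup>2)"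
    proof -
      have "X - s = c * (dist p q - t * dist q r)" "s = c * (t * dist q r)" "X - Z = c * (dist p q - dist q r)"
        unfolding X_def s_def Z_def by (auto simp: algebra_simps)
      then show ?thesis unfolding A Y_def[symmetric] Z_def[symmetric] using c
        by (simp add: add_divide_distrib diff_divide_distrib right_diff_distrib)
    qed
    ultimately show "(cosh (c * (dist p q - t * dist q r)) - 1) / c\<^sup>2 + sinh (c * (t * dist q r)) / c /
        (sinh (c * dist q r) / c) * ((cosh (c * dist p r) - 1) / c\<^sup>2 - (cosh (c * (dist p q - dist q r)) - 1) / c\<^sup>2)
        \<le> (cosh (c * dist p m) - 1) / c\<^sup>2" by simp
  qed
qed

text \<open>The bound \<open>1 / (2 * c)\<close> on the sides keeps the perimeter below
  \<open>2 * pi / c\<close>, so that the curvature bound applies, makes the sines that occur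
  nonnegative, and gives \<open>c * dist p m \<le> 1\<close>, inside the interval on which
  \<open>cos\<close> decreases.\<close>

lemma model_comparison_spherical:
  assumes gs: "geodesic_space TYPE('a::metric_space)" and cu: "curv_ge TYPE('a) k" and k: "k > 0"
  defines "c \<equiv> sqrt k"
  shows "model_functions (c\<^sup>2) (1 / (2 * c)) (\<lambda>x. (1 - cos (c * x)) / c\<^sup>2) (\<lambda>x. sin (c * x) / c) (\<lambda>x. cos (c * x))"
    and "model_comparison TYPE('a) (1 / (2 * c)) (\<lambda>x. (1 - cos (c * x)) / c\<^sup>2) (\<lambda>x. sin (c * x) / c)"
proof -
  have c: "c > 0" unfolding c_def using k by simp
  have "\<bar>cos (c * x) - 1\<bar> \<le> c\<^sup>2 * x\<^sup>2" for x
  proof -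
    have "1 - cos (c * x) = 2 * (sin (c * x / 2))\<^sup>2"
      using cos_double_sin[of "c * x / 2"] by simp
    also have "\<dots> \<le> 2 * (c * x / 2)\<^sup>2"
      using abs_le_square_iff[THEN iffD1, OF abs_sin_x_le_abs_x[of "c * x / 2"]] by simp
    also have "\<dots> = c\<^sup>2 * x\<^sup>2 / 2" by (simp add: power2_eq_square)
    also have "\<dots> \<le> c\<^sup>2 * x\<^sup>2" by simp
    finally show ?thesis using cos_le_one[of "c * x"] by simp
  qed
  then show "model_functions (c\<^sup>2) (1 / (2 * c)) (\<lambda>x. (1 - cos (c * x)) / c\<^sup>2) (\<lambda>x. sin (c * x) / c) (\<lambda>x. cos (c * x))"
    unfolding model_functions_def using c
    by (auto intro!: derivative_eq_intros simp: power2_eq_square)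
  show "model_comparison TYPE('a) (1 / (2 * c)) (\<lambda>x. (1 - cos (c * x)) / c\<^sup>2) (\<lambda>x. sin (c * x) / c)"
    unfolding model_comparison_def
  proof (intro allI impI, elim conjE)
    fix p q r m :: 'a and t :: real
    assume t: "0 \<le> t" "t \<le> 1" and b: "between t q m r" "q \<noteq> r"
      and d: "dist p q \<le> 1 / (2 * c)" "dist p r \<le> 1 / (2 * c)" "dist q r \<le> 1 / (2 * c)"
    define X Y Z s where "X = c * dist p q" and "Y = c * dist p r" and "Z = c * dist q r"
      and "s = t * Z"
    have small: "X \<le> 1 / 2" "Y \<le> 1 / 2" "Z \<le> 1 / 2"
      using d c unfolding X_def Y_def Z_def by (auto simp: field_simps)
    have nn: "X \<ge> 0" "Y \<ge> 0" unfolding X_def Y_def using c by auto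
    have pi: "pi > 3" using pi_gt3 by simp
    have Z: "Z > 0" unfolding Z_def using b c by simp
    have s: "0 \<le> s" "s \<le> Z" unfolding s_def using t Z by (auto simp: mult_left_le_one_le)
    have tri: "\<bar>X - Z\<bar> \<le> Y"
      unfolding X_def Y_def Z_def using scaled_triangle[OF c] .
    define A where "A = (sin (Z - s) * cos X + sin s * cos Y) / sin Z"
    have shZ: "sin Z > 0" using Z small pi by (intro sin_gt_zero) auto
    have sns: "sin s \<ge> 0" using s small pi by (intro sin_ge_zero) auto
    have snZs: "sin (Z - s) \<ge> 0" using s small pi by (intro sin_ge_zero) auto
    have id: "sin (Z - s) * cos X + sin s * cos (X - Z) = sin Z * cos (X - s)"
    proof -
      have "sin (Z - s) * cos X + sin s * cos (X - Z) - sin Z * cos (X - s) = 0"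
        by (simp add: sin_diff cos_diff algebra_simps)
      then show ?thesis by simp
    qed
    have A: "A = cos (X - s) + sin s / sin Z * (cos Y - cos (X - Z))"
      unfolding A_def using id shZ by (simp add: field_simps)
    have "cos Y \<le> cos \<bar>X - Z\<bar>"
      using tri small pi nn by (intro cos_monotone_0_pi_le) auto
    then have "cos Y - cos (X - Z) \<le> 0" by simp
    then have "sin s / sin Z * (cos Y - cos (X - Z)) \<le> 0"
      using sns shZ by (intro mult_nonneg_nonpos) auto
    then have A1: "A \<le> 1" unfolding A using cos_le_one[of "X - s"] by linarith
    have "cos X \<ge> 0" "cos Y \<ge> 0" using nn small pi by (auto intro!: cos_ge_zero)
    then have A0: "A \<ge> 0" unfolding A_def using sns snZs shZ by simp
    have "dist p q + dist p r + dist q r < 2 * pi / sqrt k"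
    proof -
      have "dist p q + dist p r + dist q r \<le> 3 * (1 / (2 * c))" using d by simp
      also have "\<dots> < 2 * pi / c" using c pi by (simp add: field_simps)
      finally show ?thesis unfolding c_def .
    qed
    then have "model_cmp k (dist p q) (dist p r) (dist q r) (t * dist q r) \<le> dist p m"
      using curv_ge_between[OF gs cu t b] by simp
    moreover have "model_cmp k (dist p q) (dist p r) (dist q r) (t * dist q r) = arccos A / c"
      using k unfolding model_cmp_def A_def X_def Y_def Z_def s_def c_def by (simp add: algebra_simps)
    ultimately have le: "arccos A \<le> c * dist p m" using c by (simp add: field_simps)
    have "dist p m \<le> dist p q + t * dist q r"
      using dist_triangle[of p m q] b(1) unfolding between_def by simp
    also have "\<dots> \<le> dist p q + dist q r" using t by (simp add: mult_left_le_one_le)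
    also have "\<dots> \<le> 1 / c" using d by (simp add: field_simps)
    finally have "c * dist p m \<le> 1" using c by (simp add: field_simps)
    then have "cos (c * dist p m) \<le> cos (arccos A)"
      using le A0 A1 pi by (intro cos_monotone_0_pi_le) (auto intro: arccos_lbound)
    then have "cos (c * dist p m) \<le> A" using A0 A1 by (simp add: cos_arccos)
    then have "(1 - A) / c\<^sup>2 \<le> (1 - cos (c * dist p m)) / c\<^sup>2" using c by (simp add: divide_right_mono)
    moreover have "(1 - A) / c\<^sup>2 = (1 - cos (c * (dist p q - t * dist q r))) / c\<^sup>2 + sin (c * (t * dist q r)) / c /
        (sin (c * dist q r) / c) * ((1 - cos (c * dist p r)) / c\<^sup>2 - (1 - cos (c * (dist p q - dist q r))) / c\<^sup>2)"
    proof -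
      have "X - s = c * (dist p q - t * dist q r)" "s = c * (t * dist q r)" "X - Z = c * (dist p q - dist q r)"
        unfolding X_def s_def Z_def by (auto simp: algebra_simps)
      then show ?thesis unfolding A Y_def[symmetric] Z_def[symmetric] using c
        by (simp add: add_divide_distrib diff_divide_distrib right_diff_distrib)
    qed
    ultimately show "(1 - cos (c * (dist p q - t * dist q r))) / c\<^sup>2 + sin (c * (t * dist q r)) / c /
        (sin (c * dist q r) / c) * ((1 - cos (c * dist p r)) / c\<^sup>2 - (1 - cos (c * (dist p q - dist q r))) / c\<^sup>2)
        \<le> (1 - cos (c * dist p m)) / c\<^sup>2" by simp
  qed
qed

lemma curv_ge_model_comparison:
  assumes "geodesic_space TYPE('a::metric_space)" "curv_ge TYPE('a) k"
  obtains K R md sn cn where "model_functions K R md sn cn" "model_comparison TYPE('a) R md sn"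
proof -
  consider "k = 0" | "k < 0" | "k > 0" by linarith
  then show ?thesis
  proof cases
    case 1 then show ?thesis using model_comparison_flat[where 'a='a] assms that by blast
  next
    case 2 then show ?thesis using model_comparison_hyperbolic[where 'a='a and k=k] assms that by blast
  next
    case 3 then show ?thesis using model_comparison_spherical[where 'a='a and k=k] assms that by blast
  qed
qed

section \<open>Estimates on scale r for the model functions, and their metric consequences\<close>

context
  fixes K R r :: real and md sn cn :: "real \<Rightarrow> real"
  assumes model: "model_functions K R md sn cn" and r: "0 \<le> r" "r \<le> R" and Kr: "K * r\<^sup>2 \<le> 1 / 10"
begin

lemma model_cn: "\<bar>x\<bar> \<le> r \<Longrightarrow> \<bar>cn x - 1\<bar> \<le> K * r\<^sup>2"
proof -
  assume x: "\<bar>x\<bar> \<le> r"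
  then have "\<bar>cn x - 1\<bar> \<le> K * x\<^sup>2" using model r unfolding model_functions_def by auto
  also have "\<dots> \<le> K * r\<^sup>2"
    using model x r unfolding model_functions_def by (intro mult_left_mono) (auto simp: abs_le_square_iff[symmetric])
  finally show ?thesis .
qed

lemma model_sn_bounds:
  assumes "0 \<le> x" "x \<le> r"
  shows "(1 - K * r\<^sup>2) * x \<le> sn x" "sn x \<le> (1 + K * r\<^sup>2) * x"
proof -
  have "(1 - K * r\<^sup>2) * x \<le> sn x \<and> sn x \<le> (1 + K * r\<^sup>2) * x"
  proof (cases "x = 0")
    case True then show ?thesis using model unfolding model_functions_def by simp
  next
    case False
    then have "0 < x" using assms by simp
    then obtain z where z: "0 < z" "z < x" "sn x - sn 0 = (x - 0) * cn z"
      using MVT2[of 0 x sn cn] model unfolding model_functions_def by blast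
    then have "sn x = x * cn z" using model unfolding model_functions_def by simp
    moreover have "\<bar>cn z - 1\<bar> \<le> K * r\<^sup>2" using model_cn[of z] z assms by simp
    ultimately show ?thesis
      using mult_left_mono[of "1 - K * r\<^sup>2" "cn z" x] mult_left_mono[of "cn z" "1 + K * r\<^sup>2" x] assms
      by (simp add: abs_le_iff mult.commute)
  qed
  then show "(1 - K * r\<^sup>2) * x \<le> sn x" "sn x \<le> (1 + K * r\<^sup>2) * x" by auto
qed

lemma model_sn_mono:
  assumes "0 \<le> x" "x \<le> y" "y \<le> r"
  shows "sn x \<le> sn y"
proof (rule DERIV_nonneg_imp_nondecreasing[OF assms(2)])
  fix z assume "x \<le> z" "z \<le> y"
  then have "\<bar>cn z - 1\<bar> \<le> K * r\<^sup>2" using model_cn[of z] assms by simp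
  then have "0 \<le> cn z" using Kr by linarith
  then show "\<exists>d. (sn has_real_derivative d) (at z) \<and> 0 \<le> d"
    using model unfolding model_functions_def by blast
qed

lemma model_sn_nonneg: "0 \<le> x \<Longrightarrow> x \<le> r \<Longrightarrow> 0 \<le> sn x"
  using model_sn_mono[of 0 x] model unfolding model_functions_def by simp

lemma model_sn_pos:
  assumes "0 < x" "x \<le> r"
  shows "0 < sn x"
proof -
  have "0 < (1 - K * r\<^sup>2) * x" using assms Kr by simp
  then show ?thesis using model_sn_bounds(1)[of x] assms by linarith
qed

lemma model_sn_ratio:
  assumes "0 \<le> t" "t \<le> 1" "0 < s" "s \<le> r"
  shows "(1 - 2 * (K * r\<^sup>2)) * t \<le> sn (t * s) / sn s"
proof -
  define \<mu> where "\<mu> = K * r\<^sup>2"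
  have mu: "0 \<le> \<mu>" "\<mu> \<le> 1 / 10" using Kr model unfolding \<mu>_def model_functions_def by auto
  have "t * s \<le> 1 * s" using assms by (intro mult_right_mono) auto
  then have ts: "0 \<le> t * s" "t * s \<le> r" using assms by (simp, linarith)
  have "(1 - 2 * \<mu>) * t * sn s \<le> (1 - 2 * \<mu>) * t * ((1 + \<mu>) * s)"
    using model_sn_bounds(2)[of s] assms mu unfolding \<mu>_def[symmetric] by (intro mult_left_mono) auto
  also have "\<dots> = ((1 - 2 * \<mu>) * (1 + \<mu>)) * (t * s)" by (simp add: algebra_simps)
  also have "\<dots> \<le> (1 - \<mu>) * (t * s)"
    using ts mu by (intro mult_right_mono) (auto simp: algebra_simps)
  also have "\<dots> \<le> sn (t * s)" using model_sn_bounds(1)[of "t * s"] ts unfolding \<mu>_def by simp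
  finally show ?thesis using model_sn_pos[of s] assms unfolding \<mu>_def by (simp add: field_simps)
qed

lemma model_md_diff:
  assumes "0 \<le> x" "x \<le> y" "y \<le> r"
  shows "(y - x) * sn x \<le> md y - md x" "md y - md x \<le> (y - x) * sn y"
proof -
  have "(y - x) * sn x \<le> md y - md x \<and> md y - md x \<le> (y - x) * sn y"
  proof (cases "x = y")
    case False
    then have "x < y" using assms by simp
    then obtain z where z: "x < z" "z < y" "md y - md x = (y - x) * sn z"
      using MVT2[of x y md sn] model unfolding model_functions_def by blast
    then show ?thesis using model_sn_mono[of x z] model_sn_mono[of z y] assms by simp
  qed simp
  then show "(y - x) * sn x \<le> md y - md x" "md y - md x \<le> (y - x) * sn y" by auto
qed

lemma model_md_abs: "md \<bar>x\<bar> = md x"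
  using model unfolding model_functions_def by (simp add: abs_if)

lemma model_md_mono:
  assumes "\<bar>x\<bar> \<le> y" "y \<le> r"
  shows "md x \<le> md y"
proof -
  have "0 \<le> (y - \<bar>x\<bar>) * sn \<bar>x\<bar>" using model_sn_nonneg[of "\<bar>x\<bar>"] assms by simp
  then show ?thesis using model_md_diff(1)[of "\<bar>x\<bar>" y] assms model_md_abs[of x] by simp
qed

lemma model_md_bounds:
  assumes "\<bar>x\<bar> \<le> r"
  shows "(1 - K * r\<^sup>2) * x\<^sup>2 / 2 \<le> md x" "md x \<le> (1 + K * r\<^sup>2) * x\<^sup>2 / 2"
proof -
  define y where "y = \<bar>x\<bar>"
  have y: "0 \<le> y" "y \<le> r" using assms unfolding y_def by auto
  have md0: "md 0 = 0" using model unfolding model_functions_def by simp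
  have "(\<lambda>z. md z - (1 - K * r\<^sup>2) * z\<^sup>2 / 2) 0 \<le> (\<lambda>z. md z - (1 - K * r\<^sup>2) * z\<^sup>2 / 2) y"
  proof (rule DERIV_nonneg_imp_nondecreasing[OF y(1)])
    fix z assume "0 \<le> z" "z \<le> y"
    then have "0 \<le> sn z - (1 - K * r\<^sup>2) * z" using model_sn_bounds(1)[of z] y by simp
    moreover have "((\<lambda>z. md z - (1 - K * r\<^sup>2) * z\<^sup>2 / 2) has_real_derivative sn z - (1 - K * r\<^sup>2) * z) (at z)"
      using model unfolding model_functions_def by (auto intro!: derivative_eq_intros)
    ultimately show "\<exists>d. ((\<lambda>z. md z - (1 - K * r\<^sup>2) * z\<^sup>2 / 2) has_real_derivative d) (at z) \<and> 0 \<le> d" by blast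
  qed
  then show "(1 - K * r\<^sup>2) * x\<^sup>2 / 2 \<le> md x" using md0 model_md_abs[of x] unfolding y_def by simp
  have "(\<lambda>z. (1 + K * r\<^sup>2) * z\<^sup>2 / 2 - md z) 0 \<le> (\<lambda>z. (1 + K * r\<^sup>2) * z\<^sup>2 / 2 - md z) y"
  proof (rule DERIV_nonneg_imp_nondecreasing[OF y(1)])
    fix z assume "0 \<le> z" "z \<le> y"
    then have "0 \<le> (1 + K * r\<^sup>2) * z - sn z" using model_sn_bounds(2)[of z] y by simp
    moreover have "((\<lambda>z. (1 + K * r\<^sup>2) * z\<^sup>2 / 2 - md z) has_real_derivative (1 + K * r\<^sup>2) * z - sn z) (at z)"
      using model unfolding model_functions_def by (auto intro!: derivative_eq_intros)
    ultimately show "\<exists>d. ((\<lambda>z. (1 + K * r\<^sup>2) * z\<^sup>2 / 2 - md z) has_real_derivative d) (at z) \<and> 0 \<le> d" by blast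
  qed
  then show "md x \<le> (1 + K * r\<^sup>2) * x\<^sup>2 / 2" using md0 model_md_abs[of x] unfolding y_def by simp
qed

text \<open>Homotheties are almost expanding: this is the comparison inequality applied on two sides of a
  hinge, once for each arm.\<close>

lemma model_homothety:
  fixes v x y x' y' :: "'a::metric_space"
  assumes cmp: "model_comparison TYPE('a) R md sn"
    and t: "0 \<le> t" "t \<le> 1" and bx: "between t v x' x" and by': "between t v y' y"
    and d: "dist v x \<le> r / 2" "dist v y \<le> r / 2"
  shows "(1 - 4 * (K * r\<^sup>2)) * t * dist x y \<le> dist x' y'"
proof -
  define \<mu> where "\<mu> = K * r\<^sup>2"
  have mu: "0 \<le> \<mu>" "\<mu> \<le> 1 / 10" using Kr model unfolding \<mu>_def model_functions_def by auto
  consider "v = x" | "v = y" | "v \<noteq> x" "v \<noteq> y" by blast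
  then show ?thesis
  proof cases
    case 1
    then have "x' = v" using bx by simp
    then have "dist x' y' = t * dist x y" using by' 1 unfolding between_def by blast
    moreover have "(1 - 4 * \<mu>) * (t * dist x y) \<le> 1 * (t * dist x y)"
      using mu t by (intro mult_right_mono) auto
    ultimately show ?thesis unfolding \<mu>_def by (simp add: mult.assoc)
  next
    case 2
    then have "y' = v" using by' by simp
    then have "dist x' y' = t * dist x y" using bx 2 unfolding between_def by (metis dist_commute)
    moreover have "(1 - 4 * \<mu>) * (t * dist x y) \<le> 1 * (t * dist x y)"
      using mu t by (intro mult_right_mono) auto
    ultimately show ?thesis unfolding \<mu>_def by (simp add: mult.assoc)
  next
    case 3
    define a b c c' c'' where "a = dist v x" and "b = dist v y" and "c = dist x y"
      and "c' = dist y x'" and "c'' = dist x' y'"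
    have ab: "0 < a" "0 < b" "a \<le> r / 2" "b \<le> r / 2" using 3 d unfolding a_def b_def by auto
    have c: "c \<le> r" "\<bar>a - b\<bar> \<le> c"
      unfolding a_def b_def c_def using dist_triangle[of x y v] d dist_triangle[of v x y] dist_triangle[of v y x]
      by (auto simp: abs_le_iff dist_commute)
    have x'v: "dist x' v = t * a" and y'v: "dist v y' = t * b"
      using bx by' unfolding between_def a_def b_def by (auto simp: dist_commute)
    have ta: "0 \<le> t * a" "t * a \<le> a" "0 \<le> t * b" "t * b \<le> b" using t ab by (auto simp: mult_left_le_one_le)
    have c': "c' \<le> r" "\<bar>t * a - b\<bar> \<le> c'"
      unfolding c'_def abs_le_iff
      using dist_triangle[of y x' v] dist_triangle[of v x' y] dist_triangle[of v y x'] x'v ta ab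
        dist_commute[of y x'] dist_commute[of v x'] dist_commute[of v y] b_def by linarith+
    have c'': "c'' \<le> r"
      unfolding c''_def using dist_triangle[of x' y' v] x'v y'v ta ab by linarith
    have E: "0 \<le> md c - md (b - a)"
      using model_md_mono[of "b - a" c] c by (simp add: abs_minus_commute)
    have m1: "md (b - t * a) + sn (t * a) / sn a * (md c - md (b - a)) \<le> md c'"
      using cmp[unfolded model_comparison_def, rule_format, of t v x' x y] t bx 3(1) d c r ab
      unfolding a_def b_def c_def c'_def by (simp add: dist_commute)
    have "dist x' v \<le> R" "dist x' y \<le> R" "dist v y \<le> R"
      using x'v ta ab r c' dist_commute[of y x'] unfolding b_def c'_def by linarith+
    then have "md (dist x' v - t * dist v y) + sn (t * dist v y) / sn (dist v y) *
        (md (dist x' y) - md (dist x' v - dist v y)) \<le> md (dist x' y')"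
      using cmp[unfolded model_comparison_def, rule_format, of t v y' y x'] t by' 3(2) by blast
    then have m2: "md (t * a - t * b) + sn (t * b) / sn b * (md c' - md (t * a - b)) \<le> md c''"
      unfolding x'v b_def c'_def c''_def by (simp add: dist_commute)
    have ra: "(1 - 2 * \<mu>) * t \<le> sn (t * a) / sn a" and rb: "(1 - 2 * \<mu>) * t \<le> sn (t * b) / sn b"
      using model_sn_ratio[of t a] model_sn_ratio[of t b] t ab r unfolding \<mu>_def by auto
    have lam: "0 \<le> (1 - 2 * \<mu>) * t" using mu t by simp
    have "md (b - t * a) = md (t * a - b)" using model_md_abs[of "b - t * a"] model_md_abs[of "t * a - b"]
      by (simp add: abs_minus_commute)
    then have "(1 - 2 * \<mu>) * t * (md c - md (b - a)) \<le> md c' - md (t * a - b)"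
      using m1 mult_right_mono[OF ra E] by linarith
    then have "(1 - 2 * \<mu>) * t * ((1 - 2 * \<mu>) * t * (md c - md (b - a))) \<le> sn (t * b) / sn b * (md c' - md (t * a - b))"
      using mult_mono[OF rb] order_trans[OF lam rb] mult_nonneg_nonneg[OF lam E] by blast
    then have m3: "md (t * a - t * b) + ((1 - 2 * \<mu>) * t)\<^sup>2 * (md c - md (b - a)) \<le> md c''"
      using m2 by (simp add: power2_eq_square mult.assoc)
    have "\<bar>t * a - t * b\<bar> \<le> r" unfolding abs_le_iff using ta ab by linarith
    then have "(1 - \<mu>) * (t * a - t * b)\<^sup>2 / 2 \<le> md (t * a - t * b)"
      using model_md_bounds(1) unfolding \<mu>_def by blast
    then have m4: "t\<^sup>2 * ((1 - \<mu>) * (b - a)\<^sup>2 / 2) \<le> md (t * a - t * b)"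
      by (simp add: power2_eq_square algebra_simps)
    have "\<bar>b - a\<bar> \<le> r" using ab by (auto simp: abs_le_iff)
    then have "md (b - a) \<le> (1 + \<mu>) * (b - a)\<^sup>2 / 2" using model_md_bounds(2) unfolding \<mu>_def by blast
    \<comment> \<open>The collinear parts scale by \<open>t\<^sup>2\<close> exactly in the flat
      case. Here they are only known up to factors \<open>1 - \<mu>\<close> and
      \<open>1 + \<mu>\<close>, and the loss \<open>(1 - 2 * \<mu>)\<^sup>2\<close> from the two
      sine ratios pays for the discrepancy.\<close>
    then have "(1 - 2 * \<mu>)\<^sup>2 * md (b - a) \<le> (1 - 2 * \<mu>)\<^sup>2 * ((1 + \<mu>) * (b - a)\<^sup>2 / 2)"
      by (intro mult_left_mono) auto
    also have "\<dots> = ((1 - 2 * \<mu>)\<^sup>2 * (1 + \<mu>)) * ((b - a)\<^sup>2 / 2)" by simp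
    also have "\<dots> \<le> (1 - \<mu>) * ((b - a)\<^sup>2 / 2)"
    proof (intro mult_right_mono)
      have "(1 - 2 * \<mu>)\<^sup>2 * (1 + \<mu>) = (1 - \<mu>) - 2 * \<mu> * (1 - 2 * \<mu> * \<mu>)"
        by (simp add: power2_eq_square algebra_simps)
      moreover have "\<mu> * \<mu> \<le> 1 / 10 * (1 / 10)" using mu by (intro mult_mono) auto
      ultimately show "(1 - 2 * \<mu>)\<^sup>2 * (1 + \<mu>) \<le> 1 - \<mu>" using mu by simp
    qed auto
    finally have "t\<^sup>2 * ((1 - 2 * \<mu>)\<^sup>2 * md (b - a)) \<le> t\<^sup>2 * ((1 - \<mu>) * ((b - a)\<^sup>2 / 2))"
      by (rule mult_left_mono) simp
    then have "t\<^sup>2 * ((1 - 2 * \<mu>)\<^sup>2 * md (b - a)) \<le> md (t * a - t * b)" using m4 by simp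
    then have "((1 - 2 * \<mu>) * t)\<^sup>2 * md (b - a) \<le> md (t * a - t * b)"
      by (simp add: power_mult_distrib mult.commute mult.left_commute)
    then have m5: "((1 - 2 * \<mu>) * t)\<^sup>2 * md c \<le> md c''"
      using m3 by (simp add: right_diff_distrib)
    have "(1 - \<mu>) * c\<^sup>2 / 2 \<le> md c" using model_md_bounds(1)[of c] c unfolding \<mu>_def by auto
    moreover have "md c'' \<le> (1 + \<mu>) * c''\<^sup>2 / 2"
      using model_md_bounds(2)[of c''] c'' unfolding \<mu>_def c''_def by auto
    ultimately have "((1 - 2 * \<mu>) * t)\<^sup>2 * ((1 - \<mu>) * c\<^sup>2 / 2) \<le> (1 + \<mu>) * c''\<^sup>2 / 2"
      using m5 mult_left_mono[of "(1 - \<mu>) * c\<^sup>2 / 2" "md c" "((1 - 2 * \<mu>) * t)\<^sup>2"] by simp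
    then have m6: "(1 - \<mu>) * ((1 - 2 * \<mu>) * t * c)\<^sup>2 \<le> (1 + \<mu>) * c''\<^sup>2"
      by (simp add: power_mult_distrib mult_ac)
    have "(1 + \<mu>) * ((1 - 2 * \<mu>) * ((1 - 2 * \<mu>) * t * c))\<^sup>2 = ((1 - 2 * \<mu>)\<^sup>2 * (1 + \<mu>)) * ((1 - 2 * \<mu>) * t * c)\<^sup>2"
      by (simp add: power_mult_distrib)
    also have "\<dots> \<le> (1 - \<mu>) * ((1 - 2 * \<mu>) * t * c)\<^sup>2"
    proof (intro mult_right_mono)
      have "(1 - 2 * \<mu>)\<^sup>2 * (1 + \<mu>) = (1 - \<mu>) - 2 * \<mu> * (1 - 2 * \<mu> * \<mu>)"
        by (simp add: power2_eq_square algebra_simps)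
      moreover have "\<mu> * \<mu> \<le> 1 / 10 * (1 / 10)" using mu by (intro mult_mono) auto
      ultimately show "(1 - 2 * \<mu>)\<^sup>2 * (1 + \<mu>) \<le> 1 - \<mu>" using mu by simp
    qed auto
    also note m6
    finally have "((1 - 2 * \<mu>) * ((1 - 2 * \<mu>) * t * c))\<^sup>2 \<le> c''\<^sup>2" using mu by simp
    then have "(1 - 2 * \<mu>) * ((1 - 2 * \<mu>) * t * c) \<le> c''"
      by (rule power2_le_imp_le) (simp add: c''_def)
    moreover have "(1 - 4 * \<mu>) * (t * c) \<le> ((1 - 2 * \<mu>) * (1 - 2 * \<mu>)) * (t * c)"
      using t mu by (intro mult_right_mono) (auto simp: algebra_simps c_def)
    ultimately show ?thesis unfolding \<mu>_def c_def c''_def by (simp add: mult.assoc)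
  qed
qed

text \<open>In the plane this is the median formula for the triangle \<open>q\<close>,
  \<open>x\<close>, \<open>a\<close> with midpoint \<open>y\<close>, as an equality without error
  term. The curvature bound makes the median at least as long as its comparison median, which bounds
  the two sides from above.\<close>

lemma model_midpoint:
  fixes q x y a :: "'a::metric_space"
  assumes cmp: "model_comparison TYPE('a) R md sn" and b: "between (1/2) x y a"
    and d: "dist q y \<le> r / 2" "dist x y \<le> r / 2"
  shows "(dist q x)\<^sup>2 + (dist q a)\<^sup>2 \<le> 2 * (dist q y)\<^sup>2 + 2 * (dist x y)\<^sup>2 + 8 * (K * r\<^sup>2) * (dist q y + dist x y)\<^sup>2"
proof -
  define \<mu> where "\<mu> = K * r\<^sup>2"
  have mu: "0 \<le> \<mu>" "\<mu> \<le> 1 / 10" using Kr model unfolding \<mu>_def model_functions_def by auto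
  define h e X Y Q where "h = dist x y" and "e = dist q y" and "X = dist q x" and "Y = dist q a"
    and "Q = (e + h)\<^sup>2"
  have xa: "dist x a = 2 * h" and ya: "dist y a = h" using b unfolding between_def h_def by auto
  show ?thesis
  proof (cases "h = 0")
    case True
    then have "x = y" "a = y" using xa ya unfolding h_def by auto
    then show ?thesis using mu unfolding \<mu>_def by simp
  next
    case False
    then have h: "0 < h" "h \<le> r / 2" using d unfolding h_def by auto
    have XY: "0 \<le> X" "X \<le> e + h" "0 \<le> Y" "Y \<le> e + h" "\<bar>X - 2 * h\<bar> \<le> Y" "\<bar>X - h\<bar> \<le> e" "0 \<le> e"
      unfolding X_def Y_def e_def h_def
      using dist_triangle[of q x y] dist_triangle[of q a y] dist_triangle[of x a q] dist_triangle[of q x a]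
        xa ya dist_triangle[of q y x] dist_triangle[of x y q]
      by (auto simp: abs_le_iff dist_commute h_def)
    have er: "e + h \<le> r" using d unfolding e_def h_def by simp
    have "x \<noteq> a" using xa h by auto
    then have m: "md (X - h) + sn h / sn (2 * h) * (md Y - md (X - 2 * h)) \<le> md e"
      using cmp[unfolded model_comparison_def, rule_format, of "1/2" x y a q] b XY er r h
      unfolding X_def Y_def e_def by (simp add: xa)
    have E: "0 \<le> md Y - md (X - 2 * h)" using model_md_mono[of "X - 2 * h" Y] XY er by simp
    have "(1 - 2 * \<mu>) * (1/2) \<le> sn h / sn (2 * h)"
      using model_sn_ratio[of "1/2" "2 * h"] h unfolding \<mu>_def by simp
    then have "md (X - h) + (1 - 2 * \<mu>) * (1/2) * (md Y - md (X - 2 * h)) \<le> md e"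
      using m mult_right_mono[OF _ E, of "(1 - 2 * \<mu>) * (1/2)" "sn h / sn (2 * h)"] by linarith
    moreover have "(1 - \<mu>) * (X - h)\<^sup>2 / 2 \<le> md (X - h)"
      using model_md_bounds(1)[of "X - h"] XY er h unfolding \<mu>_def by auto
    moreover have "md e \<le> (1 + \<mu>) * e\<^sup>2 / 2" using model_md_bounds(2)[of e] XY er h unfolding \<mu>_def by auto
    moreover have "(1 - 2 * \<mu>) * (1/2) * ((1 - \<mu>) * Y\<^sup>2 / 2 - (1 + \<mu>) * (X - 2 * h)\<^sup>2 / 2)
        \<le> (1 - 2 * \<mu>) * (1/2) * (md Y - md (X - 2 * h))"
      using model_md_bounds(1)[of Y] model_md_bounds(2)[of "X - 2 * h"] XY er mu unfolding \<mu>_def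
      by (intro mult_left_mono) auto
    ultimately have m2: "(1 - \<mu>) * (X - h)\<^sup>2 / 2 +
      (1 - 2 * \<mu>) * (1/2) * ((1 - \<mu>) * Y\<^sup>2 / 2 - (1 + \<mu>) * (X - 2 * h)\<^sup>2 / 2) \<le> (1 + \<mu>) * e\<^sup>2 / 2" by linarith
    have Q: "Y\<^sup>2 \<le> Q" "(X - h)\<^sup>2 \<le> Q" "(X - 2 * h)\<^sup>2 \<le> Q" "e\<^sup>2 \<le> Q"
      unfolding Q_def using XY h by (auto intro!: power2_le_iff_abs_le[THEN iffD2] simp: power_mono)
    \<comment> \<open>Algebra that separates the flat part: the left side becomes
      \<open>(X\<^sup>2 + Y\<^sup>2) / 2 - h\<^sup>2\<close>, and what remains besides the
      comparison inequality is a multiple of \<mu>, controlled by \<open>Q\<close>.\<close>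
    have "A + B / 2 - C / 2 =
      ((1 - \<mu>) * A + (1 - 2 * \<mu>) * ((1 - \<mu>) * B / 2 - (1 + \<mu>) * C / 2))
      + \<mu> * A + \<mu> * (3/2 - \<mu>) * B - \<mu> * (1/2 + \<mu>) * C" for A B C
      by (simp add: field_simps)
    then have "(X - h)\<^sup>2 + Y\<^sup>2 / 2 - (X - 2 * h)\<^sup>2 / 2 =
      ((1 - \<mu>) * (X - h)\<^sup>2 + (1 - 2 * \<mu>) * ((1 - \<mu>) * Y\<^sup>2 / 2 - (1 + \<mu>) * (X - 2 * h)\<^sup>2 / 2))
      + \<mu> * (X - h)\<^sup>2 + \<mu> * (3/2 - \<mu>) * Y\<^sup>2 - \<mu> * (1/2 + \<mu>) * (X - 2 * h)\<^sup>2" .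
    also have "\<dots> \<le> (1 + \<mu>) * e\<^sup>2 + \<mu> * Q + 2 * \<mu> * Q"
    proof -
      have "\<mu> * (3/2 - \<mu>) \<le> \<mu> * 2" using mu by (intro mult_left_mono) auto
      then have "\<mu> * (3/2 - \<mu>) * Y\<^sup>2 \<le> 2 * \<mu> * Q" using mult_mono[of "\<mu> * (3/2 - \<mu>)" "\<mu> * 2" "Y\<^sup>2" Q] Q mu by (simp add: mult.commute)
      moreover have "\<mu> * (X - h)\<^sup>2 \<le> \<mu> * Q" using Q mu by (intro mult_left_mono) auto
      moreover have "0 \<le> \<mu> * (1/2 + \<mu>) * (X - 2 * h)\<^sup>2" using mu by simp
      ultimately show ?thesis using m2 by linarith
    qed
    also have "\<dots> \<le> e\<^sup>2 + 4 * \<mu> * Q" using mult_left_mono[OF Q(4) mu(1)] by (simp add: algebra_simps)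
    finally have "X\<^sup>2 + Y\<^sup>2 \<le> 2 * e\<^sup>2 + 2 * h\<^sup>2 + 8 * \<mu> * Q"
      by (simp add: power2_eq_square field_simps)
    then show ?thesis unfolding X_def Y_def e_def h_def Q_def \<mu>_def by simp
  qed
qed

text \<open>The comparison inequality bounds \<open>md\<close> of the distance; dividing by
  \<open>sn\<close> turns this into a bound on the distance itself. On a segment that is short
  compared with \<open>dist a u\<close>, the values of \<open>sn\<close> vary only by factors close
  to 1, so the error is a small multiple of the length of the segment.\<close>

lemma model_almost_concave:
  fixes a u w w' :: "'a::metric_space"
  assumes cmp: "model_comparison TYPE('a) R md sn" and t: "0 \<le> t" "t \<le> 1" and b: "between t u w' w"
    and mu: "K * r\<^sup>2 \<le> \<mu>" "\<mu> \<le> 1 / 10"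
    and d: "dist a u \<le> r / 2" "dist u w \<le> \<mu> * dist a u"
  shows "(1 - t) * dist a u + t * dist a w - 12 * \<mu> * t * dist u w \<le> dist a w'"
proof (cases "u = w")
  case True
  then have "w' = u" using b by simp
  then show ?thesis using True by (simp add: algebra_simps)
next
  case False
  define \<nu> where "\<nu> = K * r\<^sup>2"
  have nu: "0 \<le> \<nu>" "\<nu> \<le> \<mu>" "\<nu> \<le> 1 / 10" using Kr mu model unfolding \<nu>_def model_functions_def by auto
  define X Y S f where "X = dist a u" and "Y = dist a w" and "S = dist u w" and "f = dist a w'"
  have S: "0 < S" "S \<le> \<mu> * X" using False d unfolding S_def X_def by auto
  have X: "0 \<le> X" "X \<le> r / 2" using d unfolding X_def by auto
  have "\<mu> * X \<le> 1 / 10 * X" using mu X by (intro mult_right_mono) auto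
  then have SX: "S \<le> X / 10" using S by simp
  have tS: "0 \<le> t * S" "t * S \<le> S" using t S by (auto simp: mult_left_le_one_le)
  have Y: "X - S \<le> Y" "Y \<le> X + S"
    unfolding X_def Y_def S_def using dist_triangle[of a w u] dist_triangle[of a u w] by (auto simp: dist_commute)
  have uw': "dist u w' = t * S" using b unfolding between_def S_def by simp
  have f: "X - t * S \<le> f" "f \<le> X + S"
    unfolding X_def f_def using dist_triangle[of a w' u] dist_triangle[of a u w'] uw' tS by (auto simp: dist_commute)
  \<comment> \<open>The excess of \<open>Y\<close> over the least value \<open>X - S\<close> that
    the triangle inequality permits. The linear interpolation equals
    \<open>X - t * S + t * Q\<close>, and \<open>Q \<le> 2 * S\<close> turns the relative error
    \<open>6 * \<mu>\<close> into \<open>12 * \<mu> * t * S\<close>.\<close>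
  define Q where "Q = Y - X + S"
  have Q: "0 \<le> Q" "Q \<le> 2 * S" unfolding Q_def using Y by auto
  have m: "md (X - t * S) + sn (t * S) / sn S * (md Y - md (X - S)) \<le> md f"
    using cmp[unfolded model_comparison_def, rule_format, of t u w' w a] t b False Y SX X r
    unfolding X_def Y_def S_def f_def by (auto simp: X_def[symmetric])
  have "Q * sn (X - S) \<le> md Y - md (X - S)"
    using model_md_diff(1)[of "X - S" Y] Y SX X S unfolding Q_def by (simp add: algebra_simps)
  moreover have snp: "0 \<le> sn (X - S)" using model_sn_nonneg[of "X - S"] SX X S by simp
  ultimately have "(1 - 2 * \<nu>) * t * (Q * sn (X - S)) \<le> sn (t * S) / sn S * (md Y - md (X - S))"
    using model_sn_ratio[of t S] t S SX X Q nu unfolding \<nu>_def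
    by (intro mult_mono) (auto intro: order_trans[of 0 "(1 - 2 * (K * r\<^sup>2)) * t"])
  moreover have "md f - md (X - t * S) \<le> (f - (X - t * S)) * sn f"
    using model_md_diff(2)[of "X - t * S" f] f tS SX X S by simp
  moreover have "(f - (X - t * S)) * sn f \<le> (f - (X - t * S)) * sn (X + S)"
    using model_sn_mono[of f "X + S"] f SX X S tS by (intro mult_left_mono) auto
  ultimately have m2: "(1 - 2 * \<nu>) * t * (Q * sn (X - S)) \<le> (f - (X - t * S)) * sn (X + S)"
    using m by linarith
  have X0: "0 < X" using S SX by simp
  have lo: "(1 - \<mu>) * ((1 - \<mu>) * X) \<le> sn (X - S)"
  proof -
    have "(1 - \<mu>) * ((1 - \<mu>) * X) \<le> (1 - \<nu>) * (X - S)"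
      using nu mu S X0 by (intro mult_mono) (auto simp: algebra_simps)
    then show ?thesis using model_sn_bounds(1)[of "X - S"] SX X S unfolding \<nu>_def by simp
  qed
  have hi: "sn (X + S) \<le> (1 + \<mu>) * ((1 + \<mu>) * X)"
  proof -
    have "(1 + \<nu>) * (X + S) \<le> (1 + \<mu>) * ((1 + \<mu>) * X)"
      using nu mu S X0 by (intro mult_mono) (auto simp: algebra_simps)
    then show ?thesis using model_sn_bounds(2)[of "X + S"] SX X S unfolding \<nu>_def by simp
  qed
  have "(1 - 2 * \<mu>) * t * (Q * ((1 - \<mu>) * ((1 - \<mu>) * X))) \<le> (1 - 2 * \<nu>) * t * (Q * sn (X - S))"
    using lo nu mu t Q X0 by (intro mult_mono mult_nonneg_nonneg) auto
  also have "\<dots> \<le> (f - (X - t * S)) * ((1 + \<mu>) * ((1 + \<mu>) * X))"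
    using m2 mult_left_mono[OF hi, of "f - (X - t * S)"] f by simp
  finally have "X * ((1 - 2 * \<mu>) * (1 - \<mu>)\<^sup>2 * (t * Q)) \<le> X * ((f - (X - t * S)) * (1 + \<mu>)\<^sup>2)"
    by (simp add: power2_eq_square algebra_simps)
  then have m3: "(1 - 2 * \<mu>) * (1 - \<mu>)\<^sup>2 * (t * Q) \<le> (f - (X - t * S)) * (1 + \<mu>)\<^sup>2" using X0 by simp
  have mup: "0 \<le> \<mu>" using nu by simp
  have "(1 - 6 * \<mu>) * (1 + \<mu>)\<^sup>2 \<le> (1 - 2 * \<mu>) * (1 - \<mu>)\<^sup>2"
  proof -
    have "(1 - 2 * \<mu>) * (1 - \<mu>)\<^sup>2 - (1 - 6 * \<mu>) * (1 + \<mu>)\<^sup>2 = 16 * \<mu>\<^sup>2 + 4 * \<mu> * \<mu>\<^sup>2"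
      by (simp add: power2_eq_square algebra_simps)
    moreover have "0 \<le> 16 * \<mu>\<^sup>2 + 4 * \<mu> * \<mu>\<^sup>2" using mup by simp
    ultimately show ?thesis by linarith
  qed
  then have "(1 - 6 * \<mu>) * (1 + \<mu>)\<^sup>2 * (t * Q) \<le> (f - (X - t * S)) * (1 + \<mu>)\<^sup>2"
    using order_trans[OF mult_right_mono m3] t Q by simp
  then have "(1 + \<mu>)\<^sup>2 * ((1 - 6 * \<mu>) * (t * Q)) \<le> (1 + \<mu>)\<^sup>2 * (f - (X - t * S))" by (simp add: algebra_simps)
  then have "(1 - 6 * \<mu>) * (t * Q) \<le> f - (X - t * S)" using mup by simp
  moreover have "\<mu> * (t * Q) \<le> \<mu> * (t * (2 * S))" using mup t Q by (intro mult_left_mono) auto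
  ultimately have "X - t * S + t * Q - 12 * \<mu> * t * S \<le> f" by (simp add: algebra_simps)
  then show ?thesis unfolding Q_def X_def Y_def S_def f_def by (simp add: algebra_simps)
qed

end

section \<open>Metric consequences of the curvature bound, collected in a locale\<close>

text \<open>The parameter \<open>ty\<close> only serves to fix the type of points.\<close>

locale alexandrov =
  fixes K R :: real and ty :: "'a::metric_space itself"
  assumes R_pos: "0 < R" and K_nonneg: "0 \<le> K" and KR: "K * R\<^sup>2 \<le> 1 / 10"
    and ty: "ty = TYPE('a)"
    and between_ex: "\<And>t (x::'a) y. 0 \<le> t \<Longrightarrow> t \<le> 1 \<Longrightarrow> \<exists>m. between t x m y"
    and homothety: "\<And>t r (v::'a) x' x y' y. 0 \<le> t \<Longrightarrow> t \<le> 1 \<Longrightarrow> 0 \<le> r \<Longrightarrow> r \<le> R \<Longrightarrow>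
      between t v x' x \<Longrightarrow> between t v y' y \<Longrightarrow> dist v x \<le> r \<Longrightarrow> dist v y \<le> r \<Longrightarrow>
      (1 - K * r\<^sup>2) * t * dist x y \<le> dist x' y'"
    and midpoint: "\<And>r (x::'a) y a q. 0 \<le> r \<Longrightarrow> r \<le> R \<Longrightarrow> between (1/2) x y a \<Longrightarrow> dist q y \<le> r \<Longrightarrow>
      dist x y \<le> r \<Longrightarrow>
      (dist q x)\<^sup>2 + (dist q a)\<^sup>2 \<le> 2 * (dist q y)\<^sup>2 + 2 * (dist x y)\<^sup>2 + K * r\<^sup>2 * (dist q y + dist x y)\<^sup>2"
    and almost_concave: "\<And>t r \<mu> (u::'a) w' w a. 0 \<le> t \<Longrightarrow> t \<le> 1 \<Longrightarrow> 0 \<le> r \<Longrightarrow> r \<le> R \<Longrightarrow>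
      between t u w' w \<Longrightarrow> K * r\<^sup>2 \<le> \<mu> \<Longrightarrow> \<mu> \<le> 1 / 10 \<Longrightarrow> dist a u \<le> r \<Longrightarrow>
      dist u w \<le> \<mu> * dist a u \<Longrightarrow>
      (1 - t) * dist a u + t * dist a w - 12 * \<mu> * t * dist u w \<le> dist a w'"

lemma curv_ge_alexandrov:
  assumes gs: "geodesic_space TYPE('a::metric_space)" and "curv_ge TYPE('a) k"
  obtains K R where "alexandrov K R TYPE('a)"
proof -
  obtain K0 R0 md sn cn where m: "model_functions K0 R0 md sn cn" and c: "model_comparison TYPE('a) R0 md sn"
    using curv_ge_model_comparison[OF assms] by blast
  have R0: "0 < R0" and K0: "0 \<le> K0" using m unfolding model_functions_def by auto
  \<comment> \<open>The estimates above are applied on scale \<open>2 * r\<close>, since they ask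
    for distances up to half the scale. The largest error, in the midpoint inequality, is
    \<open>8 * (K0 * (2 * r)\<^sup>2) = 32 * (K0 * r\<^sup>2)\<close>. The choice of
    \<open>R\<close> gives \<open>R \<le> 1\<close> and \<open>K * R \<le> 1 / 20\<close>, hence the
    smallness of \<open>K * R\<^sup>2\<close>.\<close>
  define K where "K = 32 * K0"
  define R where "R = min (R0 / 2) (1 / (20 * (K + 1)))"
  have K: "0 \<le> K" unfolding K_def using K0 by simp
  have R: "0 < R" "R \<le> R0 / 2" unfolding R_def using R0 K by auto
  have small: "K * R\<^sup>2 \<le> 1 / 10"
  proof -
    have "1 / (20 * (K + 1)) \<le> 1" using K by (simp add: divide_simps)
    then have "R \<le> 1" unfolding R_def by linarith
    then have "R * R \<le> 1 * (1 / (20 * (K + 1)))"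
      using R by (intro mult_mono) (auto simp: R_def)
    then have "K * (R * R) \<le> K * (1 / (20 * (K + 1)))" using K by (intro mult_left_mono) auto
    also have "\<dots> \<le> 1 / 10" using K by (simp add: divide_simps)
    finally show ?thesis by (simp add: power2_eq_square)
  qed
  have sc: "0 \<le> 2 * r" "2 * r \<le> R0" "K0 * (2 * r)\<^sup>2 \<le> 1 / 10" "32 * (K0 * r\<^sup>2) = K * r\<^sup>2" "0 \<le> K0 * r\<^sup>2"
    if "0 \<le> r" "r \<le> R" for r
  proof -
    have "K * r\<^sup>2 \<le> K * R\<^sup>2" using that K by (intro mult_left_mono power_mono) auto
    then show "0 \<le> 2 * r" "2 * r \<le> R0" "K0 * (2 * r)\<^sup>2 \<le> 1 / 10" "32 * (K0 * r\<^sup>2) = K * r\<^sup>2" "0 \<le> K0 * r\<^sup>2"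
      using small that R K0 unfolding K_def by (auto simp: power_mult_distrib)
  qed
  have "alexandrov K R TYPE('a)"
  proof
    show "0 < R" "0 \<le> K" "K * R\<^sup>2 \<le> 1 / 10" by fact+
    show "TYPE('a) = TYPE('a)" by (rule refl)
    show "\<exists>m. between t x m y" if "0 \<le> t" "t \<le> 1" for t and x y :: 'a
      using between_exists[OF gs that] .
  next
    fix t r :: real and v x x' y y' :: 'a
    assume a: "0 \<le> t" "t \<le> 1" "0 \<le> r" "r \<le> R" "between t v x' x" "between t v y' y" "dist v x \<le> r" "dist v y \<le> r"
    have "(1 - 4 * (K0 * (2 * r)\<^sup>2)) * t * dist x y \<le> dist x' y'"
      using model_homothety[OF m sc(1-3)[OF a(3,4)] c a(1,2,5,6)] a(7,8) by simp
    moreover have "(1 - K * r\<^sup>2) * (t * dist x y) \<le> (1 - 4 * (K0 * (2 * r)\<^sup>2)) * (t * dist x y)"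
      using sc(4,5)[OF a(3,4)] a(1) by (intro mult_right_mono) (auto simp: power_mult_distrib)
    ultimately show "(1 - K * r\<^sup>2) * t * dist x y \<le> dist x' y'" by (simp add: mult.assoc)
  next
    fix r :: real and x y a q :: 'a
    assume a: "0 \<le> r" "r \<le> R" "between (1/2) x y a" "dist q y \<le> r" "dist x y \<le> r"
    have "8 * (K0 * (2 * r)\<^sup>2) = K * r\<^sup>2" using sc(4)[OF a(1,2)] by (simp add: power_mult_distrib)
    with model_midpoint[OF m sc(1-3)[OF a(1,2)] c a(3), of q] a(4,5)
    show "(dist q x)\<^sup>2 + (dist q a)\<^sup>2 \<le> 2 * (dist q y)\<^sup>2 + 2 * (dist x y)\<^sup>2 + K * r\<^sup>2 * (dist q y + dist x y)\<^sup>2"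
      by (metis (no_types, lifting) field_sum_of_halves mult_2 nonzero_mult_div_cancel_left zero_neq_numeral)
  next
    fix t r \<mu> :: real and u w w' a :: 'a
    assume a: "0 \<le> t" "t \<le> 1" "0 \<le> r" "r \<le> R" "between t u w' w" "K * r\<^sup>2 \<le> \<mu>" "\<mu> \<le> 1 / 10" "dist a u \<le> r"
      "dist u w \<le> \<mu> * dist a u"
    have "K0 * (2 * r)\<^sup>2 = 4 * (K0 * r\<^sup>2)" by (simp add: power_mult_distrib)
    then have "K0 * (2 * r)\<^sup>2 \<le> \<mu>" using sc(4,5)[OF a(3,4)] a(6) by linarith
    then show "(1 - t) * dist a u + t * dist a w - 12 * \<mu> * t * dist u w \<le> dist a w'"
      using model_almost_concave[OF m sc(1-3)[OF a(3,4)] c a(1,2,5) _ a(7)] a(8,9) by simp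
  qed
  then show ?thesis using that by blast
qed

section \<open>Hausdorff measure\<close>

lemma diameter_le_dist:
  assumes "\<And>x y. x \<in> S \<Longrightarrow> y \<in> S \<Longrightarrow> dist x y \<le> d" "0 \<le> d"
  shows "diameter S \<le> d"
  unfolding diameter_def using assms by (auto intro!: cSUP_least)

lemma hausdorff_pre_le:
  assumes "A \<subseteq> (\<Union>i. C i)" "\<And>i. bounded (C i)" "\<And>i. diameter (C i) \<le> \<delta>"
  shows "hausdorff_pre s \<delta> A \<le> (\<Sum>i. hterm s (C i))"
  unfolding hausdorff_pre_def using assms by (intro INF_lower) auto

lemma hausdorff_pre_greatest:
  assumes "\<And>C. A \<subseteq> (\<Union>i. C i) \<Longrightarrow> (\<And>i. bounded (C i)) \<Longrightarrow> (\<And>i. diameter (C i) \<le> \<delta>) \<Longrightarrow>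
    x \<le> (\<Sum>i. hterm s (C i))"
  shows "x \<le> hausdorff_pre s \<delta> A"
  unfolding hausdorff_pre_def using assms by (intro INF_greatest) auto

lemma hausdorff_pre_lessE:
  assumes "hausdorff_pre s \<delta> A < x"
  obtains C where "A \<subseteq> (\<Union>i. C i)" "\<And>i. bounded (C i)" "\<And>i. diameter (C i) \<le> \<delta>"
    "(\<Sum>i. hterm s (C i)) < x"
  using assms unfolding hausdorff_pre_def INF_less_iff by auto

lemma hausdorff_pre_mono: "A \<subseteq> B \<Longrightarrow> hausdorff_pre s \<delta> A \<le> hausdorff_pre s \<delta> B"
  by (intro hausdorff_pre_greatest hausdorff_pre_le) auto

lemma hausdorff_pre_antimono: "\<delta> \<le> \<delta>' \<Longrightarrow> hausdorff_pre s \<delta>' A \<le> hausdorff_pre s \<delta> A"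
  by (intro hausdorff_pre_greatest hausdorff_pre_le) (auto intro: order_trans)

lemma hterm_empty [simp]: "hterm s {} = 0"
  unfolding hterm_def by simp

lemma hausdorff_pre_le_hterm:
  assumes "bounded A" "diameter A \<le> \<delta>" "0 \<le> \<delta>"
  shows "hausdorff_pre s \<delta> A \<le> hterm s A"
proof -
  have "hausdorff_pre s \<delta> A \<le> (\<Sum>i. hterm s (if i = (0::nat) then A else {}))"
    using assms by (intro hausdorff_pre_le) auto
  also have "\<dots> = hterm s A"
    by (subst suminf_finite[of "{0}"]) auto
  finally show ?thesis .
qed

lemma hausdorff_pre_empty [simp]: "0 \<le> \<delta> \<Longrightarrow> hausdorff_pre s \<delta> {} = 0"
  using hausdorff_pre_le_hterm[of "{}" \<delta> s] by simp

lemma hausdorff_pre_UN: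
  fixes A :: "nat \<Rightarrow> 'a::metric_space set"
  shows "hausdorff_pre s \<delta> (\<Union>i. A i) \<le> (\<Sum>i. hausdorff_pre s \<delta> (A i))"
proof (rule ennreal_le_epsilon)
  fix e :: real
  assume e: "0 < e" and fin: "(\<Sum>i. hausdorff_pre s \<delta> (A i)) < top"
  have "\<exists>C. A i \<subseteq> (\<Union>j. C j) \<and> (\<forall>j. bounded (C j)) \<and> (\<forall>j. diameter (C j) \<le> \<delta>) \<and>
    (\<Sum>j. hterm s (C j)) < hausdorff_pre s \<delta> (A i) + ennreal (e * (1/2) ^ Suc i)" for i
  proof -
    have "hausdorff_pre s \<delta> (A i) < top" using ennreal_suminf_lessD[OF fin] .
    then have "hausdorff_pre s \<delta> (A i) < hausdorff_pre s \<delta> (A i) + ennreal (e * (1/2) ^ Suc i)"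
      using e by (cases "hausdorff_pre s \<delta> (A i)") (auto simp: ennreal_less_iff simp flip: ennreal_plus)
    then show ?thesis by (elim hausdorff_pre_lessE) blast
  qed
  then obtain C where C: "\<And>i. A i \<subseteq> (\<Union>j. C i j)" "\<And>i j. bounded (C i j)" "\<And>i j. diameter (C i j) \<le> \<delta>"
    "\<And>i. (\<Sum>j. hterm s (C i j)) < hausdorff_pre s \<delta> (A i) + ennreal (e * (1/2) ^ Suc i)"
    by metis
  have "hausdorff_pre s \<delta> (\<Union>i. A i) \<le> (\<Sum>k. hterm s (case_prod C (prod_decode k)))"
  proof (rule hausdorff_pre_le)
    show "(\<Union>i. A i) \<subseteq> (\<Union>k. case_prod C (prod_decode k))"
    proof
      fix x assume "x \<in> (\<Union>i. A i)"
      then obtain i j where "x \<in> C i j" using C(1) by blast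
      then have "x \<in> case_prod C (prod_decode (prod_encode (i, j)))" by simp
      then show "x \<in> (\<Union>k. case_prod C (prod_decode k))" by (rule UN_I[OF UNIV_I])
    qed
  qed (use C(2,3) in \<open>auto split: prod.split\<close>)
  also have "\<dots> = (\<Sum>i. \<Sum>j. hterm s (C i j))"
    using suminf_ennreal_2dimen[of "\<lambda>i. \<Sum>j. hterm s (C i j)" "\<lambda>p. hterm s (case_prod C p)"] by simp
  also have "\<dots> \<le> (\<Sum>i. hausdorff_pre s \<delta> (A i) + ennreal (e * (1/2) ^ Suc i))"
    using C(4) by (intro suminf_le) (auto intro: less_imp_le)
  also have "\<dots> = (\<Sum>i. hausdorff_pre s \<delta> (A i)) + (\<Sum>i. ennreal (e * (1/2) ^ Suc i))"
    by (rule suminf_add[symmetric]) auto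
  also have "(\<Sum>i. ennreal (e * (1/2) ^ Suc i)) = ennreal e"
  proof (rule suminf_ennreal_eq)
    show "(\<lambda>i. e * (1/2) ^ Suc i) sums e" using sums_mult[OF power_half_series, of e] by simp
  qed (use e in auto)
  finally show "hausdorff_pre s \<delta> (\<Union>i. A i) \<le> (\<Sum>i. hausdorff_pre s \<delta> (A i)) + ennreal e" .
qed

lemma hausdorff_pre_Un:
  assumes "0 \<le> \<delta>"
  shows "hausdorff_pre s \<delta> (A \<union> B) \<le> hausdorff_pre s \<delta> A + hausdorff_pre s \<delta> B"
  using hausdorff_pre_UN[of s \<delta> "binaryset A B"] suminf_binaryset_eq[of "hausdorff_pre s \<delta>" A B] assms
  by (simp add: UN_binaryset_eq)

lemma hausdorff_pre_finite_UN:
  assumes "0 \<le> \<delta>" "finite I"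
  shows "hausdorff_pre s \<delta> (\<Union>i\<in>I. A i) \<le> (\<Sum>i\<in>I. hausdorff_pre s \<delta> (A i))"
  using assms(2)
proof (induction I rule: finite_induct)
  case (insert i I)
  then show ?case
    using hausdorff_pre_Un[OF assms(1), of s "A i" "\<Union>i\<in>I. A i"]
    by (simp add: insert_absorb) (meson add_left_mono order_trans)
qed (use assms in simp)

lemma hausdorff_pre_le_measure: "0 < \<delta> \<Longrightarrow> hausdorff_pre s \<delta> A \<le> hausdorff_measure s A"
  unfolding hausdorff_measure_def by (intro SUP_upper) auto

lemma hausdorff_measure_least:
  assumes "\<And>\<delta>. 0 < \<delta> \<Longrightarrow> hausdorff_pre s \<delta> A \<le> x"
  shows "hausdorff_measure s A \<le> x"
  unfolding hausdorff_measure_def using assms by (intro SUP_least) auto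

lemma hausdorff_measure_mono: "A \<subseteq> B \<Longrightarrow> hausdorff_measure s A \<le> hausdorff_measure s B"
  by (intro hausdorff_measure_least) (meson hausdorff_pre_le_measure hausdorff_pre_mono order_trans)

lemma hausdorff_measure_empty [simp]: "hausdorff_measure s {} = 0"
proof -
  have "hausdorff_measure s {} \<le> 0" by (rule hausdorff_measure_least) simp
  then show ?thesis by simp
qed

lemma hausdorff_measure_UN:
  fixes A :: "nat \<Rightarrow> 'a::metric_space set"
  shows "hausdorff_measure s (\<Union>i. A i) \<le> (\<Sum>i. hausdorff_measure s (A i))"
proof (rule hausdorff_measure_least)
  fix \<delta> :: real assume "0 < \<delta>"
  then show "hausdorff_pre s \<delta> (\<Union>i. A i) \<le> (\<Sum>i. hausdorff_measure s (A i))"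
    using hausdorff_pre_le_measure
    by (intro order_trans[OF hausdorff_pre_UN suminf_le]) auto
qed

lemma hausdorff_measure_Un: "hausdorff_measure s (A \<union> B) \<le> hausdorff_measure s A + hausdorff_measure s B"
  using hausdorff_measure_UN[of s "binaryset A B"] suminf_binaryset_eq[of "hausdorff_measure s" A B]
  by (simp add: UN_binaryset_eq)

lemma hausdorff_measure_finite_UN:
  assumes "finite I"
  shows "hausdorff_measure s (\<Union>i\<in>I. A i) \<le> (\<Sum>i\<in>I. hausdorff_measure s (A i))"
  using assms
proof (induction I rule: finite_induct)
  case (insert i I)
  then show ?case
    using hausdorff_measure_Un[of s "A i" "\<Union>i\<in>I. A i"]
    by (simp add: insert_absorb) (meson add_left_mono order_trans)
qed simp

text \<open>A covering set of diameter at most \<delta>, below the gap \<eta>, meets at most one of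
  \<open>A\<close> and \<open>B\<close>; so a cover of the union splits into covers of the two
  sets.\<close>

lemma hausdorff_pre_separated:
  assumes sep: "\<And>x y. x \<in> A \<Longrightarrow> y \<in> B \<Longrightarrow> \<eta> \<le> dist x y" and "\<delta> < \<eta>"
  shows "hausdorff_pre s \<delta> A + hausdorff_pre s \<delta> B \<le> hausdorff_pre s \<delta> (A \<union> B)"
proof (rule hausdorff_pre_greatest)
  fix C :: "nat \<Rightarrow> 'a set"
  assume C: "A \<union> B \<subseteq> (\<Union>i. C i)" "\<And>i. bounded (C i)" "\<And>i. diameter (C i) \<le> \<delta>"
  have d0: "0 \<le> \<delta>" using C(3)[of 0] diameter_ge_0[OF C(2)[of 0]] by simp
  define D where "D S i = (if C i \<inter> S = {} then {} else C i)" for S i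
  have D: "hausdorff_pre s \<delta> S \<le> (\<Sum>i. hterm s (D S i))" if SAB: "S \<subseteq> A \<union> B" for S
  proof (rule hausdorff_pre_le)
    show "S \<subseteq> (\<Union>i. D S i)"
    proof
      fix x assume x: "x \<in> S"
      then obtain i where "x \<in> C i" using SAB C(1) by blast
      then have "x \<in> D S i" using x unfolding D_def by auto
      then show "x \<in> (\<Union>i. D S i)" by blast
    qed
  qed (use C d0 in \<open>auto simp: D_def\<close>)
  have "hterm s (D A i) + hterm s (D B i) \<le> hterm s (C i)" for i
  proof -
    have "C i \<inter> A = {} \<or> C i \<inter> B = {}"
    proof (rule ccontr)
      assume "\<not> ?thesis"
      then obtain x y where xy: "x \<in> C i" "x \<in> A" "y \<in> C i" "y \<in> B" by blast
      then have "dist x y \<le> \<delta>" using diameter_bounded_bound[OF C(2)[of i]] C(3)[of i] order_trans by blast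
      then show False using sep[OF xy(2,4)] assms(2) by simp
    qed
    then show ?thesis unfolding D_def by auto
  qed
  then have "(\<Sum>i. hterm s (D A i) + hterm s (D B i)) \<le> (\<Sum>i. hterm s (C i))"
    by (intro suminf_le) auto
  moreover have "(\<Sum>i. hterm s (D A i) + hterm s (D B i)) = (\<Sum>i. hterm s (D A i)) + (\<Sum>i. hterm s (D B i))"
    by (rule suminf_add[symmetric]) auto
  ultimately show "hausdorff_pre s \<delta> A + hausdorff_pre s \<delta> B \<le> (\<Sum>i. hterm s (C i))"
    using add_mono[OF D[of A] D[of B]] by simp
qed

text \<open>This is the defining property of a metric outer measure. In the density argument it
  replaces measurability of the sets whose measures are added. The two scales are refined
  independently, each pair of them being dominated by a common scale below \<eta>.\<close>

lemma hausdorff_measure_separated: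
  assumes sep: "\<And>x y. x \<in> A \<Longrightarrow> y \<in> B \<Longrightarrow> \<eta> \<le> dist x y" and eta: "0 < \<eta>"
  shows "hausdorff_measure s A + hausdorff_measure s B \<le> hausdorff_measure s (A \<union> B)"
proof -
  have *: "hausdorff_pre s \<delta> A + hausdorff_pre s \<delta>' B \<le> hausdorff_measure s (A \<union> B)" if "0 < \<delta>" "0 < \<delta>'" for \<delta> \<delta>'
  proof -
    define d where "d = min (min \<delta> \<delta>') (\<eta> / 2)"
    have d: "0 < d" "d \<le> \<delta>" "d \<le> \<delta>'" "d < \<eta>" unfolding d_def using that eta by auto
    have "hausdorff_pre s \<delta> A + hausdorff_pre s \<delta>' B \<le> hausdorff_pre s d A + hausdorff_pre s d B"
      using d by (intro add_mono hausdorff_pre_antimono) auto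
    also have "\<dots> \<le> hausdorff_pre s d (A \<union> B)" using hausdorff_pre_separated[OF sep d(4)] by simp
    finally show ?thesis using hausdorff_pre_le_measure[OF d(1)] order_trans by blast
  qed
  have "hausdorff_measure s A + hausdorff_pre s \<delta>' B \<le> hausdorff_measure s (A \<union> B)" if "0 < \<delta>'" for \<delta>'
  proof -
    have "hausdorff_measure s A + hausdorff_pre s \<delta>' B = (SUP \<delta>\<in>{0<..}. hausdorff_pre s \<delta> A + hausdorff_pre s \<delta>' B)"
      unfolding hausdorff_measure_def by (rule ennreal_SUP_add_left[symmetric]) auto
    then show ?thesis using * that by (auto intro!: SUP_least)
  qed
  moreover have "hausdorff_measure s A + hausdorff_measure s B = (SUP \<delta>'\<in>{0<..}. hausdorff_measure s A + hausdorff_pre s \<delta>' B)"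
    unfolding hausdorff_measure_def[of s B] add.commute[of "hausdorff_measure s A"]
    by (rule ennreal_SUP_add_left[symmetric]) auto
  ultimately show ?thesis by (auto intro!: SUP_least)
qed

lemma hausdorff_measure_separated_finite:
  assumes "finite I" "0 < \<eta>" "\<And>i j x y. i \<in> I \<Longrightarrow> j \<in> I \<Longrightarrow> i \<noteq> j \<Longrightarrow> x \<in> A i \<Longrightarrow> y \<in> A j \<Longrightarrow> \<eta> \<le> dist x y"
  shows "(\<Sum>i\<in>I. hausdorff_measure s (A i)) \<le> hausdorff_measure s (\<Union>i\<in>I. A i)"
  using assms(1,3)
proof (induction I rule: finite_induct)
  case (insert i I)
  have "(\<Sum>i\<in>insert i I. hausdorff_measure s (A i)) \<le> hausdorff_measure s (A i) + hausdorff_measure s (\<Union>i\<in>I. A i)"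
    using insert.IH insert.prems insert.hyps by (auto intro!: add_left_mono)
  also have "\<dots> \<le> hausdorff_measure s (A i \<union> (\<Union>i\<in>I. A i))"
    using insert.prems insert.hyps by (intro hausdorff_measure_separated[OF _ assms(2)]) blast
  finally show ?case by simp
qed simp

section \<open>Hausdorff measure under expanding maps and in coordinates\<close>

lemma hterm_scale:
  assumes L: "0 < L" and C: "bounded C" and "\<And>x y. x \<in> D \<Longrightarrow> y \<in> D \<Longrightarrow> dist x y \<le> L * diameter C"
    and ne: "D \<noteq> {} \<Longrightarrow> C \<noteq> {}" and s: "0 \<le> s"
  shows "diameter D \<le> L * diameter C" "hterm s D \<le> ennreal (L powr s) * hterm s C"
proof -
  show d: "diameter D \<le> L * diameter C"
    using assms diameter_ge_0[OF C] by (intro diameter_le_dist) auto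
  show "hterm s D \<le> ennreal (L powr s) * hterm s C"
  proof (cases "D = {} \<or> s = 0")
    \<comment> \<open>For \<open>s = 0\<close> a nonempty set contributes 1 whatever its diameter,
      so the inequality rests on \<open>D\<close> being empty whenever \<open>C\<close> is.\<close>
    case True
    then show ?thesis using ne L unfolding hterm_def by auto
  next
    case False
    have "bounded D" using assms(3) unfolding bounded_def by (metis)
    then have "diameter D powr s \<le> (L * diameter C) powr s"
      using d s diameter_ge_0 by (intro powr_mono2) auto
    also have "\<dots> = L powr s * diameter C powr s" using L diameter_ge_0[OF C] by (simp add: powr_mult)
    finally show ?thesis using False ne unfolding hterm_def by (auto simp: ennreal_mult[symmetric])
  qed
qed

text \<open>The inverse of \<phi> is Lipschitz with constant \<open>L\<close>, so preimages of a
  cover of the image cover \<open>S\<close> with diameters enlarged by at most \<open>L\<close>.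
  Homotheties are used in this form.\<close>

lemma hausdorff_measure_expanding:
  fixes \<phi> :: "'a::metric_space \<Rightarrow> 'b::metric_space"
  assumes L: "0 < L" and s: "0 \<le> s" and ex: "\<And>x y. x \<in> S \<Longrightarrow> y \<in> S \<Longrightarrow> dist x y \<le> L * dist (\<phi> x) (\<phi> y)"
  shows "hausdorff_measure s S \<le> ennreal (L powr s) * hausdorff_measure s (\<phi> ` S)"
proof (rule hausdorff_measure_least)
  fix \<delta> :: real assume d: "0 < \<delta>"
  define c where "c = ennreal (L powr s)"
  have c: "c \<noteq> 0" "c \<noteq> top" unfolding c_def using L by auto
  have "hausdorff_pre s \<delta> S / c \<le> hausdorff_pre s (\<delta> / L) (\<phi> ` S)"
  proof (rule hausdorff_pre_greatest)
    fix C :: "nat \<Rightarrow> 'b set"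
    assume C: "\<phi> ` S \<subseteq> (\<Union>i. C i)" "\<And>i. bounded (C i)" "\<And>i. diameter (C i) \<le> \<delta> / L"
    define D where "D i = S \<inter> \<phi> -` C i" for i
    have D: "dist x y \<le> L * diameter (C i)" if "x \<in> D i" "y \<in> D i" for x y i
    proof -
      have "dist x y \<le> L * dist (\<phi> x) (\<phi> y)" using ex that unfolding D_def by simp
      also have "\<dots> \<le> L * diameter (C i)"
        using that L diameter_bounded_bound[OF C(2)] unfolding D_def by (intro mult_left_mono) auto
      finally show ?thesis .
    qed
    have sc: "diameter (D i) \<le> L * diameter (C i)" "hterm s (D i) \<le> c * hterm s (C i)" for i
      using hterm_scale[of L "C i" "D i" s] L C(2) D s unfolding c_def D_def by auto
    have "hausdorff_pre s \<delta> S \<le> (\<Sum>i. hterm s (D i))"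
    proof (rule hausdorff_pre_le)
      show "S \<subseteq> (\<Union>i. D i)" using C(1) unfolding D_def by blast
      show "bounded (D i)" for i using D unfolding bounded_def by (metis)
      show "diameter (D i) \<le> \<delta>" for i
        using sc(1)[of i] C(3)[of i] L by (simp add: field_simps)
    qed
    also have "\<dots> \<le> (\<Sum>i. c * hterm s (C i))" using sc by (intro suminf_le) auto
    also have "\<dots> = c * (\<Sum>i. hterm s (C i))" by simp
    finally show "hausdorff_pre s \<delta> S / c \<le> (\<Sum>i. hterm s (C i))"
      using c by (intro divide_le_posI_ennreal) (auto simp: zero_less_iff_neq_zero)
  qed
  also have "\<dots> \<le> hausdorff_measure s (\<phi> ` S)" using d L by (intro hausdorff_pre_le_measure) simp
  finally have "c * (hausdorff_pre s \<delta> S / c) \<le> c * hausdorff_measure s (\<phi> ` S)" by (rule mult_left_mono) simp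
  moreover have "c * (hausdorff_pre s \<delta> S / c) = hausdorff_pre s \<delta> S"
    using c by (metis ennreal_times_divide ennreal_mult_divide_eq mult.commute)
  ultimately show "hausdorff_pre s \<delta> S \<le> ennreal (L powr s) * hausdorff_measure s (\<phi> ` S)"
    unfolding c_def by simp
qed

lemma hausdorff_measure_zero_mono:
  assumes "hausdorff_measure s A = 0" "0 \<le> s" "s \<le> t"
  shows "hausdorff_measure t A = 0"
proof -
  have "hausdorff_measure t A \<le> 0"
  proof (rule hausdorff_measure_least)
    fix \<delta> :: real assume d: "0 < \<delta>"
    have "hausdorff_pre t \<delta> A \<le> hausdorff_pre t (min \<delta> 1) A" by (rule hausdorff_pre_antimono) simp
    also have "\<dots> \<le> hausdorff_pre s (min \<delta> 1) A"
    proof (rule hausdorff_pre_greatest)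
      fix C :: "nat \<Rightarrow> 'a set"
      assume C: "A \<subseteq> (\<Union>i. C i)" "\<And>i. bounded (C i)" "\<And>i. diameter (C i) \<le> min \<delta> 1"
      have "hterm t (C i) \<le> hterm s (C i)" for i
      proof -
        have "0 \<le> diameter (C i)" "diameter (C i) \<le> 1" using C(3)[of i] diameter_ge_0[OF C(2)] by auto
        then show ?thesis using assms(2,3) unfolding hterm_def
          by (auto intro!: ennreal_leI powr_mono' powr_le1 simp: ennreal_le_1)
      qed
      then show "hausdorff_pre t (min \<delta> 1) A \<le> (\<Sum>i. hterm s (C i))"
        by (intro order_trans[OF hausdorff_pre_le[OF C] suminf_le]) auto
    qed
    also have "\<dots> \<le> hausdorff_measure s A" using d by (intro hausdorff_pre_le_measure) simp
    finally show "hausdorff_pre t \<delta> A \<le> 0" using assms by simp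
  qed
  then show ?thesis by simp
qed

text \<open>The cube of side \<open>2 * r\<close> around \<open>c\<close> that contains the
  coordinates is cut into \<open>N ^ m\<close> equal cells. Two points in one cell differ by at most
  \<open>2 * r / N\<close> in each coordinate, and the lower bound in some coordinate makes them
  \<open>h\<close>-close.\<close>

lemma hausdorff_pre_chart_le:
  fixes S :: "'a::metric_space set" and F :: "nat \<Rightarrow> 'a \<Rightarrow> real"
  assumes e: "0 < \<epsilon>" and r: "0 < r" and s: "0 \<le> s" and N: "0 < N"
    and box: "\<And>j x. j < m \<Longrightarrow> x \<in> S \<Longrightarrow> \<bar>F j x - c j\<bar> < r"
    and bilip: "\<And>x y. x \<in> S \<Longrightarrow> y \<in> S \<Longrightarrow> x \<noteq> y \<Longrightarrow> \<exists>j<m. \<epsilon> * dist x y \<le> \<bar>F j x - F j y\<bar>"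
    and d: "2 * r / (real N * \<epsilon>) \<le> \<delta>"
  shows "hausdorff_pre s \<delta> S \<le> ennreal (real N ^ m * (2 * r / (real N * \<epsilon>)) powr s)"
proof -
  define h where "h = 2 * r / (real N * \<epsilon>)"
  have h: "0 < h" "h \<le> \<delta>" unfolding h_def using e r N d by auto
  define ix where "ix x = restrict (\<lambda>j. nat \<lfloor>(F j x - c j + r) * real N / (2 * r)\<rfloor>) {..<m}" for x
  define I where "I = {..<m} \<rightarrow>\<^sub>E {..<N}"
  define cell where "cell k = {x \<in> S. ix x = k}" for k
  have fin: "finite I" unfolding I_def by (auto intro: finite_PiE)
  have cov: "S \<subseteq> (\<Union>k\<in>I. cell k)"
  proof
    fix x assume x: "x \<in> S"
    have "nat \<lfloor>(F j x - c j + r) * real N / (2 * r)\<rfloor> < N" if "j < m" for j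
    proof -
      have "F j x - c j + r < 2 * r" using box[OF that x] by auto
      then have "(F j x - c j + r) * real N < 2 * r * real N" using N by (intro mult_strict_right_mono) auto
      then have "(F j x - c j + r) * real N / (2 * r) < real N" using r by (simp add: divide_less_eq mult.commute)
      then have "\<lfloor>(F j x - c j + r) * real N / (2 * r)\<rfloor> < int N" by (simp add: floor_less_iff)
      then show ?thesis using N by linarith
    qed
    then have "ix x \<in> I" unfolding ix_def I_def by auto
    then show "x \<in> (\<Union>k\<in>I. cell k)" using x unfolding cell_def by auto
  qed
  have dc: "dist x y \<le> h" if xy: "x \<in> cell k" "y \<in> cell k" for x y k
  proof (cases "x = y")
    case True then show ?thesis using h by simp
  next
    case False
    have xyS: "x \<in> S" "y \<in> S" "ix x = ix y" using xy unfolding cell_def by auto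
    obtain j where j: "j < m" "\<epsilon> * dist x y \<le> \<bar>F j x - F j y\<bar>" using bilip[OF xyS(1,2) False] by blast
    define a b where "a = (F j x - c j + r) * real N / (2 * r)" and "b = (F j y - c j + r) * real N / (2 * r)"
    have ab: "0 \<le> a" "0 \<le> b"
      unfolding a_def b_def using box[OF j(1) xyS(1)] box[OF j(1) xyS(2)] r by auto
    have "nat \<lfloor>a\<rfloor> = nat \<lfloor>b\<rfloor>" using fun_cong[OF xyS(3), of j] j(1) unfolding ix_def a_def b_def by simp
    then have "\<lfloor>a\<rfloor> = \<lfloor>b\<rfloor>" using ab by (simp add: nat_eq_iff)
    then have "\<bar>a - b\<bar> \<le> 1" using floor_correct[of a] floor_correct[of b] by linarith
    moreover have "a - b = (F j x - F j y) * (real N / (2 * r))"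
      unfolding a_def b_def by (simp add: diff_divide_distrib[symmetric] algebra_simps)
    ultimately have "\<bar>F j x - F j y\<bar> * (real N / (2 * r)) \<le> 1" using r by (simp add: abs_mult)
    then have "\<epsilon> * dist x y * (real N / (2 * r)) \<le> 1"
      by (rule order_trans[OF mult_right_mono[OF j(2)], rotated]) (use r in simp)
    then show ?thesis unfolding h_def using e r N by (simp add: field_simps)
  qed
  have "hausdorff_pre s \<delta> (cell k) \<le> ennreal (h powr s)" for k
  proof -
    have b: "bounded (cell k)" using dc unfolding bounded_def by metis
    have dm: "diameter (cell k) \<le> h" using dc h by (intro diameter_le_dist) auto
    have "hausdorff_pre s \<delta> (cell k) \<le> hterm s (cell k)"
      using b dm h by (intro hausdorff_pre_le_hterm) auto
    also have "\<dots> \<le> ennreal (h powr s)"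
      using dm diameter_ge_0[OF b] s h unfolding hterm_def by (auto intro!: ennreal_leI powr_mono2)
    finally show ?thesis .
  qed
  then have "(\<Sum>k\<in>I. hausdorff_pre s \<delta> (cell k)) \<le> (\<Sum>k\<in>I. ennreal (h powr s))" by (intro sum_mono)
  also have "\<dots> = ennreal (real N ^ m * h powr s)"
    unfolding I_def by (simp add: card_PiE ennreal_mult flip: ennreal_of_nat_eq_real_of_nat ennreal_power)
  finally show ?thesis
    using order_trans[OF hausdorff_pre_mono[OF cov, of s \<delta>] hausdorff_pre_finite_UN[OF _ fin, of \<delta> s cell]] h
    unfolding h_def by simp
qed

text \<open>Refining the grid, the bound behaves like \<open>N powr (m - s)\<close>: it is constant
  for \<open>s = m\<close> and tends to 0 for larger \<open>s\<close>.\<close>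

lemma hausdorff_measure_chart_le:
  fixes S :: "'a::metric_space set" and F :: "nat \<Rightarrow> 'a \<Rightarrow> real"
  assumes e: "0 < \<epsilon>" and r: "0 < r"
    and box: "\<And>j x. j < m \<Longrightarrow> x \<in> S \<Longrightarrow> \<bar>F j x - c j\<bar> < r"
    and bilip: "\<And>x y. x \<in> S \<Longrightarrow> y \<in> S \<Longrightarrow> x \<noteq> y \<Longrightarrow> \<exists>j<m. \<epsilon> * dist x y \<le> \<bar>F j x - F j y\<bar>"
  shows "hausdorff_measure (real m) S \<le> ennreal ((2 * r / \<epsilon>) ^ m)"
    and "real m < s \<Longrightarrow> hausdorff_measure s S = 0"
proof -
  define c0 where "c0 = 2 * r / \<epsilon>"
  have c0: "0 < c0" unfolding c0_def using e r by simp
  have ev: "eventually (\<lambda>N. 0 < N \<and> 2 * r / (real N * \<epsilon>) \<le> \<delta>) sequentially" if "0 < \<delta>" for \<delta>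
  proof -
    have "(\<lambda>N. c0 / real N) \<longlonglongrightarrow> 0" by real_asymp
    then have "eventually (\<lambda>N. c0 / real N < \<delta>) sequentially" using that by (rule order_tendstoD)
    then show ?thesis using eventually_gt_at_top[of 0]
      by eventually_elim (auto simp: c0_def field_simps)
  qed
  have bd: "hausdorff_pre s \<delta> S \<le> ennreal (c0 powr s * real N powr (real m - s))"
    if "0 < N" "2 * r / (real N * \<epsilon>) \<le> \<delta>" "0 \<le> s" for N s \<delta>
  proof -
    have "real N ^ m * (2 * r / (real N * \<epsilon>)) powr s = c0 powr s * real N powr (real m - s)"
      using that e r unfolding c0_def
      by (simp add: powr_diff powr_divide powr_mult powr_realpow field_simps)
    then show ?thesis using hausdorff_pre_chart_le[OF e r that(3,1) box bilip that(2)] by simp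
  qed
  show "hausdorff_measure (real m) S \<le> ennreal ((2 * r / \<epsilon>) ^ m)"
  proof (rule hausdorff_measure_least)
    fix \<delta> :: real assume "0 < \<delta>"
    then obtain N where "0 < N" "2 * r / (real N * \<epsilon>) \<le> \<delta>"
      using eventually_happens'[OF sequentially_bot ev] by blast
    then show "hausdorff_pre (real m) \<delta> S \<le> ennreal ((2 * r / \<epsilon>) ^ m)"
      using bd[of N \<delta> "real m"] c0 by (simp add: powr_realpow c0_def)
  qed
  show "hausdorff_measure s S = 0" if s: "real m < s"
  proof -
    have "hausdorff_measure s S \<le> 0"
    proof (rule hausdorff_measure_least)
      fix \<delta> :: real assume d: "0 < \<delta>"
      have "(\<lambda>N. c0 powr s * real N powr (real m - s)) \<longlonglongrightarrow> 0"
      proof (intro tendsto_mult_right_zero tendsto_neg_powr)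
        show "filterlim real at_top sequentially" by (rule filterlim_real_sequentially)
      qed (use s in simp)
      then have "(\<lambda>N. ennreal (c0 powr s * real N powr (real m - s))) \<longlonglongrightarrow> ennreal 0"
        by (rule tendsto_ennrealI)
      then show "hausdorff_pre s \<delta> S \<le> 0"
        using ev[OF d] bd[of _ \<delta> s] s
        by (intro tendsto_lowerbound[of _ 0 sequentially]) (auto elim!: eventually_mono)
    qed
    then show ?thesis by simp
  qed
qed

text \<open>As the coordinates are 1-Lipschitz, the image of a covering set lies in a cube whose
  half side is the diameter of that set. Lebesgue measure of the box then bounds the sum over the
  cover from below, the factors \<open>2 ^ m\<close> cancelling. Covers of every mesh obey this;
  mesh 1 is an arbitrary choice.\<close>

lemma hausdorff_measure_onto_box:
  fixes S :: "'a::metric_space set" and F :: "nat \<Rightarrow> 'a \<Rightarrow> real"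
  assumes t: "0 < \<tau>"
    and lip: "\<And>j x y. j < m \<Longrightarrow> x \<in> S \<Longrightarrow> y \<in> S \<Longrightarrow> \<bar>F j x - F j y\<bar> \<le> dist x y"
    and onto: "\<And>v. (\<And>j. j < m \<Longrightarrow> \<bar>v j - c j\<bar> \<le> \<tau>) \<Longrightarrow> \<exists>x\<in>S. \<forall>j<m. F j x = v j"
  shows "ennreal (\<tau> ^ m) \<le> hausdorff_measure (real m) S"
proof -
  interpret product_sigma_finite "\<lambda>_::nat. lborel :: real measure" ..
  define M where "M = Pi\<^sub>M {..<m} (\<lambda>_. lborel :: real measure)"
  define B where "B = (\<Pi>\<^sub>E j\<in>{..<m}. {c j - \<tau> .. c j + \<tau>})"
  have box: "emeasure M (\<Pi>\<^sub>E j\<in>{..<m}. {a j - l .. a j + l}) = ennreal ((2 * l) ^ m)"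
    if "0 \<le> l" for l and a :: "nat \<Rightarrow> real"
    unfolding M_def using that by (subst emeasure_PiM) (auto simp: ennreal_power)
  have "ennreal (\<tau> ^ m) \<le> hausdorff_pre (real m) 1 S"
  proof (rule hausdorff_pre_greatest)
    fix C :: "nat \<Rightarrow> 'a set"
    assume C: "S \<subseteq> (\<Union>i. C i)" "\<And>i. bounded (C i)" "\<And>i. diameter (C i) \<le> 1"
    define x where "x i = (SOME x. x \<in> C i \<inter> S)" for i
    have x: "x i \<in> C i" "x i \<in> S" if "C i \<inter> S \<noteq> {}" for i
      using someI_ex[of "\<lambda>x. x \<in> C i \<inter> S"] that unfolding x_def by auto
    define D where "D i = (if C i \<inter> S = {} then {} else
      (\<Pi>\<^sub>E j\<in>{..<m}. {F j (x i) - diameter (C i) .. F j (x i) + diameter (C i)}))" for i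
    have D: "D i \<in> sets M" for i unfolding D_def M_def by (auto intro!: sets_PiM_I_finite)
    have "emeasure M (D i) \<le> ennreal (2 ^ m) * hterm (real m) (C i)" for i
    proof (cases "C i \<inter> S = {}")
      case True then show ?thesis unfolding D_def by simp
    next
      case False
      have dd: "0 \<le> diameter (C i)" using diameter_ge_0[OF C(2)] .
      then have "emeasure M (D i) = ennreal ((2 * diameter (C i)) ^ m)" unfolding D_def using False box by simp
      also have "\<dots> = ennreal (2 ^ m) * ennreal (diameter (C i) ^ m)"
        using dd by (simp add: power_mult_distrib ennreal_mult)
      also have "ennreal (diameter (C i) ^ m) = hterm (real m) (C i)"
        using False dd unfolding hterm_def by (auto simp: powr_realpow')
      finally show ?thesis by simp
    qed
    then have s: "(\<Sum>i. emeasure M (D i)) \<le> (\<Sum>i. ennreal (2 ^ m) * hterm (real m) (C i))" by (intro suminf_le) auto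
    have "B \<subseteq> (\<Union>i. D i)"
    proof
      fix v assume v: "v \<in> B"
      have "\<bar>v j - c j\<bar> \<le> \<tau>" if "j < m" for j
        using PiE_mem[OF v[unfolded B_def], of j] that by (auto simp: abs_le_iff)
      then obtain y where y: "y \<in> S" "\<And>j. j < m \<Longrightarrow> F j y = v j" using onto by blast
      then obtain i where i: "y \<in> C i" using C(1) by blast
      then have ne: "C i \<inter> S \<noteq> {}" using y by blast
      have "\<bar>F j y - F j (x i)\<bar> \<le> diameter (C i)" if "j < m" for j
        using lip[OF that y(1) x(2)[OF ne]] diameter_bounded_bound[OF C(2) i x(1)[OF ne]] by simp
      then have "v j \<in> {F j (x i) - diameter (C i) .. F j (x i) + diameter (C i)}" if "j < m" for j
        using that y(2)[OF that] by (fastforce simp: abs_le_iff)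
      then have "v \<in> D i" using v ne unfolding D_def B_def by (auto simp: PiE_iff)
      then show "v \<in> (\<Union>i. D i)" by blast
    qed
    then have "emeasure M B \<le> emeasure M (\<Union>i. D i)" using D by (intro emeasure_mono) auto
    also have "\<dots> \<le> (\<Sum>i. emeasure M (D i))" using D by (intro emeasure_subadditive_countably) auto
    also have "\<dots> \<le> ennreal (2 ^ m) * (\<Sum>i. hterm (real m) (C i))" using s by simp
    finally have "ennreal (2 ^ m) * ennreal (\<tau> ^ m) \<le> ennreal (2 ^ m) * (\<Sum>i. hterm (real m) (C i))"
      using box[of \<tau> c] t unfolding B_def by (simp add: power_mult_distrib ennreal_mult)
    then show "ennreal (\<tau> ^ m) \<le> (\<Sum>i. hterm (real m) (C i))"
      by (subst (asm) ennreal_mult_le_mult_iff) auto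
  qed
  also have "\<dots> \<le> hausdorff_measure (real m) S" by (rule hausdorff_pre_le_measure) simp
  finally show ?thesis .
qed

section \<open>Strainers\<close>

text \<open>The variational principle of Ekeland and Caristi: descent at a definite rate from every
  point with \<open>G > 0\<close> leads to an exact zero, at a distance controlled by the initial
  value. Descent is asked for only in the region that the sequence cannot leave. This turns
  approximate solvability of the strainer coordinates into exact solvability.\<close>

lemma caristi_descent:
  fixes G :: "'a::metric_space \<Rightarrow> real"
  assumes compl: "complete (UNIV :: 'a set)" and cont: "continuous_on UNIV G"
    and nn: "\<And>x. 0 \<le> G x" and c: "0 < c"
    and desc: "\<And>x. c * dist p x \<le> G p \<Longrightarrow> 0 < G x \<Longrightarrow> \<exists>y. y \<noteq> x \<and> G y + c * dist x y \<le> G x"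
  shows "\<exists>x. c * dist p x \<le> G p \<and> G x = 0"
proof -
  \<comment> \<open>The points below \<open>x\<close> in the Ekeland order. Each iterate is chosen
    in the set of its predecessor, within \<open>(1/2) ^ k\<close> of the infimum of
    \<open>G\<close> there.\<close>
  define S where "S x = {y. G y + c * dist x y \<le> G x}" for x
  have Sself: "x \<in> S x" for x unfolding S_def by simp
  have bdd: "bdd_below (G ` S x)" for x using nn by (intro bdd_belowI[of _ 0]) auto
  have "\<exists>y\<in>S x. G y < Inf (G ` S x) + (1/2) ^ k" for x and k :: nat
  proof -
    have "Inf (G ` S x) < Inf (G ` S x) + (1/2) ^ k" by simp
    then show ?thesis using cInf_less_iff[OF _ bdd[of x]] Sself[of x] by blast
  qed
  then obtain nx where nx: "\<And>x k. nx x k \<in> S x" "\<And>x k. G (nx x k) < Inf (G ` S x) + (1/2) ^ (k::nat)"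
    by metis
  define x where "x = rec_nat p (\<lambda>k y. nx y k)"
  have x0: "x 0 = p" and xS: "x (Suc k) = nx (x k) k" for k unfolding x_def by auto
  have step: "G (x (Suc k)) + c * dist (x k) (x (Suc k)) \<le> G (x k)" for k
    using nx(1)[of "x k" k] unfolding xS S_def by simp
  have le: "G (x l) + c * dist (x k) (x l) \<le> G (x k)" if "k \<le> l" for k l
    using that
  proof (induction l rule: dec_induct)
    case (step l)
    have "c * dist (x k) (x (Suc l)) \<le> c * (dist (x k) (x l) + dist (x l) (x (Suc l)))"
      using c by (intro mult_left_mono dist_triangle) auto
    then show ?case using step.IH \<open>\<And>k. G (x (Suc k)) + c * dist (x k) (x (Suc k)) \<le> G (x k)\<close>[of l]
      by (simp add: distrib_left)
  qed simp
  have dec: "decseq (\<lambda>k. G (x k))"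
  proof (rule decseq_SucI)
    fix k show "G (x (Suc k)) \<le> G (x k)" using step[of k] c by (smt (verit) mult_nonneg_nonneg zero_le_dist)
  qed
  then obtain g where g: "(\<lambda>k. G (x k)) \<longlonglongrightarrow> g" using decseq_convergent[OF dec] nn by blast
  have "Cauchy x"
  proof (rule metric_CauchyI)
    fix e :: real assume e: "0 < e"
    have "Cauchy (\<lambda>k. G (x k))" using g by (intro LIMSEQ_imp_Cauchy)
    then obtain N where N: "\<And>k l. N \<le> k \<Longrightarrow> N \<le> l \<Longrightarrow> dist (G (x k)) (G (x l)) < c * e"
      using metric_CauchyD[of "\<lambda>k. G (x k)" "c * e"] e c by (metis mult_pos_pos)
    have "dist (x k) (x l) < e" if "N \<le> k" "k \<le> l" for k l
    proof -
      have "c * dist (x k) (x l) < c * e"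
        using le[OF that(2)] N[of k l] that by (simp add: dist_real_def)
      then show ?thesis using c by simp
    qed
    then show "\<exists>N. \<forall>k\<ge>N. \<forall>l\<ge>N. dist (x k) (x l) < e" by (metis dist_commute nle_le)
  qed
  then obtain y where y: "x \<longlonglongrightarrow> y" using compl unfolding complete_def by blast
  have Gy: "(\<lambda>k. G (x k)) \<longlonglongrightarrow> G y"
    using continuous_on_tendsto_compose[OF cont y] by simp
  have ylim: "G y + c * dist (x k) y \<le> G (x k)" for k
  proof (rule tendsto_upperbound)
    show "(\<lambda>l. G (x l) + c * dist (x k) (x l)) \<longlonglongrightarrow> G y + c * dist (x k) y"
      using Gy y by (intro tendsto_intros)
    show "\<forall>\<^sub>F l in sequentially. G (x l) + c * dist (x k) (x l) \<le> G (x k)"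
      using eventually_ge_at_top[of k] by eventually_elim (rule le)
  qed simp
  have yp: "c * dist p y \<le> G p" using ylim[of 0] nn[of y] unfolding x0 by linarith
  have "G y = 0"
  proof (rule ccontr)
    assume "G y \<noteq> 0"
    then have "0 < G y" using nn[of y] by simp
    then obtain z where z: "z \<noteq> y" "G z + c * dist y z \<le> G y" using desc[OF yp] by blast
    \<comment> \<open>A point \<open>z\<close> below the limit \<open>y\<close> lies below every
      iterate by the triangle inequality, so the near-minimal choice of the iterates keeps
      \<open>G z\<close> from falling below the limit value.\<close>
    have "G (x (Suc k)) - (1/2) ^ k \<le> G z" for k
    proof -
      have "c * dist (x k) z \<le> c * (dist (x k) y + dist y z)" using c by (intro mult_left_mono dist_triangle) auto
      then have "z \<in> S (x k)" unfolding S_def using z ylim[of k] by (simp add: distrib_left)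
      then have "Inf (G ` S (x k)) \<le> G z" using bdd by (intro cInf_lower) auto
      then show ?thesis using nx(2)[of "x k" k] unfolding xS by simp
    qed
    moreover have "(\<lambda>k. G (x (Suc k)) - (1/2) ^ k) \<longlonglongrightarrow> G y - 0"
      using Gy by (intro tendsto_diff LIMSEQ_Suc LIMSEQ_power_zero) auto
    ultimately have "G y \<le> G z" by (intro tendsto_upperbound[of "\<lambda>k. G (x (Suc k)) - (1/2) ^ k"]) auto
    moreover have "0 < c * dist y z" using z c by simp
    ultimately show False using z by simp
  qed
  then show ?thesis using yp by blast
qed

lemma sum_quarter_powers: "(\<Sum>j<m. (1/4) ^ j) \<le> (4/3 :: real)"
  by (subst sum_gp_strict) (auto simp: field_simps)

text \<open>With weights \<open>(1/4) ^ j\<close>, all later weights together stay below one third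
  of the weight of index \<open>i\<close>. Hence progress in coordinate \<open>i\<close> outweighs
  any damage to the coordinates after it.\<close>

lemma sum_quarter_powers_tail:
  "i < m \<Longrightarrow> 3 * (\<Sum>j<m. if i < j then (1/4) ^ j else 0) + 4 * (1/4) ^ m = ((1/4) ^ i :: real)"
proof (induction m)
  case (Suc m)
  show ?case
  proof (cases "i = m")
    case True
    have "(\<Sum>j<Suc m. if i < j then (1/4::real) ^ j else 0) = 0" using True by (intro sum.neutral) auto
    then show ?thesis using True by simp
  next
    case False
    then show ?thesis using Suc by simp
  qed
qed simp

context alexandrov
begin

text \<open>Seen from points near the midpoint \<open>z\<close>, the directions to \<open>a\<close>
  and \<open>b\<close> are almost opposite, so the first variations of the two distances nearly
  cancel. Without angles this is expressed through the midpoint inequality: used once it locates the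
  direction of \<open>b\<close>, used again it bounds the change of the distance to \<open>a\<close>
  by that of the distance to \<open>b\<close>.\<close>

lemma opposite_sum_lipschitz:
  fixes a b z :: 'a
  assumes e: "0 < \<epsilon>" "\<epsilon> \<le> 1" and L: "L = 1 + 3 / \<epsilon>" and \<sigma>: "\<sigma> = 1 / (13 * (1 + L)\<^sup>2)"
    and r: "0 < r" "r \<le> R" "K * r\<^sup>2 \<le> \<sigma>\<^sup>2"
    and ab: "a \<noteq> b" "dist a b \<le> r / 2" and z: "between (1/2) a z b"
  shows "\<exists>\<rho>>0. \<forall>x\<in>ball z \<rho>. \<forall>w\<in>ball z \<rho>.
    \<bar>(dist a x + dist b x) - (dist a w + dist b w)\<bar> \<le> \<epsilon> * dist x w"
proof -
  define \<mu> where "\<mu> = \<sigma>\<^sup>2"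
  define l where "l = dist a b"
  define \<rho> where "\<rho> = \<mu> * l / 100"
  have L4: "4 \<le> L" using e unfolding L by (simp add: field_simps)
  have L3: "(L - 1) * \<epsilon> = 3" using e unfolding L by simp
  have Lsq: "25 \<le> (1 + L)\<^sup>2" using power_mono[of 5 "1 + L" 2] L4 by simp
  have s0: "0 < \<sigma>" unfolding \<sigma> using L4 by simp
  have sL: "13 * \<sigma> * (1 + L)\<^sup>2 = 1" unfolding \<sigma> using L4 by simp
  have s1: "\<sigma> \<le> 1 / 325" unfolding \<sigma> using Lsq by (intro frac_le) auto
  have m0: "0 < \<mu>" unfolding \<mu>_def using s0 by simp
  have ms: "325 * \<mu> \<le> \<sigma>"
    unfolding \<mu>_def power2_eq_square using mult_right_mono[OF s1, of \<sigma>] s0 by simp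
  have m1: "\<mu> \<le> 1 / 100" using ms s1 by linarith
  have me: "48 * \<mu> \<le> \<epsilon>"
  proof -
    have "(1 + L) * \<epsilon> \<le> (1 + L)\<^sup>2 * \<epsilon>" using L4 e by (simp add: power2_eq_square)
    moreover have "(1 + L) * \<epsilon> \<ge> 3" using L3 e by (simp add: algebra_simps)
    ultimately have "3 * \<sigma> \<le> \<sigma> * ((1 + L)\<^sup>2 * \<epsilon>)" using s0 by (simp add: mult.commute)
    also have "\<dots> = \<epsilon> / 13" using sL by (simp add: field_simps)
    finally show ?thesis using ms e by simp
  qed
  have l: "0 < l" "l \<le> r / 2" unfolding l_def using ab by auto
  have rho: "0 < \<rho>" "100 * \<rho> = \<mu> * l" "\<rho> \<le> l / 100"
    unfolding \<rho>_def using m0 m1 l by (auto simp: mult_le_cancel_right)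
  have za: "dist z a = l / 2" and zb: "dist z b = l / 2"
    using z unfolding between_def l_def by (auto simp: dist_commute)
  have main: "(dist a w + dist b w) - (dist a x + dist b x) \<le> \<epsilon> * dist x w"
    if x: "x \<in> ball z \<rho>" and w: "w \<in> ball z \<rho>" for x w
  proof (cases "x = w")
    case False
    have xw: "0 < dist x w" using False by simp
    have approx: "dist a w + dist b w \<le> dist a x + dist b x + \<epsilon> * dist x w + 3 * \<eta>"
      if eta: "0 < \<eta>" "\<eta> \<le> \<rho>" "\<eta> \<le> dist x w / 2" for \<eta>
    proof -
      have xa: "l / 2 - \<rho> \<le> dist x a" "dist x a \<le> l / 2 + \<rho>"
        using dist_triangle[of z a x] dist_triangle[of x a z] x za by (auto simp: dist_commute)
      have xa0: "2 * \<eta> \<le> dist x a" "0 < dist x a" using xa eta rho l by auto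
      obtain a' where a': "between (2 * \<eta> / dist x a) x a' a"
        using between_ex[of "2 * \<eta> / dist x a" x a] eta xa0 by auto
      have xa': "dist x a' = 2 * \<eta>" and a'a: "dist a' a = dist x a - 2 * \<eta>"
        using a' xa0 unfolding between_def by (auto simp: field_simps)
      \<comment> \<open>Geodesics from \<open>a\<close> need not extend beyond \<open>x\<close>. The
        nearby point \<open>y\<close> lies inside one, so that \<open>x\<close> and
        \<open>a'\<close> are exactly opposite as seen from \<open>y\<close>. The shift \<eta> tends
        to 0 at the end.\<close>
      obtain y where y: "between (1/2) x y a'" using between_ex[of "1/2" x a'] by auto
      have xy: "dist x y = \<eta>" and ya': "dist y a' = \<eta>" using y xa' unfolding between_def by auto
      define A B where "A = dist y a" and "B = dist y b"
      have A: "A = dist x a - \<eta>"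
        unfolding A_def using dist_triangle[of y a a'] dist_triangle[of x a y] xy ya' a'a by simp
      have zy: "dist z y \<le> 2 * \<rho>" using dist_triangle[of z y x] x xy eta by simp
      have Ab: "l / 2 - 2 * \<rho> \<le> A" "A \<le> l / 2 + 2 * \<rho>" "l / 2 - 2 * \<rho> \<le> B" "B \<le> l / 2 + 2 * \<rho>"
        using zy za zb dist_triangle[of z a y] dist_triangle[of y a z] dist_triangle[of z b y] dist_triangle[of y b z]
        unfolding A_def B_def by (auto simp: dist_commute)
      have A4: "l / 4 \<le> A" "0 < A" "l / 4 \<le> B" "0 < B" "A \<le> r" "B \<le> r" "\<eta> \<le> A" using Ab rho l eta by auto
      have mA: "\<mu> * (l / 4) \<le> \<mu> * A" using A4 m0 by (intro mult_left_mono) auto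
      have BA: "B \<le> (1 + \<mu>) * A" "(1 - \<mu>) * A \<le> B" "(2 - \<mu>) * A \<le> l"
        using Ab mA rho by (auto simp: algebra_simps)
      define t where "t = \<eta> / A"
      have t: "0 < t" "t \<le> 1" "t * A = \<eta>" unfolding t_def using eta A4 by auto
      have yaa: "between t y a' a"
        unfolding between_def A_def[symmetric] using t ya' a'a A by (simp add: left_diff_distrib)
      \<comment> \<open>A point at distance about \<eta> from \<open>y\<close> towards
        \<open>b\<close>. The homothety centred at \<open>y\<close> gives a distance of almost
        \<open>2 * \<eta>\<close> from \<open>a'\<close>, so the midpoint inequality seen from
        \<open>x1\<close> forces \<open>dist x1 x \<le> 5 * \<sigma> * \<eta>\<close>. The square
        root taken here is the reason for \<open>\<mu> = \<sigma>\<^sup>2\<close>.\<close>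
      obtain x1 where x1: "between t y x1 b" using between_ex[of t y b] t by auto
      have yx1: "dist y x1 = t * B" and x1b: "dist x1 b = B - t * B"
        using x1 unfolding between_def B_def by (auto simp: algebra_simps)
      have tB: "t * B \<le> (1 + \<mu>) * \<eta>" "(1 - \<mu>) * \<eta> \<le> t * B" "(2 - \<mu>) * \<eta> \<le> t * l"
        using mult_left_mono[OF BA(1), of t] mult_left_mono[OF BA(2), of t] mult_left_mono[OF BA(3), of t] t
        by (auto simp: mult.left_commute[of t])
      have Km: "K * r\<^sup>2 \<le> \<mu>" using r unfolding \<mu>_def by simp
      have "(1 - K * r\<^sup>2) * t * dist a b \<le> dist a' x1"
        using homothety[OF _ _ _ r(2) yaa x1] t r A4 unfolding A_def B_def by simp
      moreover have "(1 - \<mu>) * ((2 - \<mu>) * \<eta>) \<le> (1 - K * r\<^sup>2) * (t * l)"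
        by (rule mult_mono) (use Km tB m1 eta t l in auto)
      ultimately have ax1: "(1 - \<mu>) * ((2 - \<mu>) * \<eta>) \<le> dist x1 a'"
        unfolding l_def by (simp add: dist_commute mult.assoc)
      have "(1 + \<mu>) * \<eta> \<le> 2 * \<eta>" using m1 eta by (intro mult_right_mono) auto
      then have yx1r: "dist y x1 \<le> 2 * \<eta>" using tB yx1 by linarith
      have etar: "2 * \<eta> \<le> r" using eta rho l by linarith
      have "(dist x1 x)\<^sup>2 + (dist x1 a')\<^sup>2 \<le> 2 * (dist x1 y)\<^sup>2 + 2 * (dist x y)\<^sup>2 + K * r\<^sup>2 * (dist x1 y + dist x y)\<^sup>2"
        using midpoint[OF _ r(2) y, of x1] r yx1r etar xy eta by (simp add: dist_commute)
      also have "\<dots> \<le> 2 * ((1 + \<mu>) * \<eta>)\<^sup>2 + 2 * \<eta>\<^sup>2 + \<mu> * ((2 + \<mu>) * \<eta>)\<^sup>2"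
      proof -
        have "dist x1 y \<le> (1 + \<mu>) * \<eta>" using tB yx1 by (simp add: dist_commute)
        then have "(dist x1 y)\<^sup>2 \<le> ((1 + \<mu>) * \<eta>)\<^sup>2" "(dist x1 y + dist x y)\<^sup>2 \<le> ((2 + \<mu>) * \<eta>)\<^sup>2"
          using xy eta by (auto intro!: power_mono simp: algebra_simps)
        moreover from this have "K * r\<^sup>2 * (dist x1 y + dist x y)\<^sup>2 \<le> \<mu> * ((2 + \<mu>) * \<eta>)\<^sup>2"
          using Km m0 by (intro mult_mono) auto
        ultimately show ?thesis using xy by simp
      qed
      finally have q1: "(dist x1 x)\<^sup>2 + (dist x1 a')\<^sup>2 \<le> 2 * ((1 + \<mu>) * \<eta>)\<^sup>2 + 2 * \<eta>\<^sup>2 + \<mu> * ((2 + \<mu>) * \<eta>)\<^sup>2" .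
      have "((2 - 3 * \<mu>) * \<eta>)\<^sup>2 \<le> (dist x1 a')\<^sup>2"
      proof (rule power_mono)
        have "(2 - 3 * \<mu>) * \<eta> \<le> (1 - \<mu>) * ((2 - \<mu>) * \<eta>)"
          using m0 eta by (simp add: algebra_simps)
        then show "(2 - 3 * \<mu>) * \<eta> \<le> dist x1 a'" using ax1 by simp
        show "0 \<le> (2 - 3 * \<mu>) * \<eta>" using m1 eta by simp
      qed
      then have "(dist x1 x)\<^sup>2 \<le> \<eta>\<^sup>2 * (2 * (1 + \<mu>)\<^sup>2 + 2 + \<mu> * (2 + \<mu>)\<^sup>2 - (2 - 3 * \<mu>)\<^sup>2)"
        using q1 unfolding power_mult_distrib
        by (simp only: right_diff_distrib distrib_left mult.commute mult.left_commute)
      also have "\<dots> \<le> \<eta>\<^sup>2 * (25 * \<mu>)"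
      proof (rule mult_left_mono)
        have "2 * (1 + \<mu>)\<^sup>2 + 2 + \<mu> * (2 + \<mu>)\<^sup>2 - (2 - 3 * \<mu>)\<^sup>2 = \<mu> * (20 + \<mu> * (\<mu> - 3))"
          by (simp add: power2_eq_square algebra_simps)
        also have "\<dots> \<le> \<mu> * 25" using m0 m1 mult_nonneg_nonpos[of \<mu> "\<mu> - 3"] by (intro mult_left_mono) auto
        finally show "2 * (1 + \<mu>)\<^sup>2 + 2 + \<mu> * (2 + \<mu>)\<^sup>2 - (2 - 3 * \<mu>)\<^sup>2 \<le> 25 * \<mu>" by simp
      qed simp
      also have "\<dots> = (5 * \<sigma> * \<eta>)\<^sup>2" unfolding \<mu>_def by (simp add: power_mult_distrib)
      finally have x1x: "dist x1 x \<le> 5 * \<sigma> * \<eta>" by (rule power2_le_imp_le) (use s0 eta in simp)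
      \<comment> \<open>The step from \<open>y\<close> towards \<open>w\<close> is shorter than
        \<eta> by the large factor \<open>L\<close>, so that the second order terms in the distances
        to \<open>x\<close> and \<open>a'\<close> remain small against
        \<open>\<epsilon> * s\<close>.\<close>
      define s where "s = \<eta> / L"
      have s: "0 < s" "L * s = \<eta>" unfolding s_def using eta L4 by auto
      have yw: "dist x w - \<eta> \<le> dist y w" "dist y w \<le> dist x w + \<eta>"
        using dist_triangle[of x w y] dist_triangle[of y w x] xy by (auto simp: dist_commute)
      have "4 * s \<le> \<eta>" using L4 s mult_right_mono[of 4 L s] by simp
      then have syw: "s \<le> dist y w" "0 < dist y w" using yw eta s by linarith+
      define \<tau> where "\<tau> = s / dist y w"
      have tau: "0 < \<tau>" "\<tau> \<le> 1" "\<tau> * dist y w = s" unfolding \<tau>_def using s syw by auto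
      obtain w' where w': "between \<tau> y w' w" using between_ex[of \<tau> y w] tau by auto
      have yw': "dist y w' = s" using w' tau unfolding between_def by simp
      \<comment> \<open>The slope of the distance to \<open>b\<close> along the step. It will follow
        that the distance to \<open>a\<close> grows by at most
        \<open>(\<epsilon> / 2 - \<gamma>) * s\<close>.\<close>
      define \<gamma> where "\<gamma> = (dist b w' - B) / s"
      have gs: "\<gamma> * s = dist b w' - B" unfolding \<gamma>_def using s by simp
      have g: "\<bar>\<gamma>\<bar> \<le> 1"
      proof -
        have "\<bar>dist b w' - B\<bar> \<le> s"
          unfolding B_def using dist_triangle[of b w' y] dist_triangle[of b y w'] yw'
          by (auto simp: dist_commute abs_le_iff)
        then show ?thesis unfolding \<gamma>_def using s by (simp add: abs_divide)
      qed
      define \<nu> where "\<nu> = 6 * \<sigma>"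
      have "s * (L + \<gamma> - L * \<nu>) \<le> dist w' x"
      proof -
        have "dist b w' \<le> dist x1 b + dist w' x1"
          using dist_triangle[of b w' x1] by (simp add: dist_commute)
        then have "\<gamma> * s + (1 - \<mu>) * \<eta> \<le> dist w' x1" using gs x1b tB by simp
        moreover have "dist w' x1 \<le> dist w' x + 5 * \<sigma> * \<eta>"
          using dist_triangle[of w' x1 x] x1x by (simp add: dist_commute)
        moreover have "\<mu> * \<eta> \<le> \<sigma> * \<eta>" using ms m0 eta by (intro mult_right_mono) auto
        ultimately have "\<gamma> * s + \<eta> - 6 * \<sigma> * \<eta> \<le> dist w' x" by (simp add: algebra_simps)
        then show ?thesis unfolding \<nu>_def s(2)[symmetric] by (simp add: algebra_simps)
      qed
      moreover have Lg: "0 \<le> L + \<gamma> - L * \<nu>"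
      proof -
        have "L * \<nu> \<le> L * (1/2)" unfolding \<nu>_def using s1 L4 by (intro mult_left_mono) auto
        then show ?thesis using g L4 by linarith
      qed
      ultimately have "(s * (L + \<gamma> - L * \<nu>))\<^sup>2 \<le> (dist w' x)\<^sup>2" using s by (intro power_mono) auto
      moreover have "(dist w' x)\<^sup>2 + (dist w' a')\<^sup>2 \<le> 2 * s\<^sup>2 + 2 * \<eta>\<^sup>2 + \<mu> * (s + \<eta>)\<^sup>2"
      proof -
        have "(dist w' x)\<^sup>2 + (dist w' a')\<^sup>2 \<le> 2 * (dist w' y)\<^sup>2 + 2 * (dist x y)\<^sup>2 + K * r\<^sup>2 * (dist w' y + dist x y)\<^sup>2"
          using midpoint[OF _ r(2) y, of w'] r etar xy eta yw' s \<open>4 * s \<le> \<eta>\<close> by (simp add: dist_commute)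
        also have "\<dots> \<le> 2 * s\<^sup>2 + 2 * \<eta>\<^sup>2 + \<mu> * (s + \<eta>)\<^sup>2"
          using yw' xy mult_right_mono[OF Km, of "(s + \<eta>)\<^sup>2"] by (simp add: dist_commute)
        finally show ?thesis .
      qed
      ultimately have "(dist w' a')\<^sup>2 \<le> 2 * s\<^sup>2 + 2 * (L * s)\<^sup>2 + \<mu> * (s + L * s)\<^sup>2 - (s * (L + \<gamma> - L * \<nu>))\<^sup>2"
        unfolding s(2) by linarith
      also have "\<dots> = s\<^sup>2 * (2 + 2 * L\<^sup>2 + \<mu> * (1 + L)\<^sup>2 - (L + \<gamma> - L * \<nu>)\<^sup>2)"
        by (simp add: power2_eq_square algebra_simps)
      also have "\<dots> \<le> s\<^sup>2 * (L - \<gamma> + \<epsilon> / 2)\<^sup>2"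
      proof (rule mult_left_mono)
        \<comment> \<open>Here \<open>L\<close> and \<sigma> originate. The squares of
          \<open>L + \<gamma>\<close> and \<open>L - \<gamma>\<close> add up to at least
          \<open>2 * L\<^sup>2\<close>, so \<open>(L - \<gamma>) * \<epsilon>\<close> has to absorb
          2 and the errors. The errors are at most
          \<open>13 * \<sigma> * (1 + L)\<^sup>2 = 1\<close>, and
          \<open>(L - 1) * \<epsilon> = 3\<close>.\<close>
        have "(L + \<gamma>) * (L * \<nu>) \<le> (1 + L) * ((1 + L) * \<nu>)"
          using g L4 s0 unfolding \<nu>_def by (intro mult_mono) (auto simp: abs_le_iff)
        then have "(L + \<gamma>) * (L * \<nu>) \<le> (1 + L)\<^sup>2 * \<nu>" by (simp add: power2_eq_square mult.assoc)
        moreover have "(L + \<gamma> - L * \<nu>)\<^sup>2 = (L + \<gamma>)\<^sup>2 - 2 * ((L + \<gamma>) * (L * \<nu>)) + (L * \<nu>)\<^sup>2"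
          by (simp add: power2_eq_square algebra_simps)
        moreover have "0 \<le> (L * \<nu>)\<^sup>2" by simp
        ultimately have i1: "(L + \<gamma>)\<^sup>2 - 2 * ((1 + L)\<^sup>2 * \<nu>) \<le> (L + \<gamma> - L * \<nu>)\<^sup>2" by linarith
        have i2: "(L + \<gamma>)\<^sup>2 = 2 * L\<^sup>2 + 2 * \<gamma>\<^sup>2 - (L - \<gamma>)\<^sup>2" by (simp add: power2_eq_square algebra_simps)
        have i3: "\<mu> * (1 + L)\<^sup>2 + 2 * ((1 + L)\<^sup>2 * \<nu>) \<le> 1"
        proof -
          have "\<mu> * (1 + L)\<^sup>2 \<le> \<sigma> * (1 + L)\<^sup>2" using ms m0 by (intro mult_right_mono) auto
          then show ?thesis using sL unfolding \<nu>_def by (simp add: algebra_simps)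
        qed
        have i4: "(L - \<gamma> + \<epsilon> / 2)\<^sup>2 = (L - \<gamma>)\<^sup>2 + (L - \<gamma>) * \<epsilon> + (\<epsilon> / 2)\<^sup>2"
          by (simp add: power2_eq_square field_simps)
        have i5: "3 \<le> (L - \<gamma>) * \<epsilon>"
          using L3 mult_right_mono[of "L - 1" "L - \<gamma>" \<epsilon>] g e by (simp add: abs_le_iff)
        have "0 \<le> \<gamma>\<^sup>2" "0 \<le> (\<epsilon> / 2)\<^sup>2" by auto
        then show "2 + 2 * L\<^sup>2 + \<mu> * (1 + L)\<^sup>2 - (L + \<gamma> - L * \<nu>)\<^sup>2 \<le> (L - \<gamma> + \<epsilon> / 2)\<^sup>2"
          using i1 i2 i3 i4 i5 by linarith
      qed simp
      also have "\<dots> = (s * (L - \<gamma> + \<epsilon> / 2))\<^sup>2" by (simp add: power_mult_distrib)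
      finally have "dist w' a' \<le> s * (L - \<gamma> + \<epsilon> / 2)"
        by (rule power2_le_imp_le) (use s L4 g e in \<open>auto simp: abs_le_iff\<close>)
      then have "dist w' a' \<le> \<eta> - \<gamma> * s + \<epsilon> / 2 * s" unfolding s(2)[symmetric] by (simp add: algebra_simps)
      moreover have "dist a w' \<le> dist a' a + dist w' a'" using dist_triangle[of a w' a'] by (simp add: dist_commute)
      ultimately have ew': "dist a w' + dist b w' \<le> A + B + \<epsilon> / 2 * s" using gs A a'a by simp
      have ywm: "dist y w \<le> \<mu> * A" "dist y w \<le> \<mu> * B"
      proof -
        have "dist y w \<le> 3 * \<rho>" using dist_triangle[of y w z] zy w by (simp add: dist_commute)
        moreover have "\<mu> * (l / 4) \<le> \<mu> * B" using A4 m0 by (intro mult_left_mono) auto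
        ultimately show "dist y w \<le> \<mu> * A" "dist y w \<le> \<mu> * B" using mA rho by auto
      qed
      \<comment> \<open>Almost concavity from \<open>y\<close> to \<open>w\<close>: the increase
        over the whole segment is at most the initial slope times its length, up to the error. So
        the bound at \<open>w'\<close> extends to \<open>w\<close>.\<close>
      have "(1 - \<tau>) * dist a y + \<tau> * dist a w - 12 * \<mu> * \<tau> * dist y w \<le> dist a w'"
        using almost_concave[OF _ _ _ r(2) w' Km, of a] tau r m1 A4 ywm unfolding A_def B_def by (simp add: dist_commute)
      then have "A + \<tau> * (dist a w - A) - 12 * \<mu> * s \<le> dist a w'"
        unfolding A_def tau(3)[symmetric] by (simp add: dist_commute[of y a] algebra_simps)
      moreover
      have "(1 - \<tau>) * dist b y + \<tau> * dist b w - 12 * \<mu> * \<tau> * dist y w \<le> dist b w'"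
        using almost_concave[OF _ _ _ r(2) w' Km, of b] tau r m1 A4 ywm unfolding A_def B_def by (simp add: dist_commute)
      then have "B + \<tau> * (dist b w - B) - 12 * \<mu> * s \<le> dist b w'"
        unfolding B_def tau(3)[symmetric] by (simp add: dist_commute[of y b] algebra_simps)
      ultimately have "A + B + \<tau> * (dist a w + dist b w - A - B) - 24 * \<mu> * s \<le> A + B + \<epsilon> / 2 * s"
        using ew' by (simp add: algebra_simps)
      moreover have "24 * \<mu> * s \<le> \<epsilon> / 2 * s" using me s by (intro mult_right_mono) auto
      ultimately have "\<tau> * (dist a w + dist b w - A - B) \<le> \<epsilon> * s" by simp
      also have "\<dots> = \<tau> * (\<epsilon> * dist y w)" using tau by simp
      finally have "dist a w + dist b w - A - B \<le> \<epsilon> * dist y w" using tau by simp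
      moreover have "\<epsilon> * dist y w \<le> \<epsilon> * dist x w + \<eta>"
        using mult_left_mono[OF yw(2), of \<epsilon>] mult_right_mono[OF e(2), of \<eta>] e eta unfolding distrib_left by linarith
      moreover have "B \<le> dist b x + \<eta>" unfolding B_def using dist_triangle[of b y x] xy by (simp add: dist_commute)
      moreover have "A \<le> dist a x" using A eta by (simp add: dist_commute)
      ultimately show ?thesis using eta by simp
    qed
    have "dist a w + dist b w \<le> dist a x + dist b x + \<epsilon> * dist x w"
    proof (rule field_le_epsilon)
      fix \<delta> :: real assume d: "0 < \<delta>"
      define \<eta> where "\<eta> = min (min \<rho> (dist x w / 2)) (\<delta> / 3)"
      have "0 < \<eta>" "\<eta> \<le> \<rho>" "\<eta> \<le> dist x w / 2" "3 * \<eta> \<le> \<delta>" unfolding \<eta>_def using d rho xw by auto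
      then show "dist a w + dist b w \<le> dist a x + dist b x + \<epsilon> * dist x w + \<delta>" using approx[of \<eta>] by simp
    qed
    then show ?thesis by simp
  qed simp
  have "\<bar>(dist a x + dist b x) - (dist a w + dist b w)\<bar> \<le> \<epsilon> * dist x w" if "x \<in> ball z \<rho>" "w \<in> ball z \<rho>" for x w
    using main[OF that] main[OF that(2,1)] by (auto simp: abs_le_iff dist_commute)
  then show ?thesis using rho by blast
qed

end

context alexandrov
begin

text \<open>A strained ball: the pairs \<open>a\<^sub>j, b\<^sub>j\<close> are almost opposite as seen from every point of the ball,
  and, in triangular form, moving towards \<open>a\<^sub>i\<close> or \<open>b\<^sub>i\<close> hardly changes the distance to \<open>a\<^sub>j\<close> for \<open>j < i\<close>.\<close>

definition strained :: "real \<Rightarrow> real \<Rightarrow> nat \<Rightarrow> 'a \<Rightarrow> real \<Rightarrow> (nat \<Rightarrow> 'a) \<Rightarrow> (nat \<Rightarrow> 'a) \<Rightarrow> bool" where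
  "strained \<epsilon> r m p \<rho> a b \<longleftrightarrow> 0 < \<rho> \<and>
    (\<exists>D>0. \<forall>j<m. \<forall>u\<in>ball p \<rho>. D \<le> dist (a j) u \<and> D \<le> dist (b j) u) \<and>
    (\<forall>j<m. \<forall>u\<in>ball p \<rho>. dist (a j) u \<le> r \<and> dist (b j) u \<le> r) \<and>
    (\<forall>j<m. \<forall>u\<in>ball p \<rho>. \<forall>w\<in>ball p \<rho>.
      \<bar>(dist (a j) u + dist (b j) u) - (dist (a j) w + dist (b j) w)\<bar> \<le> \<epsilon> * dist u w) \<and>
    (\<forall>i<m. \<forall>j<i. \<forall>u\<in>ball p \<rho>. \<forall>w\<in>ball p \<rho>. \<forall>t\<in>{0..1}. between t u w (a i) \<or> between t u w (b i) \<longrightarrow>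
      \<bar>dist (a j) w - dist (a j) u\<bar> \<le> 10 * \<epsilon> * dist u w)"

lemma strainedE:
  assumes "strained \<epsilon> r m p \<rho> a b"
  obtains D where "0 < \<rho>" "0 < D"
    "\<And>j u. j < m \<Longrightarrow> u \<in> ball p \<rho> \<Longrightarrow> D \<le> dist (a j) u" "\<And>j u. j < m \<Longrightarrow> u \<in> ball p \<rho> \<Longrightarrow> D \<le> dist (b j) u"
    "\<And>j u. j < m \<Longrightarrow> u \<in> ball p \<rho> \<Longrightarrow> dist (a j) u \<le> r" "\<And>j u. j < m \<Longrightarrow> u \<in> ball p \<rho> \<Longrightarrow> dist (b j) u \<le> r"
    "\<And>j u w. j < m \<Longrightarrow> u \<in> ball p \<rho> \<Longrightarrow> w \<in> ball p \<rho> \<Longrightarrow>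
      \<bar>(dist (a j) u + dist (b j) u) - (dist (a j) w + dist (b j) w)\<bar> \<le> \<epsilon> * dist u w"
    "\<And>i j u w t. i < m \<Longrightarrow> j < i \<Longrightarrow> u \<in> ball p \<rho> \<Longrightarrow> w \<in> ball p \<rho> \<Longrightarrow> t \<in> {0..1} \<Longrightarrow>
      between t u w (a i) \<or> between t u w (b i) \<Longrightarrow> \<bar>dist (a j) w - dist (a j) u\<bar> \<le> 10 * \<epsilon> * dist u w"
proof -
  obtain D where D: "0 < \<rho>" "0 < D" "\<forall>j<m. \<forall>u\<in>ball p \<rho>. D \<le> dist (a j) u \<and> D \<le> dist (b j) u"
    "\<forall>j<m. \<forall>u\<in>ball p \<rho>. dist (a j) u \<le> r \<and> dist (b j) u \<le> r"
    "\<forall>j<m. \<forall>u\<in>ball p \<rho>. \<forall>w\<in>ball p \<rho>.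
      \<bar>(dist (a j) u + dist (b j) u) - (dist (a j) w + dist (b j) w)\<bar> \<le> \<epsilon> * dist u w"
    "\<forall>i<m. \<forall>j<i. \<forall>u\<in>ball p \<rho>. \<forall>w\<in>ball p \<rho>. \<forall>t\<in>{0..1}. between t u w (a i) \<or> between t u w (b i) \<longrightarrow>
      \<bar>dist (a j) w - dist (a j) u\<bar> \<le> 10 * \<epsilon> * dist u w"
    using assms unfolding strained_def by (elim conjE exE) (rule that)
  show ?thesis
    by (rule that[OF D(1,2)]) (use D(3) in blast, use D(3) in blast, use D(4) in blast, use D(4) in blast,
      use D(5) in blast, use D(6)[rule_format] in blast)
qed

text \<open>If the coordinates fail to be bi-Lipschitz near \<open>p\<close>, there are close points
  \<open>x\<close>, \<open>y\<close> at nearly equal distances from every \<open>a j\<close>, and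
  they form the new pair, around their midpoint \<open>z\<close>. Almost concavity keeps the old
  distances at \<open>z\<close> from being much smaller than at the ends, so moving towards an end
  hardly decreases them. The nearly constant sums of distances turn the lower bounds for both points
  of a pair into two-sided bounds.\<close>

lemma strained_extend:
  assumes e: "0 < \<epsilon>" "\<epsilon> \<le> 1" and L: "L = 1 + 3 / \<epsilon>" and \<sigma>: "\<sigma> = 1 / (13 * (1 + L)\<^sup>2)"
    and r: "0 < r" "r \<le> R" "K * r\<^sup>2 \<le> \<sigma>\<^sup>2" and se: "96 * \<sigma>\<^sup>2 \<le> \<epsilon>"
    and str: "strained \<epsilon> r m p \<rho> a b"
    and small: "\<And>\<rho>'. 0 < \<rho>' \<Longrightarrow> \<exists>x\<in>ball p \<rho>'. \<exists>y\<in>ball p \<rho>'. x \<noteq> y \<and>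
      (\<forall>j<m. \<bar>dist (a j) x - dist (a j) y\<bar> < \<epsilon> * dist x y)"
  shows "\<exists>p' \<rho>' a' b'. strained \<epsilon> r (Suc m) p' \<rho>' a' b'"
proof -
  define \<mu> where "\<mu> = \<sigma>\<^sup>2"
  have s0: "0 < \<sigma>" unfolding \<sigma> L using e by (simp add: add_pos_pos less_imp_neq[symmetric])
  have m0: "0 < \<mu>" and me: "96 * \<mu> \<le> \<epsilon>" and Km: "K * r\<^sup>2 \<le> \<mu>"
    using s0 se r unfolding \<mu>_def by auto
  have m1: "\<mu> \<le> 1 / 10" using me e by simp
  obtain D where rho: "0 < \<rho>" and D: "0 < D"
    "\<And>j u. j < m \<Longrightarrow> u \<in> ball p \<rho> \<Longrightarrow> D \<le> dist (a j) u" "\<And>j u. j < m \<Longrightarrow> u \<in> ball p \<rho> \<Longrightarrow> D \<le> dist (b j) u"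
    and ub: "\<And>j u. j < m \<Longrightarrow> u \<in> ball p \<rho> \<Longrightarrow> dist (a j) u \<le> r" "\<And>j u. j < m \<Longrightarrow> u \<in> ball p \<rho> \<Longrightarrow> dist (b j) u \<le> r"
    and el: "\<And>j u w. j < m \<Longrightarrow> u \<in> ball p \<rho> \<Longrightarrow> w \<in> ball p \<rho> \<Longrightarrow>
      \<bar>(dist (a j) u + dist (b j) u) - (dist (a j) w + dist (b j) w)\<bar> \<le> \<epsilon> * dist u w"
    and off: "\<And>i j u w t. i < m \<Longrightarrow> j < i \<Longrightarrow> u \<in> ball p \<rho> \<Longrightarrow> w \<in> ball p \<rho> \<Longrightarrow> t \<in> {0..1} \<Longrightarrow>
      between t u w (a i) \<or> between t u w (b i) \<Longrightarrow> \<bar>dist (a j) w - dist (a j) u\<bar> \<le> 10 * \<epsilon> * dist u w"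
    apply (rule strainedE[OF str])
    subgoal for D by (rule that[of D])
    done
  \<comment> \<open>Segments inside the ball of radius \<rho>1 must be short compared with the
    distances to the old strainers, which are at least \<open>D\<close>: almost concavity asks for
    the ratio \<mu>.\<close>
  define \<rho>1 where "\<rho>1 = min (\<rho> / 4) (min (\<mu> * D / 8) (r / 16))"
  have r1: "0 < \<rho>1" "4 * \<rho>1 \<le> \<rho>" "8 * \<rho>1 \<le> \<mu> * D" "16 * \<rho>1 \<le> r"
    unfolding \<rho>1_def using rho m0 D r by auto
  obtain x y where x: "dist p x < \<rho>1" and y: "dist p y < \<rho>1" and xy: "x \<noteq> y"
    and fxy: "\<And>j. j < m \<Longrightarrow> \<bar>dist (a j) x - dist (a j) y\<bar> < \<epsilon> * dist x y"
    using small[OF r1(1)] by auto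
  define l where "l = dist x y"
  have l: "0 < l" "l \<le> 2 * \<rho>1" unfolding l_def using xy x y dist_triangle[of x y p] by (auto simp: dist_commute)
  obtain z where z: "between (1/2) x z y" using between_ex[of "1/2" x y] by auto
  have zx: "dist z x = l / 2" and zy: "dist z y = l / 2"
    using z unfolding between_def l_def by (auto simp: dist_commute)
  obtain \<rho>E where rE: "0 < \<rho>E" "\<And>u w. u \<in> ball z \<rho>E \<Longrightarrow> w \<in> ball z \<rho>E \<Longrightarrow>
      \<bar>(dist x u + dist y u) - (dist x w + dist y w)\<bar> \<le> \<epsilon> * dist u w"
    using opposite_sum_lipschitz[OF e L \<sigma> r xy _ z] l r1 unfolding l_def by auto
  define \<rho>2 where "\<rho>2 = min \<rho>E (min \<rho>1 (\<epsilon> * l / 16))"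
  have r2: "0 < \<rho>2" "\<rho>2 \<le> \<rho>E" "\<rho>2 \<le> \<rho>1" "16 * \<rho>2 \<le> \<epsilon> * l"
    unfolding \<rho>2_def using rE r1 e l by auto
  have "\<epsilon> * l \<le> 1 * l" using e l by (intro mult_right_mono) auto
  then have r2l: "16 * \<rho>2 \<le> l" using r2 by simp
  have pz: "dist p z < 2 * \<rho>1" using dist_triangle[of p z x] x zx l by (simp add: dist_commute)
  have sub: "u \<in> ball p \<rho>" if "u \<in> ball z \<rho>2" for u
    using dist_triangle[of p u z] pz that r2 r1 by simp
  have subE: "u \<in> ball z \<rho>E" if "u \<in> ball z \<rho>2" for u using that r2 by simp
  have xp: "x \<in> ball p \<rho>" "y \<in> ball p \<rho>" "z \<in> ball p \<rho>" using x y pz r1 by auto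
  have ux: "l / 4 \<le> dist u X" "dist u X \<le> l" if "u \<in> ball z \<rho>2" "X \<in> {x, y}" for u X
    using that zx zy dist_triangle[of u X z] dist_triangle[of z X u] r2l l by (auto simp: dist_commute)
  have newoff: "\<bar>dist (a j) w - dist (a j) u\<bar> \<le> 10 * \<epsilon> * dist u w"
    if j: "j < m" and u: "u \<in> ball z \<rho>2" and w: "w \<in> ball z \<rho>2" and t: "t \<in> {0..1}"
      and X: "X \<in> {x, y}" and bt: "between t u w X" for j u w t X
  proof -
    define f g where "f v = dist (a j) v" and "g v = dist (b j) v" for v
    have eL: "\<bar>(f v + g v) - (f v' + g v')\<bar> \<le> \<epsilon> * dist v v'" if "v \<in> ball p \<rho>" "v' \<in> ball p \<rho>" for v v'
      using el[OF j that] unfolding f_def g_def .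
    have Xp: "X \<in> ball p \<rho>" using X xp by auto
    define d where "d = dist u X"
    have d: "l \<le> 4 * d" "d \<le> l" "0 \<le> d" using ux[OF u X] unfolding d_def by auto
    have lD: "l \<le> \<mu> * D" using l r1 by simp
    have big: "l \<le> \<mu> * dist c v" if "D \<le> dist c v" for c v
      by (rule order_trans[OF lD mult_left_mono[OF that]]) (use m0 in simp)
    have zf: "1/2 * f x + 1/2 * f y - 6 * \<mu> * l \<le> f z"
      using almost_concave[OF _ _ _ r(2) z Km m1, of "a j"] r ub(1)[OF j xp(1)] big[OF D(2)[OF j xp(1)]]
      unfolding f_def l_def by simp
    have zg: "1/2 * g x + 1/2 * g y - 6 * \<mu> * l \<le> g z"
      using almost_concave[OF _ _ _ r(2) z Km m1, of "b j"] r ub(2)[OF j xp(1)] big[OF D(3)[OF j xp(1)]]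
      unfolding g_def l_def by simp
    have fd: "\<bar>f x - f y\<bar> \<le> \<epsilon> * l" using fxy[OF j] unfolding f_def l_def by simp
    have gd: "\<bar>g x - g y\<bar> \<le> 2 * (\<epsilon> * l)" using fd eL[OF xp(1,2)] unfolding l_def by linarith
    have zf': "f X - 1/2 * (\<epsilon> * l) - 6 * \<mu> * l \<le> f z" using zf fd X by auto
    have zg': "g X - \<epsilon> * l - 6 * \<mu> * l \<le> g z" using zg gd X by auto
    have uz: "\<bar>f u - f z\<bar> \<le> \<rho>2" "\<bar>g u - g z\<bar> \<le> \<rho>2"
      unfolding f_def g_def using u dist_triangle[of "a j" u z] dist_triangle[of "a j" z u]
        dist_triangle[of "b j" u z] dist_triangle[of "b j" z u] by (auto simp: dist_commute abs_le_iff)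
    have mul: "96 * (\<mu> * l) \<le> \<epsilon> * l" using mult_right_mono[OF me, of l] l by simp
    have eld: "\<epsilon> * l \<le> 4 * (\<epsilon> * d)" using mult_left_mono[OF d(1), of \<epsilon>] e by simp
    have eud: "\<bar>(f u + g u) - (f X + g X)\<bar> \<le> \<epsilon> * d" unfolding d_def using eL[OF sub[OF u] Xp] .
    \<comment> \<open>An upper bound for one distance comes from a lower bound for the other through
      their sum. Since \<open>l \<le> 4 * d\<close>, the errors in units of
      \<open>\<epsilon> * d\<close> are \<open>1 + 4 + 1/4 + 1/4\<close> here and
      \<open>1 + 2 + 1/4 + 1/4\<close> in the next bound.\<close>
    have fu: "f u \<le> f X + 11/2 * (\<epsilon> * d)" using eud uz zg' r2 mul eld by linarith
    have gu: "g u \<le> g X + 7/2 * (\<epsilon> * d)" using eud uz zf' r2 mul eld by linarith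
    have dw: "dist u w = t * d" using bt unfolding between_def d_def by simp
    have t01: "0 \<le> t" "t \<le> 1" using t by auto
    have cf: "(1 - t) * f u + t * f X - 12 * \<mu> * t * d \<le> f w"
      using almost_concave[OF t01 _ r(2) bt Km m1, of "a j"] r ub(1)[OF j sub[OF u]] big[OF D(2)[OF j sub[OF u]]] d
      unfolding f_def d_def by simp
    have cg: "(1 - t) * g u + t * g X - 12 * \<mu> * t * d \<le> g w"
      using almost_concave[OF t01 _ r(2) bt Km m1, of "b j"] r ub(2)[OF j sub[OF u]] big[OF D(3)[OF j sub[OF u]]] d
      unfolding g_def d_def by simp
    have tdm: "96 * (\<mu> * (t * d)) \<le> \<epsilon> * (t * d)"
      using mult_right_mono[OF me, of "t * d"] t01 d by simp
    have etd: "0 \<le> \<epsilon> * (t * d)" using e t01 d by simp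
    have tf: "t * (f u - f X) \<le> t * (11/2 * (\<epsilon> * d))" using fu t01 by (intro mult_left_mono) auto
    have tg: "t * (g u - g X) \<le> t * (7/2 * (\<epsilon> * d))" using gu t01 by (intro mult_left_mono) auto
    have lo: "f u - 6 * (\<epsilon> * (t * d)) \<le> f w" 
    proof -
      have "f u - t * (f u - f X) - 12 * (\<mu> * (t * d)) \<le> f w" using cf by (simp add: algebra_simps)
      moreover have "t * (11/2 * (\<epsilon> * d)) = 11/2 * (\<epsilon> * (t * d))" by simp
      ultimately show ?thesis using tf tdm etd by linarith
    qed
    have lo': "g u - 4 * (\<epsilon> * (t * d)) \<le> g w" 
    proof -
      have "g u - t * (g u - g X) - 12 * (\<mu> * (t * d)) \<le> g w" using cg by (simp add: algebra_simps)
      moreover have "t * (7/2 * (\<epsilon> * d)) = 7/2 * (\<epsilon> * (t * d))" by simp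
      ultimately show ?thesis using tg tdm etd by linarith
    qed
    \<comment> \<open>Neither distance drops much from \<open>u\<close> to \<open>w\<close>, and
      their sum changes little, so neither can rise much.\<close>
    have "\<bar>(f u + g u) - (f w + g w)\<bar> \<le> \<epsilon> * (t * d)" using eL[OF sub[OF u] sub[OF w]] dw by simp
    then have "\<bar>f w - f u\<bar> \<le> 10 * (\<epsilon> * (t * d))" using lo lo' etd by linarith
    then show ?thesis unfolding dw f_def by simp
  qed
  define a' b' where "a' = a(m := x)" and "b' = b(m := y)"
  have ab': "a' m = x" "b' m = y" "\<And>j. j < m \<Longrightarrow> a' j = a j" "\<And>j. j < m \<Longrightarrow> b' j = b j"
    unfolding a'_def b'_def by auto
  have "strained \<epsilon> r (Suc m) z \<rho>2 a' b'"
    unfolding strained_def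
  proof (intro conjI)
    show "0 < \<rho>2" by (rule r2)
    show "\<exists>D>0. \<forall>j<Suc m. \<forall>u\<in>ball z \<rho>2. D \<le> dist (a' j) u \<and> D \<le> dist (b' j) u"
    proof (intro exI[of _ "min D (l / 4)"] conjI allI impI ballI)
      show "0 < min D (l / 4)" using D l by simp
      fix j u assume j: "j < Suc m" and u: "u \<in> ball z \<rho>2"
      show "min D (l / 4) \<le> dist (a' j) u" "min D (l / 4) \<le> dist (b' j) u"
        using ux[OF u, of x] ux[OF u, of y] D(2,3)[OF _ sub[OF u], of j] j ab'
        by (cases "j = m"; force simp: dist_commute min_le_iff_disj)+
    qed
    show "\<forall>j<Suc m. \<forall>u\<in>ball z \<rho>2. dist (a' j) u \<le> r \<and> dist (b' j) u \<le> r"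
    proof (intro allI impI ballI)
      fix j u assume j: "j < Suc m" and u: "u \<in> ball z \<rho>2"
      have "l \<le> r" using l r1 r by simp
      then show "dist (a' j) u \<le> r \<and> dist (b' j) u \<le> r"
        using ux[OF u, of x] ux[OF u, of y] ub[OF _ sub[OF u], of j] j ab'
        by (cases "j = m") (force simp: dist_commute)+
    qed
    show "\<forall>j<Suc m. \<forall>u\<in>ball z \<rho>2. \<forall>w\<in>ball z \<rho>2.
      \<bar>(dist (a' j) u + dist (b' j) u) - (dist (a' j) w + dist (b' j) w)\<bar> \<le> \<epsilon> * dist u w"
    proof (intro allI impI ballI)
      fix j u w assume j: "j < Suc m" and u: "u \<in> ball z \<rho>2" and w: "w \<in> ball z \<rho>2"
      show "\<bar>(dist (a' j) u + dist (b' j) u) - (dist (a' j) w + dist (b' j) w)\<bar> \<le> \<epsilon> * dist u w"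
      proof (cases "j = m")
        case True then show ?thesis using rE(2)[OF subE[OF u] subE[OF w]] ab' by simp
      next
        case False
        then have "j < m" using j by simp
        then show ?thesis using el[OF _ sub[OF u] sub[OF w]] ab' by simp
      qed
    qed
    show "\<forall>i<Suc m. \<forall>j<i. \<forall>u\<in>ball z \<rho>2. \<forall>w\<in>ball z \<rho>2. \<forall>t\<in>{0..1}.
      between t u w (a' i) \<or> between t u w (b' i) \<longrightarrow> \<bar>dist (a' j) w - dist (a' j) u\<bar> \<le> 10 * \<epsilon> * dist u w"
    proof (intro allI impI ballI)
      fix i j u w t
      assume i: "i < Suc m" "j < i" and u: "u \<in> ball z \<rho>2" and w: "w \<in> ball z \<rho>2" and t: "t \<in> {0..(1::real)}"
        and bt: "between t u w (a' i) \<or> between t u w (b' i)"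
      have j: "j < m" using i by simp
      show "\<bar>dist (a' j) w - dist (a' j) u\<bar> \<le> 10 * \<epsilon> * dist u w"
      proof (cases "i = m")
        case True
        then show ?thesis using newoff[OF j u w t, of x] newoff[OF j u w t, of y] bt ab' j by auto
      next
        case False
        then have "i < m" using i by simp
        then show ?thesis using off[OF _ i(2) sub[OF u] sub[OF w] t] bt ab' j by simp
      qed
    qed
  qed
  then show ?thesis by blast
qed

text \<open>For a coordinate that misses its target, moving towards \<open>a i\<close> lowers it at
  rate 1 and moving towards \<open>b i\<close> raises it at rate at least
  \<open>1 - \<epsilon>\<close>. Earlier coordinates barely move, later ones move at most at rate 1
  but carry much smaller weights. The weighted error thus decreases at rate \<open>c\<close>, and
  the descent principle yields an exact solution.\<close>

lemma strained_onto_box: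
  assumes compl: "complete (UNIV :: 'a set)" and e: "0 < \<epsilon>" "100 * \<epsilon> \<le> (1/4) ^ m"
    and str: "strained \<epsilon> r m p \<rho> a b"
  shows "\<exists>\<tau>>0. \<forall>v. (\<forall>j<m. \<bar>v j - dist (a j) p\<bar> \<le> \<tau>) \<longrightarrow> (\<exists>x\<in>ball p \<rho>. \<forall>j<m. dist (a j) x = v j)"
proof -
  obtain D where rho: "0 < \<rho>" and D: "0 < D"
    "\<And>j u. j < m \<Longrightarrow> u \<in> ball p \<rho> \<Longrightarrow> D \<le> dist (a j) u" "\<And>j u. j < m \<Longrightarrow> u \<in> ball p \<rho> \<Longrightarrow> D \<le> dist (b j) u"
    and "\<And>j u. j < m \<Longrightarrow> u \<in> ball p \<rho> \<Longrightarrow> dist (a j) u \<le> r" "\<And>j u. j < m \<Longrightarrow> u \<in> ball p \<rho> \<Longrightarrow> dist (b j) u \<le> r"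
    and el: "\<And>j u w. j < m \<Longrightarrow> u \<in> ball p \<rho> \<Longrightarrow> w \<in> ball p \<rho> \<Longrightarrow>
      \<bar>(dist (a j) u + dist (b j) u) - (dist (a j) w + dist (b j) w)\<bar> \<le> \<epsilon> * dist u w"
    and off: "\<And>i j u w t. i < m \<Longrightarrow> j < i \<Longrightarrow> u \<in> ball p \<rho> \<Longrightarrow> w \<in> ball p \<rho> \<Longrightarrow> t \<in> {0..1} \<Longrightarrow>
      between t u w (a i) \<or> between t u w (b i) \<Longrightarrow> \<bar>dist (a j) w - dist (a j) u\<bar> \<le> 10 * \<epsilon> * dist u w"
    apply (rule strainedE[OF str])
    subgoal for D by (rule that[of D])
    done
  define c :: real where "c = (1/4) ^ m / 2"
  have c: "0 < c" unfolding c_def by simp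
  \<comment> \<open>The initial error is at most \<open>4/3 * \<tau> = c * \<rho> / 3\<close>, so
    the descent stays within \<rho>/2 of \<open>p\<close>.\<close>
  define \<tau> where "\<tau> = c * \<rho> / 4"
  have tau: "0 < \<tau>" unfolding \<tau>_def using c rho by simp
  have "\<exists>x\<in>ball p \<rho>. \<forall>j<m. dist (a j) x = v j" if v: "\<And>j. j < m \<Longrightarrow> \<bar>v j - dist (a j) p\<bar> \<le> \<tau>" for v
  proof -
    define G where "G x = (\<Sum>j<m. (1/4) ^ j * \<bar>dist (a j) x - v j\<bar>)" for x
    have nn: "0 \<le> G x" for x unfolding G_def by (intro sum_nonneg) auto
    have "G p \<le> (\<Sum>j<m. (1/4) ^ j * \<tau>)"
      unfolding G_def using v by (intro sum_mono mult_left_mono) (auto simp: abs_minus_commute)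
    also have "\<dots> = (\<Sum>j<m. (1/4) ^ j) * \<tau>" by (simp add: sum_distrib_right)
    also have "\<dots> \<le> 4/3 * \<tau>" using sum_quarter_powers[of m] tau by (intro mult_right_mono) auto
    finally have Gp: "2 * G p \<le> c * \<rho>" using tau nn[of p] unfolding \<tau>_def by (simp add: mult.commute)
    have "\<exists>x. c * dist p x \<le> G p \<and> G x = 0"
    proof (rule caristi_descent[OF compl _ nn c])
      show "continuous_on UNIV G" unfolding G_def by (intro continuous_intros)
      fix x assume x: "c * dist p x \<le> G p" and Gx: "0 < G x"
      have "2 * (c * dist p x) \<le> c * \<rho>" using x Gp by linarith
      then have "c * (2 * dist p x) \<le> c * \<rho>" by (simp add: mult.left_commute)
      then have "2 * dist p x \<le> \<rho>" using c by simp
      then have xb: "x \<in> ball p \<rho>" "2 * dist p x \<le> \<rho>" using rho by auto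
      obtain i where i: "i < m" "dist (a i) x \<noteq> v i"
      proof (rule ccontr)
        assume "\<not> thesis"
        then have "G x = 0" unfolding G_def using that by (intro sum.neutral) auto
        then show False using Gx by simp
      qed
      have e1: "\<epsilon> \<le> 1" using e power_le_one[of "1/4::real" m] by simp
      obtain s x' t where s: "0 < s" and xx': "dist x x' = s" and x'b: "x' \<in> ball p \<rho>" and t: "t \<in> {0..1}"
        and bt: "between t x x' (a i) \<or> between t x x' (b i)"
        and gain: "\<bar>dist (a i) x' - v i\<bar> \<le> \<bar>dist (a i) x - v i\<bar> - (1 - \<epsilon>) * s"
      proof (cases "v i < dist (a i) x")
        case True
        define s where "s = min (min (dist (a i) x - v i) (dist (a i) x)) (\<rho> / 4)"
        have x0: "0 < dist x (a i)" using D(1) D(2)[OF i(1) xb(1)] dist_commute[of x "a i"] by linarith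
        have s: "0 < s" "s \<le> dist (a i) x - v i" "s \<le> dist x (a i)" "s \<le> \<rho> / 4"
          unfolding s_def using True x0 rho dist_commute[of x "a i"] by linarith+
        obtain x' where x': "between (s / dist x (a i)) x x' (a i)"
          using between_ex[of "s / dist x (a i)" x "a i"] s x0 by auto
        have xx': "dist x x' = s" "dist x' (a i) = dist x (a i) - s"
          using x' x0 unfolding between_def by (auto simp: left_diff_distrib)
        have "x' \<in> ball p \<rho>" using dist_triangle[of p x' x] xx' xb s rho by simp
        moreover have "0 \<le> \<epsilon> * s" using e s by simp
        then have "\<bar>dist (a i) x' - v i\<bar> \<le> \<bar>dist (a i) x - v i\<bar> - (1 - \<epsilon>) * s"
          using xx'(2) s by (simp add: dist_commute left_diff_distrib)
        moreover have "s / dist x (a i) \<in> {0..1}" using s x0 by simp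
        ultimately show ?thesis using that s(1) xx'(1) x' by blast
      next
        case False
        define s where "s = min (min (v i - dist (a i) x) (dist (b i) x)) (\<rho> / 4)"
        have x0: "0 < dist x (b i)" using D(1) D(3)[OF i(1) xb(1)] dist_commute[of x "b i"] by linarith
        have s: "0 < s" "s \<le> v i - dist (a i) x" "s \<le> dist x (b i)" "s \<le> \<rho> / 4"
          unfolding s_def using False i(2) x0 rho dist_commute[of x "b i"] by linarith+
        obtain x' where x': "between (s / dist x (b i)) x x' (b i)"
          using between_ex[of "s / dist x (b i)" x "b i"] s x0 by auto
        have xx': "dist x x' = s" "dist x' (b i) = dist x (b i) - s"
          using x' x0 unfolding between_def by (auto simp: left_diff_distrib)
        have x'b: "x' \<in> ball p \<rho>" using dist_triangle[of p x' x] xx' xb s rho by simp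
        have "dist (a i) x' \<le> dist (a i) x + s" using dist_triangle[of "a i" x' x] xx' by (simp add: dist_commute)
        moreover have "dist (a i) x + s - \<epsilon> * s \<le> dist (a i) x'"
          using el[OF i(1) xb(1) x'b] xx' by (simp add: dist_commute abs_le_iff)
        ultimately have "\<bar>dist (a i) x' - v i\<bar> \<le> \<bar>dist (a i) x - v i\<bar> - (1 - \<epsilon>) * s"
          using s by (simp add: left_diff_distrib)
        moreover have "s / dist x (b i) \<in> {0..1}" using s x0 by simp
        ultimately show ?thesis using that s(1) xx'(1) x'b x' by blast
      qed
      have fj: "\<bar>dist (a j) x' - dist (a j) x\<bar> \<le> s" for j
        using dist_triangle[of "a j" x' x] dist_triangle[of "a j" x x'] xx' by (auto simp: dist_commute abs_le_iff)
      have fj': "\<bar>dist (a j) x' - dist (a j) x\<bar> \<le> 10 * \<epsilon> * s" if "j < i" for j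
        using off[OF i(1) that xb(1) x'b t bt] xx' by simp
      have "(1/4) ^ j * \<bar>dist (a j) x' - v j\<bar> \<le> (1/4) ^ j * \<bar>dist (a j) x - v j\<bar> +
          (10 * \<epsilon> * s * (1/4) ^ j + s * (if i < j then (1/4) ^ j else 0) - (if j = i then (1 - \<epsilon>) * s * (1/4) ^ i else 0))"
        if "j < m" for j
      proof -
        have "\<bar>dist (a j) x' - v j\<bar> \<le> \<bar>dist (a j) x - v j\<bar> +
          (10 * \<epsilon> * s + (if i < j then s else 0) - (if j = i then (1 - \<epsilon>) * s else 0))"
        proof -
          have "0 \<le> 10 * \<epsilon> * s" using e s by simp
          then show ?thesis using fj[of j] fj'[of j] gain by (cases "j < i"; cases "j = i") auto
        qed
        then have "(1/4) ^ j * \<bar>dist (a j) x' - v j\<bar> \<le> (1/4) ^ j * (\<bar>dist (a j) x - v j\<bar> +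
          (10 * \<epsilon> * s + (if i < j then s else 0) - (if j = i then (1 - \<epsilon>) * s else 0)))"
          by (intro mult_left_mono) auto
        then show ?thesis by (auto simp: algebra_simps split: if_splits)
      qed
      then have "G x' \<le> (\<Sum>j<m. (1/4) ^ j * \<bar>dist (a j) x - v j\<bar> +
          (10 * \<epsilon> * s * (1/4) ^ j + s * (if i < j then (1/4) ^ j else 0) - (if j = i then (1 - \<epsilon>) * s * (1/4) ^ i else 0)))"
        unfolding G_def by (intro sum_mono) auto
      also have "\<dots> = G x + (10 * \<epsilon> * s * (\<Sum>j<m. (1/4) ^ j) + s * (\<Sum>j<m. if i < j then (1/4) ^ j else 0)
          - (1 - \<epsilon>) * s * (1/4) ^ i)"
        unfolding G_def using i by (simp add: sum.distrib sum_subtractf sum_distrib_left)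
      \<comment> \<open>The balance with \<open>100 * \<epsilon> \<le> q\<close>: the gain is almost
        \<open>q * s\<close>, later coordinates cost at most a third of it, and the terms with
        \<epsilon> cost less than \<open>q * s / 6\<close>; at least \<open>q * s / 2\<close>
        remains.\<close>
      also have "\<dots> \<le> G x - c * s"
      proof -
        define q :: real where "q = (1/4) ^ i"
        have q: "0 < q" "100 * \<epsilon> \<le> q" "c \<le> q / 2"
        proof -
          have "(1/4::real) ^ m \<le> q" unfolding q_def using i by (intro power_decreasing) auto
          then show "100 * \<epsilon> \<le> q" "c \<le> q / 2" using e unfolding c_def by auto
          show "0 < q" unfolding q_def by simp
        qed
        have h1: "10 * \<epsilon> * s * (\<Sum>j<m. (1/4) ^ j) \<le> 40/3 * (\<epsilon> * s)"
          using mult_left_mono[OF sum_quarter_powers[of m], of "10 * \<epsilon> * s"] e s by simp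
        have h2: "100 * (\<epsilon> * s) \<le> q * s" using mult_right_mono[OF q(2), of s] s by simp
        have h3: "s * (\<Sum>j<m. if i < j then (1/4) ^ j else 0) \<le> q * s / 3"
        proof -
          have "0 \<le> (4::real) * (1/4) ^ m" by simp
          then have "(\<Sum>j<m. if i < j then (1/4) ^ j else 0) \<le> q / 3"
            using sum_quarter_powers_tail[OF i(1)] unfolding q_def by linarith
          from mult_left_mono[OF this, of s] show ?thesis using s by (simp add: mult.commute)
        qed
        have h4: "q * s - \<epsilon> * s \<le> (1 - \<epsilon>) * s * q"
        proof -
          have "\<epsilon> * s * q \<le> \<epsilon> * s * 1"
            using e s unfolding q_def by (intro mult_left_mono) (auto simp: power_le_one)
          then show ?thesis by (simp add: algebra_simps)
        qed
        have h5: "c * s \<le> q * s / 2" using mult_right_mono[OF q(3), of s] s by simp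
        have "0 < q * s" using q s by simp
        then show ?thesis unfolding q_def[symmetric] using h1 h2 h3 h4 h5 by linarith
      qed
      finally show "\<exists>y. y \<noteq> x \<and> G y + c * dist x y \<le> G x" using xx' s by (intro exI[of _ x']) auto
    qed
    then obtain x where x: "c * dist p x \<le> G p" "G x = 0" by blast
    have "c * (2 * dist p x) \<le> c * \<rho>" using x(1) Gp by simp
    then have "2 * dist p x \<le> \<rho>" using c by simp
    moreover have "dist (a j) x = v j" if "j < m" for j
      using x(2) that unfolding G_def by (subst (asm) sum_nonneg_eq_0_iff) auto
    ultimately show ?thesis using rho by (intro bexI[of _ x]) auto
  qed
  then show ?thesis using tau by blast
qed

end

section \<open>Dimension and volume\<close>

lemma geodesic_chain_induct:
  assumes ex: "\<And>t (x::'a::metric_space) y. 0 \<le> t \<Longrightarrow> t \<le> 1 \<Longrightarrow> \<exists>m. between t x m y"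
    and d: "0 < d" and P: "P p" and step: "\<And>x y. P x \<Longrightarrow> dist x y \<le> d \<Longrightarrow> P y"
  shows "P (q :: 'a)"
proof -
  have "P q" if "dist p q \<le> real N * d" for N q
    using that
  proof (induction N arbitrary: q)
    case 0 then show ?case using P by simp
  next
    case (Suc N)
    define t where "t = real N / (real N + 1)"
    have t: "0 \<le> t" "t \<le> 1" unfolding t_def by auto
    obtain m where m: "between t p m q" using ex[OF t] by blast
    have "dist p m = t * dist p q" "dist m q = (1 - t) * dist p q" using m unfolding between_def by auto
    moreover have "t * dist p q \<le> t * ((real N + 1) * d)" "(1 - t) * dist p q \<le> (1 - t) * ((real N + 1) * d)"
      by (rule mult_left_mono; use Suc.prems t in \<open>simp add: add.commute\<close>)+
    moreover have "t * ((real N + 1) * d) = real N * d" unfolding t_def by (simp add: field_simps)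
    moreover have "(1 - t) * ((real N + 1) * d) = d" unfolding t_def by (simp add: field_simps)
    ultimately have "dist p m \<le> real N * d" "dist m q \<le> d" by auto
    then show ?case using Suc.IH step by blast
  qed
  moreover obtain N :: nat where "dist p q / d \<le> real N" using real_arch_simple by blast
  then have "dist p q \<le> real N * d" using d by (simp add: field_simps)
  ultimately show ?thesis by blast
qed

section \<open>Homotheties, measures of balls and the dimension\<close>

context alexandrov
begin

text \<open>All dividing points are collected instead of one chosen for each \<open>x\<close>:
  limits of dividing points are dividing points, but need not be the chosen ones, and the image has
  to be closed when density is used.\<close>

definition homothetic :: "real \<Rightarrow> 'a \<Rightarrow> 'a set \<Rightarrow> 'a set" where
  "homothetic t v S = {m. \<exists>x\<in>S. between t v m x}"

lemma K_small:
  assumes "0 \<le> r" "r \<le> R"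
  shows "K * r\<^sup>2 \<le> 1 / 10" "0 \<le> K * r\<^sup>2" "0 < 1 - K * r\<^sup>2" "1/2 \<le> 1 - K * r\<^sup>2" "1 - K * r\<^sup>2 \<le> 1"
proof -
  have "K * r\<^sup>2 \<le> K * R\<^sup>2" using assms K_nonneg by (intro mult_left_mono power_mono) auto
  moreover have "0 \<le> K * r\<^sup>2" using K_nonneg by simp
  ultimately show "K * r\<^sup>2 \<le> 1 / 10" "0 \<le> K * r\<^sup>2" "0 < 1 - K * r\<^sup>2" "1/2 \<le> 1 - K * r\<^sup>2" "1 - K * r\<^sup>2 \<le> 1"
    using KR by auto
qed

lemma homothetic_measure:
  assumes t: "0 < t" "t \<le> 1" and r: "0 \<le> r" "r \<le> R" and S: "\<And>x. x \<in> S \<Longrightarrow> dist v x \<le> r" and s: "0 \<le> s"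
  shows "ennreal (((1 - K * r\<^sup>2) * t) powr s) * hausdorff_measure s S \<le> hausdorff_measure s (homothetic t v S)"
proof -
  define lam where "lam = (1 - K * r\<^sup>2) * t"
  have l: "0 < lam" unfolding lam_def using K_small[OF r] t by simp
  define \<phi> where "\<phi> x = (SOME m. between t v m x)" for x
  have phi: "between t v (\<phi> x) x" for x
    using someI_ex[OF between_ex[of t v x]] t unfolding \<phi>_def by simp
  have "dist x y \<le> 1 / lam * dist (\<phi> x) (\<phi> y)" if "x \<in> S" "y \<in> S" for x y
    using homothety[OF _ t(2) r phi phi, of x y] S that t l unfolding lam_def[symmetric]
    by (simp add: field_simps)
  then have "hausdorff_measure s S \<le> ennreal ((1 / lam) powr s) * hausdorff_measure s (\<phi> ` S)"
    using l s by (intro hausdorff_measure_expanding) auto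
  also have "\<dots> \<le> ennreal ((1 / lam) powr s) * hausdorff_measure s (homothetic t v S)"
    using phi unfolding homothetic_def by (intro mult_left_mono hausdorff_measure_mono) auto
  finally have "ennreal (lam powr s) * hausdorff_measure s S \<le>
    ennreal (lam powr s) * (ennreal ((1 / lam) powr s) * hausdorff_measure s (homothetic t v S))"
    by (rule mult_left_mono) simp
  also have "\<dots> = ennreal (lam powr s * (1 / lam) powr s) * hausdorff_measure s (homothetic t v S)"
    by (simp add: ennreal_mult mult.assoc)
  also have "lam powr s * (1 / lam) powr s = 1" using l by (simp add: powr_divide)
  finally show ?thesis unfolding lam_def by simp
qed

lemma homothetic_ball_subset:
  assumes "0 < t" "S \<subseteq> ball v r" "t * r \<le> r'"
  shows "homothetic t v S \<subseteq> ball v r'"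
proof
  fix m assume "m \<in> homothetic t v S"
  then obtain x where x: "x \<in> S" "between t v m x" unfolding homothetic_def by blast
  then have "dist v m = t * dist v x" unfolding between_def by simp
  also have "\<dots> < t * r" using assms x by (intro mult_strict_left_mono) auto
  finally show "m \<in> ball v r'" using assms by simp
qed

lemma hausdorff_measure_ball_scale:
  fixes v :: 'a
  assumes "0 < t" "t \<le> 1" "0 \<le> r" "r \<le> R" "0 \<le> s"
  shows "ennreal (((1 - K * r\<^sup>2) * t) powr s) * hausdorff_measure s (ball v r) \<le> hausdorff_measure s (ball v (t * r))"
proof (rule order_trans[OF homothetic_measure[OF assms(1-4) _ assms(5)] hausdorff_measure_mono])
  show "homothetic t v (ball v r) \<subseteq> ball v (t * r)" using assms(1) by (intro homothetic_ball_subset) auto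
qed simp

text \<open>The homothety centred at \<open>v\<close> shrinks \<open>ball v R\<close>, which
  contains \<open>ball q (R / 2)\<close>, into \<open>ball v \<sigma>\<close>. The factor depends on
  neither point, so nullity, finiteness and positivity travel along chains, and packings can be
  counted.\<close>

lemma hausdorff_measure_ball_transfer:
  assumes sg: "0 < \<sigma>" and s: "0 \<le> s"
  shows "\<exists>c>0. \<forall>(v::'a) q. dist v q \<le> R / 2 \<longrightarrow>
    ennreal c * hausdorff_measure s (ball q (R / 2)) \<le> hausdorff_measure s (ball v \<sigma>)"
proof -
  define t where "t = min 1 (\<sigma> / R)"
  have t: "0 < t" "t \<le> 1" "t * R \<le> \<sigma>" unfolding t_def using sg R_pos by (auto simp: min_def field_simps)
  define c where "c = ((1 - K * R\<^sup>2) * t) powr s"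
  have "ennreal c * hausdorff_measure s (ball q (R / 2)) \<le> hausdorff_measure s (ball v \<sigma>)"
    if d: "dist v q \<le> R / 2" for v q :: 'a
  proof -
    have sub: "ball q (R / 2) \<subseteq> ball v R"
    proof
      fix x assume "x \<in> ball q (R / 2)"
      then show "x \<in> ball v R" using d dist_triangle[of v x q] by simp
    qed
    have "ennreal c * hausdorff_measure s (ball q (R / 2)) \<le> ennreal c * hausdorff_measure s (ball v R)"
      by (intro mult_left_mono hausdorff_measure_mono sub) simp
    also have "\<dots> \<le> hausdorff_measure s (ball v (t * R))"
      using hausdorff_measure_ball_scale[OF t(1,2) _ _ s, of R v] R_pos unfolding c_def by simp
    also have "\<dots> \<le> hausdorff_measure s (ball v \<sigma>)" using t by (intro hausdorff_measure_mono subset_ball) auto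
    finally show ?thesis .
  qed
  moreover have "0 < c" unfolding c_def using K_small[of R] R_pos t by auto
  ultimately show ?thesis by blast
qed

text \<open>Nullity spreads from one ball to all balls of radius \<open>R / 2\<close>. To reach the
  whole space a countable cover by small sets is required; separability is not assumed, and the
  cover comes from the vanishing measure in some exponent \<open>s0\<close>.\<close>

lemma hausdorff_measure_null_everywhere:
  assumes cov: "hausdorff_measure s0 (UNIV :: 'a set) = 0" and "0 < \<sigma>" "0 \<le> s" "hausdorff_measure s (ball (p :: 'a) \<sigma>) = 0"
  shows "hausdorff_measure s (UNIV :: 'a set) = 0"
proof -
  have step: "hausdorff_measure s (ball y (R / 2)) = 0"
    if null: "hausdorff_measure s (ball x \<rho>) = 0" and rho: "0 < \<rho>" and xy: "dist x y \<le> R / 2" for x y :: 'a and \<rho>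
  proof -
    obtain c where "0 < c" "ennreal c * hausdorff_measure s (ball y (R / 2)) \<le> hausdorff_measure s (ball x \<rho>)"
      using hausdorff_measure_ball_transfer[OF rho assms(3)] xy by blast
    then show ?thesis using null by (auto simp: ennreal_eq_0_iff)
  qed
  have all: "hausdorff_measure s (ball q (R / 2)) = 0" for q :: 'a
  proof (rule geodesic_chain_induct[where d = "R / 2" and p = p and q = q])
    show "hausdorff_measure s (ball p (R / 2)) = 0" using step[OF assms(4,2)] R_pos by simp
    show "hausdorff_measure s (ball y (R / 2)) = 0" if "hausdorff_measure s (ball x (R / 2)) = 0" "dist x y \<le> R / 2"
      for x y :: 'a using step[OF that(1) _ that(2)] R_pos by simp
  qed (use between_ex R_pos in auto)
  have "hausdorff_pre s0 (R / 4) (UNIV :: 'a set) = 0"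
    using hausdorff_pre_le_measure[of "R / 4" s0 "UNIV :: 'a set"] cov R_pos by simp
  then have "hausdorff_pre s0 (R / 4) (UNIV :: 'a set) < 1" by simp
  then obtain C where C: "(UNIV :: 'a set) \<subseteq> (\<Union>i. C i)" "\<And>i::nat. bounded (C i)" "\<And>i. diameter (C i) \<le> R / 4"
    and "(\<Sum>i. hterm s0 (C i)) < 1"
    by (elim hausdorff_pre_lessE) (rule that)
  have "hausdorff_measure s (C i) = 0" for i
  proof (cases "C i = {}")
    case False
    then obtain x where x: "x \<in> C i" by blast
    have "C i \<subseteq> ball x (R / 2)"
    proof
      fix y assume "y \<in> C i"
      then have "dist x y \<le> R / 4" using diameter_bounded_bound[OF C(2) x] C(3)[of i] order_trans by blast
      then show "y \<in> ball x (R / 2)" using R_pos by simp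
    qed
    then show ?thesis using hausdorff_measure_mono[of "C i" "ball x (R / 2)" s] all[of x] by simp
  qed simp
  then have "hausdorff_measure s (\<Union>i. C i) \<le> 0" using hausdorff_measure_UN[of s C] by simp
  then show ?thesis using C(1) hausdorff_measure_mono[of UNIV "\<Union>i. C i" s] by simp
qed

lemma strained_subball:
  assumes "strained \<epsilon> r m p \<rho> a b" "0 < \<rho>'" "\<rho>' \<le> \<rho>"
  shows "strained \<epsilon> r m p \<rho>' a b"
proof -
  have "ball p \<rho>' \<subseteq> ball p \<rho>" using assms by (intro subset_ball)
  then have sub: "u \<in> ball p \<rho>" if "u \<in> ball p \<rho>'" for u using that by blast
  show ?thesis
    apply (rule strainedE[OF assms(1)])
    subgoal for D
      unfolding strained_def using assms(2) sub by (intro conjI exI[of _ D] allI impI ballI) simp_all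
    done
qed

text \<open>A ball that carries as many strainers as possible is bi-Lipschitz to a subset of Euclidean space:
  otherwise the strainer could be enlarged. Openness of the distance map and homotheties force the
  number of strainers to be the dimension.\<close>

lemma regular_ball_exists:
  assumes compl: "complete (UNIV :: 'a set)" and dim: "hausdorff_dim (UNIV :: 'a set) = ereal (real n)"
  obtains p :: 'a and \<rho> C where "0 < \<rho>" "\<rho> \<le> R / 8" "0 < hausdorff_measure (real n) (ball p \<rho>)"
    "\<And>q r. 0 < r \<Longrightarrow> ball q r \<subseteq> ball p \<rho> \<Longrightarrow> hausdorff_measure (real n) (ball q r) \<le> ennreal (C * r ^ n)"
proof -
  \<comment> \<open>The exponent \<open>Suc n\<close> makes the openness result available for
    \<open>n + 1\<close> pairs, which is how a strainer with too many pairs is excluded.\<close>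
  define \<epsilon> :: real where "\<epsilon> = (1/4) ^ (Suc n) / 100"
  define L where "L = 1 + 3 / \<epsilon>"
  define \<sigma> where "\<sigma> = 1 / (13 * (1 + L)\<^sup>2)"
  \<comment> \<open>The factor \<sigma> turns \<open>K * R\<^sup>2 \<le> 1\<close> into
    \<open>K * r\<^sup>2 \<le> \<sigma>\<^sup>2\<close>.\<close>
  define r where "r = min R (\<sigma> * R)"
  have e: "0 < \<epsilon>" "\<epsilon> \<le> 1" unfolding \<epsilon>_def using power_le_one[of "1/4::real" "Suc n"] by auto
  have em: "100 * \<epsilon> \<le> (1/4) ^ m" if "m \<le> Suc n" for m
    unfolding \<epsilon>_def using power_decreasing[OF that, of "1/4::real"] by simp
  have L3: "3 / \<epsilon> \<le> L" "4 \<le> L" unfolding L_def using e by (auto simp: field_simps)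
  have s0: "0 < \<sigma>" unfolding \<sigma>_def using L3 by simp
  have se: "96 * \<sigma>\<^sup>2 \<le> \<epsilon>"
  proof -
    have "L \<le> (1 + L)\<^sup>2" using L3 by (simp add: power2_eq_square algebra_simps)
    then have "13 * (3 / \<epsilon>) \<le> 13 * (1 + L)\<^sup>2" using L3 by simp
    then have "\<sigma> \<le> 1 / (13 * (3 / \<epsilon>))" unfolding \<sigma>_def using e L3 by (intro divide_left_mono mult_pos_pos) auto
    then have "\<sigma> \<le> \<epsilon> / 39" by simp
    moreover from this have "\<sigma> \<le> 1 / 39" using e by simp
    ultimately have "\<sigma> * \<sigma> \<le> \<epsilon> / 39 * (1 / 39)" using s0 by (intro mult_mono) auto
    then show ?thesis using e by (simp add: power2_eq_square)
  qed
  have r: "0 < r" "r \<le> R" unfolding r_def using R_pos s0 by auto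
  have Kr: "K * r\<^sup>2 \<le> \<sigma>\<^sup>2"
  proof -
    have "r\<^sup>2 \<le> (\<sigma> * R)\<^sup>2" using r unfolding r_def by (intro power_mono) auto
    then have "K * r\<^sup>2 \<le> K * (\<sigma> * R)\<^sup>2" using K_nonneg by (rule mult_left_mono)
    also have "\<dots> = \<sigma>\<^sup>2 * (K * R\<^sup>2)" by (simp add: power_mult_distrib)
    also have "\<dots> \<le> \<sigma>\<^sup>2 * 1" using KR by (intro mult_left_mono) auto
    finally show ?thesis by simp
  qed
  define S where "S m \<longleftrightarrow> (\<exists>p \<rho> a b. strained \<epsilon> r m p \<rho> a b)" for m
  have Inf: "Inf {ereal s | s. 0 \<le> s \<and> hausdorff_measure s (UNIV :: 'a set) = 0} = ereal (real n)"
    using dim unfolding hausdorff_dim_def .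
  have below: "hausdorff_measure s (UNIV :: 'a set) \<noteq> 0" if "0 \<le> s" "s < real n" for s
  proof
    assume "hausdorff_measure s (UNIV :: 'a set) = 0"
    then have "ereal (real n) \<le> ereal s" unfolding Inf[symmetric] using that by (intro Inf_lower) auto
    then show False using that by simp
  qed
  have above: "hausdorff_measure s (UNIV :: 'a set) = 0" if s: "real n < s" for s
  proof -
    have "Inf {ereal s | s. 0 \<le> s \<and> hausdorff_measure s (UNIV :: 'a set) = 0} < ereal s" unfolding Inf using s by simp
    then obtain s' where "0 \<le> s'" "hausdorff_measure s' (UNIV :: 'a set) = 0" "s' < s"
      unfolding Inf_less_iff by auto
    then show ?thesis using hausdorff_measure_zero_mono[of s' UNIV s] by simp
  qed
  have pos: "\<exists>c>0. ennreal c \<le> hausdorff_measure (real m) (ball p \<rho>)"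
    if m: "m \<le> Suc n" and str: "strained \<epsilon> r m p \<rho> a b" for m p \<rho> a b
  proof -
    obtain \<tau> where tau: "0 < \<tau>"
      "\<And>v. (\<And>j. j < m \<Longrightarrow> \<bar>v j - dist (a j) p\<bar> \<le> \<tau>) \<Longrightarrow> \<exists>x\<in>ball p \<rho>. \<forall>j<m. dist (a j) x = v j"
      using strained_onto_box[OF compl e(1) em[OF m] str] by blast
    have "ennreal (\<tau> ^ m) \<le> hausdorff_measure (real m) (ball p \<rho>)"
    proof (rule hausdorff_measure_onto_box[OF tau(1), where F = "\<lambda>j. dist (a j)" and c = "\<lambda>j. dist (a j) p"])
      fix j x y show "\<bar>dist (a j) x - dist (a j) y\<bar> \<le> dist x y"
        using dist_triangle[of "a j" x y] dist_triangle[of "a j" y x] by (simp add: abs_le_iff dist_commute)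
    qed (use tau(2) in blast)
    then show ?thesis using tau(1) by (intro exI[of _ "\<tau> ^ m"]) auto
  qed
  have "strained \<epsilon> r 0 p 1 a b" for p a b unfolding strained_def by (intro conjI exI[of _ 1]) auto
  then have S0: "S 0" unfolding S_def by blast
  have Sle: "m \<le> n" if Sm: "S m" and m: "m \<le> Suc n" for m
  proof (rule ccontr)
    assume "\<not> m \<le> n"
    then have "hausdorff_measure (real m) (UNIV :: 'a set) = 0" using above by simp
    moreover obtain p \<rho> a b where "strained \<epsilon> r m p \<rho> a b" using Sm unfolding S_def by blast
    from pos[OF m this] obtain c where "0 < c" "ennreal c \<le> hausdorff_measure (real m) (ball p \<rho>)" by blast
    ultimately show False using hausdorff_measure_mono[of "ball p \<rho>" UNIV "real m"] by simp
  qed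
  define M where "M = (GREATEST m. S m \<and> m \<le> n)"
  have M: "S M" "M \<le> n" "\<And>m. S m \<Longrightarrow> m \<le> n \<Longrightarrow> m \<le> M"
    unfolding M_def using GreatestI_nat[of "\<lambda>m. S m \<and> m \<le> n" 0 n] S0
    by (auto intro: Greatest_le_nat[of "\<lambda>m. S m \<and> m \<le> n" _ n])
  obtain p \<rho> a b where str: "strained \<epsilon> r M p \<rho> a b" using M(1) unfolding S_def by blast
  have rho: "0 < \<rho>" using str unfolding strained_def by simp
  have "\<not> S (Suc M)"
  proof
    assume a: "S (Suc M)"
    then have "Suc M \<le> n" using Sle M(2) by simp
    then show False using M(3)[OF a] by simp
  qed
  then have "\<not> (\<forall>\<rho>'>0. \<exists>x\<in>ball p \<rho>'. \<exists>y\<in>ball p \<rho>'. x \<noteq> y \<and>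
      (\<forall>j<M. \<bar>dist (a j) x - dist (a j) y\<bar> < \<epsilon> * dist x y))"
    using strained_extend[OF e L_def \<sigma>_def r Kr se str] unfolding S_def by metis
  then obtain \<rho>1 where r1: "0 < \<rho>1" "\<And>x y. x \<in> ball p \<rho>1 \<Longrightarrow> y \<in> ball p \<rho>1 \<Longrightarrow> x \<noteq> y \<Longrightarrow>
      \<exists>j<M. \<epsilon> * dist x y \<le> \<bar>dist (a j) x - dist (a j) y\<bar>"
    by (meson not_less)
  define \<rho>2 where "\<rho>2 = min (min \<rho> \<rho>1) (R / 8)"
  have r2: "0 < \<rho>2" "\<rho>2 \<le> \<rho>" "\<rho>2 \<le> \<rho>1" "\<rho>2 \<le> R / 8" unfolding \<rho>2_def using rho r1 R_pos by auto
  have chart: "hausdorff_measure (real M) (ball q s) \<le> ennreal ((2 * s / \<epsilon>) ^ M)"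
    "real M < s' \<Longrightarrow> hausdorff_measure s' (ball q s) = 0"
    if "0 < s" "ball q s \<subseteq> ball p \<rho>2" for q s s'
  proof -
    have sub: "x \<in> ball p \<rho>1" if "x \<in> ball q s" for x using \<open>ball q s \<subseteq> ball p \<rho>2\<close> that r2 by auto
    have b: "\<bar>dist (a j) x - dist (a j) q\<bar> < s" if "x \<in> ball q s" for j x
      using dist_triangle[of "a j" x q] dist_triangle[of "a j" q x] that by (auto simp: abs_less_iff dist_commute)
    show "hausdorff_measure (real M) (ball q s) \<le> ennreal ((2 * s / \<epsilon>) ^ M)"
      by (rule hausdorff_measure_chart_le(1)[where F = "\<lambda>j. dist (a j)" and c = "\<lambda>j. dist (a j) q"])
        (fact e(1), fact that(1), rule b, assumption, rule r1(2)[OF sub sub])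
    show "hausdorff_measure s' (ball q s) = 0" if "real M < s'"
      by (rule hausdorff_measure_chart_le(2)[where F = "\<lambda>j. dist (a j)" and c = "\<lambda>j. dist (a j) q"
          and r = s and \<epsilon> = \<epsilon>, OF _ _ _ _ that])
        (fact e(1), fact \<open>0 < s\<close>, rule b, assumption, rule r1(2)[OF sub sub])
  qed
  \<comment> \<open>With fewer than \<open>n\<close> coordinates, an exponent halfway between
    \<open>M\<close> and \<open>n\<close> would give measure zero to one ball, hence to the space,
    contrary to its dimension.\<close>
  have "M = n"
  proof (rule ccontr)
    assume "M \<noteq> n"
    then have "real M < (real M + real n) / 2" "(real M + real n) / 2 < real n" using M(2) by auto
    then have "hausdorff_measure ((real M + real n) / 2) (ball p \<rho>2) = 0" using chart(2)[OF r2(1), of p] by simp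
    then have "hausdorff_measure ((real M + real n) / 2) (UNIV :: 'a set) = 0"
      using hausdorff_measure_null_everywhere[OF above[of "real n + 1"] r2(1)] by simp
    then show False using below \<open>(real M + real n) / 2 < real n\<close> by simp
  qed
  have "strained \<epsilon> r n p \<rho>2 a b"
    using strained_subball[OF str r2(1,2)] unfolding \<open>M = n\<close> .
  from pos[OF _ this] obtain c where "0 < c" "ennreal c \<le> hausdorff_measure (real n) (ball p \<rho>2)" by auto
  then have posn: "0 < hausdorff_measure (real n) (ball p \<rho>2)" by (metis ennreal_less_zero_iff less_le_trans)
  have "hausdorff_measure (real n) (ball q s) \<le> ennreal ((2 / \<epsilon>) ^ n * s ^ n)"
    if "0 < s" "ball q s \<subseteq> ball p \<rho>2" for q s
    using chart(1)[OF that] unfolding \<open>M = n\<close> by (simp add: power_mult_distrib[symmetric])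
  then show ?thesis by (rule that[OF r2(1,4) posn])
qed

end

lemma ennreal_suminf_tail:
  fixes a :: "nat \<Rightarrow> ennreal"
  assumes "(\<Sum>i. a i) < top" "0 < e"
  shows "\<exists>N. \<forall>k\<ge>N. (\<Sum>i. a (i + k)) < e"
proof -
  have "a i < top" for i using ennreal_suminf_lessD[OF assms(1)] .
  then have a: "a i = ennreal (enn2real (a i))" for i by (simp add: less_top)
  have sm: "summable (\<lambda>i. enn2real (a i))"
    using assms(1) by (intro summable_suminf_not_top) (auto simp flip: a)
  obtain d where d: "0 < d" "ennreal d \<le> e"
  proof (cases e)
    case (real x)
    then show ?thesis using that[of x] assms(2) by simp
  next
    case top
    then show ?thesis using that[of 1] by simp
  qed
  obtain N where N: "\<And>k. N \<le> k \<Longrightarrow> norm (\<Sum>i. enn2real (a (i + k))) < d"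
    using suminf_exist_split[OF d(1) sm] by blast
  have "(\<Sum>i. a (i + k)) < e" if "N \<le> k" for k
  proof -
    have s: "summable (\<lambda>i. enn2real (a (i + k)))" using summable_ignore_initial_segment[OF sm] .
    have "(\<Sum>i. a (i + k)) = (\<Sum>i. ennreal (enn2real (a (i + k))))" using a by simp
    also have "\<dots> = ennreal (\<Sum>i. enn2real (a (i + k)))" using s by (intro suminf_ennreal2) auto
    also have "\<dots> < ennreal d" using N[OF that] d by (intro ennreal_lessI) auto
    finally show ?thesis using d(2) by (rule less_le_trans)
  qed
  then show ?thesis by blast
qed

lemma one_minus_power_ge:
  assumes "0 \<le> x" "x \<le> 1" "real n * x \<le> y"
  shows "1 - y \<le> (1 - x) ^ n"
  using Bernoulli_inequality[of "- x" n] assms by simp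

locale alexandrov_dim = alexandrov K R ty for K R :: real and ty :: "'a::metric_space itself" +
  fixes n :: nat
  assumes finite_ball: "\<And>q::'a. hausdorff_measure (real n) (ball q (R / 2)) < top"
    and pos_ball: "\<And>(q::'a) \<sigma>. 0 < \<sigma> \<Longrightarrow> 0 < hausdorff_measure (real n) (ball q \<sigma>)"

lemma (in alexandrov) alexandrov_dimI:
  assumes rho: "0 < \<rho>" "\<rho> \<le> R / 8" and pos: "0 < hausdorff_measure (real n) (ball (p::'a) \<rho>)"
    and fin: "hausdorff_measure (real n) (ball p \<rho>) < top"
  shows "alexandrov_dim K R ty n"
proof -
  define P where "P q \<longleftrightarrow> hausdorff_measure (real n) (ball q (R / 2)) < top \<and>
    (\<forall>\<sigma>>0. 0 < hausdorff_measure (real n) (ball q \<sigma>))" for q :: 'a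
  have finstep: "hausdorff_measure (real n) (ball y (R / 2)) < top"
    if hx: "hausdorff_measure (real n) (ball x \<sigma>) < top" and "0 < \<sigma>" and xy: "dist x y \<le> R / 2" for x y :: 'a and \<sigma>
  proof -
    obtain c where c: "0 < c" "ennreal c * hausdorff_measure (real n) (ball y (R / 2)) \<le> hausdorff_measure (real n) (ball x \<sigma>)"
      using hausdorff_measure_ball_transfer[OF \<open>0 < \<sigma>\<close>, of "real n"] xy by auto
    then have "ennreal c * hausdorff_measure (real n) (ball y (R / 2)) < top" using hx by (meson le_less_trans)
    then show ?thesis using c(1) by (auto simp: ennreal_mult_less_top less_top)
  qed
  have posstep: "0 < hausdorff_measure (real n) (ball y \<sigma>)"
    if hx: "0 < hausdorff_measure (real n) (ball x (R / 2))" and "0 < \<sigma>" and xy: "dist x y \<le> R / 2" for x y :: 'a and \<sigma>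
  proof -
    obtain c where c: "0 < c" "ennreal c * hausdorff_measure (real n) (ball x (R / 2)) \<le> hausdorff_measure (real n) (ball y \<sigma>)"
      using hausdorff_measure_ball_transfer[OF \<open>0 < \<sigma>\<close>, of "real n"] xy by (auto simp: dist_commute)
    have "0 < ennreal c * hausdorff_measure (real n) (ball x (R / 2))" using c(1) hx by (simp add: ennreal_zero_less_mult_iff)
    then show ?thesis using c(2) by (rule less_le_trans)
  qed
  have "ball p \<rho> \<subseteq> ball p (R / 2)" using rho R_pos by (intro subset_ball) auto
  then have pp: "0 < hausdorff_measure (real n) (ball p (R / 2))"
    using pos hausdorff_measure_mono less_le_trans by blast
  have Pp: "P p" unfolding P_def using finstep[OF fin rho(1), of p] posstep[OF pp, of _ p] R_pos by simp
  have "P y" if "P x" "dist x y \<le> R / 2" for x y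
    using that finstep[of x "R / 2" y] posstep[of x _ y] R_pos unfolding P_def by simp
  then have "P q" for q
    using geodesic_chain_induct[where P = P and d = "R / 2" and p = p and q = q] between_ex R_pos Pp by auto
  then show ?thesis unfolding P_def by unfold_locales auto
qed

section \<open>Real-valued volume, midpoints and density\<close>

context alexandrov_dim
begin

text \<open>Infinite measure is sent to 0 by \<open>enn2real\<close>, so finiteness accompanies the
  volume as the separate predicate \<open>fin\<close>.\<close>

definition vol :: "'a set \<Rightarrow> real" where "vol S = enn2real (hausdorff_measure (real n) S)"

definition fin :: "'a set \<Rightarrow> bool" where "fin S \<longleftrightarrow> hausdorff_measure (real n) S < top"

lemma vol_eq: "fin S \<Longrightarrow> hausdorff_measure (real n) S = ennreal (vol S)"
  unfolding vol_def fin_def by (simp add: less_top)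

lemma vol_nonneg [simp]: "0 \<le> vol S"
  unfolding vol_def by simp

lemma fin_subset: "fin B \<Longrightarrow> A \<subseteq> B \<Longrightarrow> fin A"
  unfolding fin_def using hausdorff_measure_mono le_less_trans by blast

lemma fin_ball: "r \<le> R / 2 \<Longrightarrow> fin (ball q r)"
  by (rule fin_subset[of "ball q (R / 2)"]) (auto simp: fin_def finite_ball)

lemma vol_mono: "fin B \<Longrightarrow> A \<subseteq> B \<Longrightarrow> vol A \<le> vol B"
  using hausdorff_measure_mono[of A B "real n"] fin_subset[of B A]
  unfolding vol_def fin_def by (intro enn2real_mono) auto

lemma vol_subadd:
  assumes "fin A" "fin B" "C \<subseteq> A \<union> B"
  shows "vol C \<le> vol A + vol B"
proof -
  have "hausdorff_measure (real n) C \<le> hausdorff_measure (real n) A + hausdorff_measure (real n) B"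
    using hausdorff_measure_mono[OF assms(3)] hausdorff_measure_Un order_trans by blast
  also have "\<dots> = ennreal (vol A + vol B)" using assms by (simp add: vol_eq)
  finally show ?thesis unfolding vol_def[of C] by (rule enn2real_leI[rotated]) simp
qed

lemma vol_ball_pos: "0 < r \<Longrightarrow> r \<le> R / 2 \<Longrightarrow> 0 < vol (ball q r)"
  using pos_ball[of r q] fin_ball[of r q] unfolding vol_def fin_def by (simp add: enn2real_positive_iff)

lemma vol_homothetic:
  assumes t: "0 < t" "t \<le> 1" and r: "0 \<le> r" "r \<le> R" and S: "\<And>x. x \<in> S \<Longrightarrow> dist v x \<le> r"
    and f: "fin S" "fin T" and T: "homothetic t v S \<subseteq> T"
  shows "((1 - K * r\<^sup>2) * t) ^ n * vol S \<le> vol T"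
proof -
  have pos: "0 < (1 - K * r\<^sup>2) * t" using K_small[OF r] t by simp
  have "ennreal (((1 - K * r\<^sup>2) * t) ^ n) * ennreal (vol S) \<le> ennreal (vol T)"
    using homothetic_measure[OF t r S, of S "real n"] hausdorff_measure_mono[OF T, of "real n"] f pos
    by (simp add: vol_eq[symmetric] powr_realpow)
  then show ?thesis using pos by (simp add: ennreal_mult[symmetric])
qed

lemma vol_ball_scale:
  assumes "0 < t" "t \<le> 1" "0 \<le> r" "r \<le> R / 2"
  shows "((1 - K * r\<^sup>2) * t) ^ n * vol (ball v r) \<le> vol (ball v (t * r))" "(t / 2) ^ n * vol (ball v r) \<le> vol (ball v (t * r))"
proof -
  have rR: "r \<le> R" using assms R_pos by simp
  have tr: "t * r \<le> 1 * r" using assms by (intro mult_right_mono) auto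
  show 1: "((1 - K * r\<^sup>2) * t) ^ n * vol (ball v r) \<le> vol (ball v (t * r))"
    using assms tr by (intro vol_homothetic[where v = v] rR fin_ball homothetic_ball_subset[where r = r]) auto
  have "(t / 2) ^ n \<le> ((1 - K * r\<^sup>2) * t) ^ n"
    using K_small(4)[OF assms(3) rR] assms mult_right_mono[of "1/2" "1 - K * r\<^sup>2" t] by (intro power_mono) auto
  then show "(t / 2) ^ n * vol (ball v r) \<le> vol (ball v (t * r))" using 1 mult_right_mono[OF _ vol_nonneg] order_trans by blast
qed

text \<open>The power \<open>(1/32) ^ n\<close> is the product of \<open>(1/4) ^ n\<close> and \<open>(1/8) ^ n\<close>, the volume factors of homotheties with
  ratios \<open>1/2\<close> and \<open>1/4\<close>, each with a factor \<open>1/2\<close> to absorb the curvature error.\<close>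

definition \<theta> :: real where "\<theta> = (1/32) ^ n / 4"

lemma theta_bounds: "0 < \<theta>" "\<theta> \<le> 1 / 4"
  unfolding \<theta>_def using power_le_one[of "1/32::real" n] by auto

text \<open>A variant of Steinhaus' theorem: in a ball that is almost filled by \<open>A\<close>, the homothety with centre
  \<open>z\<close> and ratio \<open>1/2\<close> cannot map \<open>A\<close> into its complement.\<close>

lemma steinhaus:
  assumes rho: "0 < \<rho>" "\<rho> \<le> R / 2" and A: "vol (ball p \<rho> - A) \<le> \<theta> * vol (ball p \<rho>)" and z: "z \<in> ball p (\<rho> / 4)"
  shows "\<exists>y\<in>A. \<exists>m\<in>A. between (1/2) z m y"
proof (rule ccontr)
  assume neg: "\<not> ?thesis"
  \<comment> \<open>Points of the quarter ball, moved halfway towards \<open>z\<close>, stay inside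
    \<open>ball p \<rho>\<close>; by assumption they leave \<open>A\<close>, so their volume is
    limited by that of the complement.\<close>
  define Y where "Y = A \<inter> ball p (\<rho> / 4)"
  define b where "b = vol (ball p \<rho>)"
  have b: "0 < b" unfolding b_def using vol_ball_pos rho by simp
  have fb: "fin (ball p \<rho>)" using fin_ball rho by simp
  have fY: "fin Y" by (rule fin_subset[OF fb]) (use rho in \<open>auto simp: Y_def\<close>)
  have fd: "fin (ball p \<rho> - A)" by (rule fin_subset[OF fb]) auto
  have sub: "homothetic (1/2) z Y \<subseteq> ball p \<rho> - A"
  proof
    fix m assume "m \<in> homothetic (1/2) z Y"
    then obtain y where y: "y \<in> Y" "between (1/2) z m y" unfolding homothetic_def by blast
    have "dist z m = 1/2 * dist z y" using y(2) unfolding between_def by simp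
    moreover have "dist z y < \<rho> / 2" using y(1) z dist_triangle[of z y p] unfolding Y_def by (simp add: dist_commute)
    ultimately have "dist p m < \<rho>" using dist_triangle[of p m z] z rho by simp
    moreover have "m \<notin> A" using neg y unfolding Y_def by blast
    ultimately show "m \<in> ball p \<rho> - A" by simp
  qed
  have dY: "dist z y \<le> \<rho>" if "y \<in> Y" for y
    using that z dist_triangle[of z y p] rho unfolding Y_def by (simp add: dist_commute)
  have rR: "\<rho> \<le> R" using rho R_pos by simp
  have "((1 - K * \<rho>\<^sup>2) * (1/2)) ^ n * vol Y \<le> vol (ball p \<rho> - A)"
    using rho rR by (intro vol_homothetic[OF _ _ _ _ dY fY fd sub]) auto
  moreover have "(1/4) ^ n * vol Y \<le> ((1 - K * \<rho>\<^sup>2) * (1/2)) ^ n * vol Y"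
    using K_small(4)[of \<rho>] rho rR by (intro mult_right_mono power_mono) auto
  ultimately have h1: "(1/4) ^ n * vol Y \<le> \<theta> * b" using A unfolding b_def by linarith
  have "(1/4 / 2) ^ n * vol (ball p \<rho>) \<le> vol (ball p (1/4 * \<rho>))"
    using vol_ball_scale(2)[of "1/4" \<rho> p] rho by simp
  also have "\<dots> \<le> vol Y + vol (ball p \<rho> - A)"
    using rho by (intro vol_subadd fY fd) (auto simp: Y_def)
  finally have h2: "(1/8) ^ n * b \<le> vol Y + \<theta> * b" using A unfolding b_def by simp
  \<comment> \<open>The quarter ball has at least the fraction \<open>(1/8) ^ n\<close> of the
    volume, and halving retains \<open>(1/4) ^ n\<close> of \<open>Y\<close>. Together this would
    give \<open>(1/32) ^ n \<le> 2 * \<theta>\<close>, while \<theta> is a quarter of that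
    power.\<close>
  have "(1/4) ^ n * ((1/8) ^ n * b) \<le> (1/4) ^ n * (vol Y + \<theta> * b)" using h2 by (intro mult_left_mono) auto
  also have "\<dots> \<le> \<theta> * b + 1 * (\<theta> * b)"
    using h1 theta_bounds b power_le_one[of "1/4::real" n] unfolding distrib_left by (intro add_mono mult_right_mono) auto
  finally have "(1/4) ^ n * (1/8) ^ n * b \<le> 2 * \<theta> * b" by (simp add: mult_ac)
  then have "(1/4) ^ n * (1/8) ^ n \<le> 2 * \<theta>" using b by simp
  moreover have "(1/4::real) ^ n * (1/8) ^ n = (1/32) ^ n" by (simp flip: power_mult_distrib)
  moreover have "0 < (1/32::real) ^ n" by simp
  ultimately show False unfolding \<theta>_def by linarith
qed

text \<open>The counting argument behind the Lebesgue density theorem, at a single small radius: a closed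
  set of positive measure almost fills some ball centred at one of its points.\<close>

lemma density_ball:
  assumes W: "closed W" "W \<subseteq> ball q (R / 4)" "0 < vol W" and th: "0 < \<theta>'" and e: "0 < e"
  shows "\<exists>r>0. r < e \<and> (\<exists>w\<in>W. vol (ball w r - W) \<le> \<theta>' * vol (ball w r))"
proof -
  define B where "B = ball q (R / 2)"
  have fB: "fin B" unfolding B_def by (rule fin_ball) simp
  have WB: "W \<subseteq> B" using W(2) R_pos unfolding B_def by auto
  have Wne: "W \<noteq> {}" using W(3) unfolding vol_def by auto
  define d0 where "d0 = R / 8"
  define rad where "rad j = d0 * (1/2) ^ j" for j :: nat
  have rad: "0 < rad j" "rad j \<le> d0" for j
    unfolding rad_def d0_def using R_pos by (auto simp: mult_le_cancel_left1 power_le_one)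
  have near: "x \<in> B" if x: "infdist x W \<le> d0" for x
  proof -
    have "infdist x W < 2 * d0" using x R_pos unfolding d0_def by simp
    then obtain w where "w \<in> W" "dist x w < 2 * d0"
      unfolding infdist_notempty[OF Wne] using cINF_less_iff[of W "dist x" "2 * d0"] Wne by (auto intro: bdd_belowI[of _ 0])
    then show ?thesis using W(2) dist_triangle[of q x w] unfolding B_def d0_def by (auto simp: dist_commute)
  qed
  \<comment> \<open>Dyadic layers around \<open>W\<close>. Distinct layers of equal parity are a
    positive distance apart, so both parity series are bounded by the measure of \<open>B\<close>
    and have small tails. As \<open>W\<close> is closed, the layers exhaust its neighbourhood
    outside \<open>W\<close>.\<close>
  define A where "A j = {x. rad (Suc j) < infdist x W \<and> infdist x W \<le> rad j}" for j
  have AB: "A j \<subseteq> B" for j using near rad(2)[of j] unfolding A_def by fastforce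
  have sep: "rad (j + 2) \<le> dist x y" if "x \<in> A i" "y \<in> A j" "i + 2 \<le> j" for i j x y
  proof -
    have "infdist x W \<le> infdist y W + dist x y" by (rule infdist_triangle)
    moreover have "rad j \<le> rad (i + 2)" unfolding rad_def d0_def
      using that(3) R_pos by (intro mult_left_mono power_decreasing) auto
    moreover have "rad (i + 2) + rad (j + 2) \<le> rad (Suc i)"
    proof -
      have "rad (j + 2) \<le> rad (i + 2)" unfolding rad_def d0_def
        using that(3) R_pos by (intro mult_left_mono power_decreasing) auto
      moreover have "rad (Suc i) = 2 * rad (i + 2)" unfolding rad_def by simp
      ultimately show ?thesis by simp
    qed
    ultimately show ?thesis using that(1,2) unfolding A_def by simp
  qed
  have par: "(\<Sum>j<N. hausdorff_measure (real n) (A (2 * j + k))) \<le> hausdorff_measure (real n) B" for N k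
  proof -
    have "(\<Sum>j<N. hausdorff_measure (real n) (A (2 * j + k))) \<le> hausdorff_measure (real n) (\<Union>j<N. A (2 * j + k))"
    proof (rule hausdorff_measure_separated_finite)
      show "0 < rad (2 * N + k + 2)" by (rule rad)
      fix i j x y assume ij: "i \<in> {..<N}" "j \<in> {..<N}" "i \<noteq> j" "x \<in> A (2 * i + k)" "y \<in> A (2 * j + k)"
      have mono: "rad (2 * N + k + 2) \<le> rad (2 * l + k + 2)" if "l \<in> {..<N}" for l
        unfolding rad_def d0_def using that R_pos by (intro mult_left_mono power_decreasing) auto
      consider "i < j" | "j < i" using ij(3) by linarith
      then show "rad (2 * N + k + 2) \<le> dist x y"
      proof cases
        case 1 then show ?thesis using sep[OF ij(4,5)] mono[OF ij(2)] by simp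
      next
        case 2 then show ?thesis using sep[OF ij(5,4)] mono[OF ij(1)] by (simp add: dist_commute)
      qed
    qed simp
    also have "\<dots> \<le> hausdorff_measure (real n) B" using AB by (intro hausdorff_measure_mono) auto
    finally show ?thesis .
  qed
  have "(\<Sum>j. hausdorff_measure (real n) (A (2 * j + k))) \<le> hausdorff_measure (real n) B" for k
    by (rule suminf_le_const) (use par in auto)
  then have fs: "(\<Sum>j. hausdorff_measure (real n) (A (2 * j + k))) < top" for k
    using fB unfolding fin_def by (meson le_less_trans)
  \<comment> \<open>The balls found below have total volume at least
    \<open>(1/8) ^ n * vol W\<close>. The radius will be so small that the part of the
    \<open>r\<close>-neighbourhood outside \<open>W\<close> has volume less than \<theta>' times
    this.\<close>
  define c where "c = \<theta>' * (1/8) ^ n * vol W"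
  have c: "0 < c" unfolding c_def using th W(3) by simp
  obtain N0 where N0: "\<And>j. N0 \<le> j \<Longrightarrow> (\<Sum>i. hausdorff_measure (real n) (A (2 * (i + j) + 0))) < ennreal (c / 2)"
    using ennreal_suminf_tail[OF fs[of 0], of "ennreal (c / 2)"] c by auto
  obtain N1 where N1: "\<And>j. N1 \<le> j \<Longrightarrow> (\<Sum>i. hausdorff_measure (real n) (A (2 * (i + j) + 1))) < ennreal (c / 2)"
    using ennreal_suminf_tail[OF fs[of 1], of "ennreal (c / 2)"] c by auto
  have "(\<lambda>j. d0 * (1/2) ^ j) \<longlonglongrightarrow> d0 * 0" by (intro tendsto_mult tendsto_const LIMSEQ_power_zero) simp
  then have "eventually (\<lambda>j. rad j < e) sequentially" unfolding rad_def using e by (intro order_tendstoD) auto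
  then obtain N2 where N2: "\<And>j. N2 \<le> j \<Longrightarrow> rad j < e" unfolding eventually_sequentially by blast
  define J where "J = max N0 (max N1 N2)"
  define r where "r = rad (2 * J)"
  have "N2 \<le> 2 * J" unfolding J_def by simp
  then have r: "0 < r" "r < e" "r \<le> R / 8" unfolding r_def using rad[of "2 * J"] N2 unfolding d0_def by auto
  define OW where "OW = {x. infdist x W \<le> r} - W"
  have OWB: "OW \<subseteq> B" using near r unfolding OW_def d0_def by auto
  have "hausdorff_measure (real n) OW < ennreal c"
  proof -
    have "OW \<subseteq> (\<Union>i. A (2 * (i + J) + 0)) \<union> (\<Union>i. A (2 * (i + J) + 1))"
    proof
      fix x assume x: "x \<in> OW"
      have "0 < infdist x W" using x W(1) Wne unfolding OW_def
        by (metis Diff_iff in_closed_iff_infdist_zero infdist_nonneg less_eq_real_def)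
      moreover have "(\<lambda>j. d0 * (1/2) ^ j) \<longlonglongrightarrow> 0" using \<open>(\<lambda>j. d0 * (1/2) ^ j) \<longlonglongrightarrow> d0 * 0\<close> by simp
      ultimately have "eventually (\<lambda>j. rad j < infdist x W) sequentially" unfolding rad_def by (intro order_tendstoD)
      then obtain N where N: "rad N < infdist x W" unfolding eventually_sequentially by blast
      define j where "j = (LEAST j. rad j < infdist x W)"
      have j1: "rad j < infdist x W" unfolding j_def using N by (rule LeastI)
      have j2: "2 * J < j"
      proof (rule ccontr)
        assume "\<not> 2 * J < j"
        then have "rad (2 * J) \<le> rad j" unfolding rad_def d0_def using R_pos by (intro mult_left_mono power_decreasing) auto
        then show False using j1 x unfolding OW_def r_def by simp
      qed
      then obtain i where i: "j = Suc i" "2 * J \<le> i" by (cases j) auto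
      have "\<not> rad i < infdist x W" using not_less_Least[of i "\<lambda>j. rad j < infdist x W"] i unfolding j_def by simp
      then have xi: "x \<in> A i" using j1 i unfolding A_def by simp
      obtain l where l: "i = 2 * J + l" using i(2) le_Suc_ex by blast
      then have "i = 2 * (l div 2 + J) + l mod 2" by simp
      moreover have "l mod 2 = 0 \<or> l mod 2 = 1" by auto
      ultimately show "x \<in> (\<Union>i. A (2 * (i + J) + 0)) \<union> (\<Union>i. A (2 * (i + J) + 1))" using xi by (metis UN_I UNIV_I Un_iff)
    qed
    then have "hausdorff_measure (real n) OW \<le> hausdorff_measure (real n) (\<Union>i. A (2 * (i + J) + 0))
        + hausdorff_measure (real n) (\<Union>i. A (2 * (i + J) + 1))"
      using hausdorff_measure_mono hausdorff_measure_Un order_trans by blast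
    also have "\<dots> \<le> (\<Sum>i. hausdorff_measure (real n) (A (2 * (i + J) + 0))) + (\<Sum>i. hausdorff_measure (real n) (A (2 * (i + J) + 1)))"
      by (intro add_mono hausdorff_measure_UN)
    also have "\<dots> < ennreal (c / 2) + ennreal (c / 2)"
      by (intro add_strict_mono N0 N1) (auto simp: J_def)
    also have "\<dots> = ennreal c" using c by (simp flip: ennreal_plus)
    finally show ?thesis .
  qed
  then have OWc: "vol OW < c"
    using vol_eq[OF fin_subset[OF fB OWB]] c by (simp add: ennreal_less_iff)
  have bB: "ball w r \<subseteq> B" if "w \<in> W" for w
  proof
    fix x assume "x \<in> ball w r"
    then show "x \<in> B" using that W(2) r dist_triangle[of q x w] R_pos unfolding B_def by force
  qed
  have fbr: "fin (ball w r)" for w using r R_pos by (intro fin_ball) simp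
  \<comment> \<open>Separation \<open>3 * r\<close> keeps the balls of radius \<open>r\<close> at
    mutual distance at least \<open>r\<close>, so their volumes add up inside \<open>B\<close>. A
    uniform lower bound for each volume bounds the cardinality, which yields a maximal family
    without compactness.\<close>
  define P where "P E \<longleftrightarrow> finite E \<and> E \<subseteq> W \<and> (\<forall>x\<in>E. \<forall>y\<in>E. x \<noteq> y \<longrightarrow> 3 * r \<le> dist x y)" for E
  have sepb: "(\<Sum>x\<in>E. vol (T x)) \<le> vol U" if E: "P E" and U: "fin U" and T: "\<And>x. x \<in> E \<Longrightarrow> T x \<subseteq> ball x r \<and> T x \<subseteq> U" for E T U
  proof -
    have fT: "fin (T x)" if "x \<in> E" for x using fin_subset[OF U] T that by blast
    have "(\<Sum>x\<in>E. hausdorff_measure (real n) (T x)) \<le> hausdorff_measure (real n) (\<Union>x\<in>E. T x)"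
    proof (rule hausdorff_measure_separated_finite)
      show "finite E" "0 < r" using E r unfolding P_def by auto
      fix x y u v assume xy: "x \<in> E" "y \<in> E" "x \<noteq> y" "u \<in> T x" "v \<in> T y"
      have "u \<in> ball x r" "v \<in> ball y r" using T[OF xy(1)] T[OF xy(2)] xy(4,5) by blast+
      then have "dist x u < r" "dist y v < r" by auto
      moreover have "3 * r \<le> dist x y" using E xy unfolding P_def by auto
      moreover have "dist x y \<le> dist x u + dist u v + dist v y"
        using dist_triangle[of x y u] dist_triangle[of u y v] by linarith
      ultimately show "r \<le> dist u v" by (simp add: dist_commute)
    qed
    also have "\<dots> \<le> hausdorff_measure (real n) U" using T by (intro hausdorff_measure_mono) auto
    also have "(\<Sum>x\<in>E. hausdorff_measure (real n) (T x)) = ennreal (\<Sum>x\<in>E. vol (T x))"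
      using fT by (simp add: vol_eq sum_ennreal)
    finally show ?thesis using U by (simp add: vol_eq)
  qed
  obtain k where k: "0 < k" "\<And>v q'. dist v q' \<le> R / 2 \<Longrightarrow>
      ennreal k * hausdorff_measure (real n) (ball q' (R / 2)) \<le> hausdorff_measure (real n) (ball (v::'a) r)"
    using hausdorff_measure_ball_transfer[OF r(1), of "real n"] by auto
  have volB: "0 < vol B" unfolding B_def using R_pos by (intro vol_ball_pos) auto
  have kB: "k * vol B \<le> vol (ball w r)" if "w \<in> W" for w
  proof -
    have "dist w q \<le> R / 2" using that W(2) R_pos by (force simp: dist_commute)
    from k(2)[OF this] have "ennreal k * ennreal (vol B) \<le> ennreal (vol (ball w r))"
      unfolding B_def[symmetric] using fB fbr by (simp add: vol_eq)
    then show ?thesis using k(1) by (simp add: ennreal_mult[symmetric])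
  qed
  have "card E < nat \<lceil>1 / k\<rceil> + 1" if E: "P E" for E
  proof -
    have "real (card E) * (k * vol B) \<le> (\<Sum>x\<in>E. vol (ball x r))"
      using kB E unfolding P_def by (intro sum_bounded_below[THEN order_trans[rotated]]) (auto)
    also have "\<dots> \<le> vol B" using bB E unfolding P_def by (intro sepb[OF E fB]) auto
    finally have "real (card E) * k \<le> 1" using volB by (simp add: mult.assoc[symmetric])
    then have "real (card E) \<le> 1 / k" using k by (simp add: field_simps)
    then show ?thesis by linarith
  qed
  moreover have "P {}" unfolding P_def by simp
  ultimately obtain E where E: "P E" "\<And>E'. P E' \<Longrightarrow> card E' \<le> card E"
    using Lattices_Big.ex_has_greatest_nat[of P "{}" card "nat \<lceil>1 / k\<rceil> + 1"] by blast
  have cover: "W \<subseteq> (\<Union>x\<in>E. ball x (4 * r))"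
  proof
    fix w assume w: "w \<in> W"
    show "w \<in> (\<Union>x\<in>E. ball x (4 * r))"
    proof (rule ccontr)
      assume a: "w \<notin> (\<Union>x\<in>E. ball x (4 * r))"
      then have far: "4 * r \<le> dist x w" if "x \<in> E" for x using that by force
      have "w \<notin> E" using a r by auto
      have "P (insert w E)" using E(1) w far r unfolding P_def by (auto simp: dist_commute) (smt (verit))+
      then have "card (insert w E) \<le> card E" by (rule E(2))
      then show False using \<open>w \<notin> E\<close> E(1) unfolding P_def by simp
    qed
  qed
  have fE: "finite E" "E \<subseteq> W" using E(1) unfolding P_def by auto
  have "vol W \<le> (\<Sum>x\<in>E. vol (ball x (4 * r)))"
  proof -
    have f4: "fin (ball x (4 * r))" for x using r by (intro fin_ball) simp
    have "hausdorff_measure (real n) W \<le> hausdorff_measure (real n) (\<Union>x\<in>E. ball x (4 * r))"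
      by (rule hausdorff_measure_mono[OF cover])
    also have "\<dots> \<le> (\<Sum>x\<in>E. hausdorff_measure (real n) (ball x (4 * r)))" by (rule hausdorff_measure_finite_UN[OF fE(1)])
    also have "\<dots> = ennreal (\<Sum>x\<in>E. vol (ball x (4 * r)))" using f4 by (simp add: vol_eq sum_ennreal)
    finally show ?thesis unfolding vol_def[of W] by (rule enn2real_leI[rotated]) (simp add: sum_nonneg)
  qed
  then have "(1/8) ^ n * vol W \<le> (\<Sum>x\<in>E. (1/8) ^ n * vol (ball x (4 * r)))"
    by (simp add: sum_distrib_left[symmetric])
  also have "\<dots> \<le> (\<Sum>x\<in>E. vol (ball x r))"
  proof (rule sum_mono)
    fix x show "(1/8) ^ n * vol (ball x (4 * r)) \<le> vol (ball x r)"
      using vol_ball_scale(2)[of "1/4" "4 * r" x] r by simp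
  qed
  finally have big: "c \<le> (\<Sum>x\<in>E. \<theta>' * vol (ball x r))"
    unfolding c_def using th by (simp add: sum_distrib_left[symmetric] mult.assoc)
  \<comment> \<open>Otherwise the parts of the balls outside \<open>W\<close>, which are separated
    and lie in \<open>OW\<close>, would have total volume at least \<open>c\<close>.\<close>
  have "\<exists>w\<in>E. vol (ball w r - W) \<le> \<theta>' * vol (ball w r)"
  proof (rule ccontr)
    assume "\<not> ?thesis"
    then have "(\<Sum>x\<in>E. \<theta>' * vol (ball x r)) \<le> (\<Sum>x\<in>E. vol (ball x r - W))" by (intro sum_mono) auto
    also have "\<dots> \<le> vol OW"
    proof (rule sepb[OF E(1) fin_subset[OF fB OWB]])
      fix x assume x: "x \<in> E"
      have "infdist y W \<le> r" if "y \<in> ball x r" for y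
        using infdist_le[of x W y] x fE(2) that by (auto simp: dist_commute intro: order_trans less_imp_le)
      then show "ball x r - W \<subseteq> ball x r \<and> ball x r - W \<subseteq> OW" unfolding OW_def by auto
    qed
    finally show False using big OWc by simp
  qed
  then show ?thesis using r(1,2) fE(2) by blast
qed

end

section \<open>Affine functions\<close>

text \<open>One endpoint is fixed, the other ranges over the whole space: an affine function has
  constant slope along a geodesic from \<open>u\<close>, so an estimate on a short initial piece is
  already global.\<close>

definition lip_at :: "('a::metric_space \<Rightarrow> real) \<Rightarrow> real \<Rightarrow> 'a \<Rightarrow> bool" where
  "lip_at f L u \<longleftrightarrow> (\<forall>x. \<bar>f x - f u\<bar> \<le> L * dist x u)"

lemma affine_slope:
  fixes f :: "'b \<Rightarrow> real"
  assumes "0 < s" "f z = (1 - s) * f p + s * f x" "\<bar>f z - f p\<bar> \<le> s * B"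
  shows "\<bar>f x - f p\<bar> \<le> B"
proof -
  have "f z - f p = s * (f x - f p)" using assms(2) by (simp add: algebra_simps)
  then have "s * \<bar>f x - f p\<bar> \<le> s * B" using assms by (simp add: abs_mult)
  then show ?thesis using assms by simp
qed

context alexandrov_dim
begin

context
  fixes f :: "'a \<Rightarrow> real"
  assumes aff: "\<And>t x m y. 0 \<le> t \<Longrightarrow> t \<le> 1 \<Longrightarrow> between t x m y \<Longrightarrow> f m = (1 - t) * f x + t * f y"
begin

lemma steinhaus_bound:
  assumes "0 < \<rho>" "\<rho> \<le> R / 2" "vol (ball p \<rho> - {x. \<bar>f x - c\<bar> \<le> M}) \<le> \<theta> * vol (ball p \<rho>)" "z \<in> ball p (\<rho> / 4)"
  shows "\<bar>f z - c\<bar> \<le> 3 * M"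
proof -
  obtain y m where ym: "\<bar>f y - c\<bar> \<le> M" "\<bar>f m - c\<bar> \<le> M" "between (1/2) z m y"
    using steinhaus[OF assms] by blast
  have "f m = (1 - 1/2) * f z + 1/2 * f y" using aff[OF _ _ ym(3)] by simp
  then show ?thesis using ym by (simp add: abs_le_iff)
qed

lemma measurable_split:
  assumes meas: "hausdorff_measurable_fun (real n) f" and "B \<in> sets borel" and "fin S"
  shows "vol (S \<inter> f -` B) + vol (S - f -` B) = vol S"
proof -
  have "f -` B \<in> lambda_system UNIV UNIV (hausdorff_measure (real n))"
    using meas assms(2) unfolding hausdorff_measurable_fun_def by blast
  then have "hausdorff_measure (real n) (f -` B \<inter> S) + hausdorff_measure (real n) ((UNIV - f -` B) \<inter> S) = hausdorff_measure (real n) S"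
    unfolding lambda_system_def by blast
  moreover have "(UNIV - f -` B) \<inter> S = S - f -` B" "f -` B \<inter> S = S \<inter> f -` B" by auto
  moreover have "fin (S \<inter> f -` B)" "fin (S - f -` B)" using fin_subset[OF assms(3)] by auto
  ultimately have "ennreal (vol (S \<inter> f -` B) + vol (S - f -` B)) = ennreal (vol S)"
    using assms(3) by (simp add: vol_eq)
  then show ?thesis by (subst (asm) ennreal_inj) auto
qed

text \<open>Measurability enters through Caratheodory additivity: the layers
  \<open>i \<le> \<bar>f\<bar> < i + 1\<close> split the finite measure of the ball into a
  convergent series, so some tail is below the fraction \<theta>, and the midpoint argument bounds
  \<open>f\<close> on the quarter ball.\<close>

lemma affine_bounded_on_small_balls:
  assumes meas: "hausdorff_measurable_fun (real n) f" and rho: "0 < \<rho>" "\<rho> \<le> R / 2"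
  shows "\<exists>M\<ge>0. \<forall>z\<in>ball p (\<rho> / 4). \<bar>f z\<bar> \<le> M"
proof -
  define B where "B = ball p \<rho>"
  have fB: "fin B" unfolding B_def using fin_ball rho by simp
  have vB: "0 < vol B" unfolding B_def using vol_ball_pos rho by simp
  define D where "D i = f -` {x. real i \<le> \<bar>x\<bar> \<and> \<bar>x\<bar> < real (Suc i)}" for i :: nat
  have borel: "{x::real. real i \<le> \<bar>x\<bar> \<and> \<bar>x\<bar> < real (Suc i)} \<in> sets borel" for i by measurable
  have Dl: "range D \<subseteq> lambda_system UNIV UNIV (hausdorff_measure (real n))"
    using meas borel unfolding hausdorff_measurable_fun_def D_def by blast
  have disj: "disjoint_family D"
    unfolding disjoint_family_on_def D_def by auto
  interpret alg: algebra UNIV "UNIV :: 'a set set" using algebra_Pow[of "UNIV :: 'a set"] by simp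
  have "positive UNIV (hausdorff_measure (real n) :: 'a set \<Rightarrow> ennreal)" unfolding positive_def by simp
  then have "(\<Sum>i<N. hausdorff_measure (real n) (B \<inter> D i)) \<le> hausdorff_measure (real n) B" for N
    using alg.lambda_system_strong_sum[OF _ _ Dl disj, of B N] hausdorff_measure_mono[of "B \<inter> (\<Union>i\<in>{0..<N}. D i)" B "real n"]
    by (simp add: atLeast0LessThan)
  then have "(\<Sum>i. hausdorff_measure (real n) (B \<inter> D i)) \<le> hausdorff_measure (real n) B"
    by (intro suminf_le_const) auto
  then have "(\<Sum>i. hausdorff_measure (real n) (B \<inter> D i)) < top" using fB unfolding fin_def by (meson le_less_trans)
  moreover have "0 < ennreal (\<theta> * vol B)" using theta_bounds vB by simp
  ultimately obtain N where N: "(\<Sum>i. hausdorff_measure (real n) (B \<inter> D (i + N))) < ennreal (\<theta> * vol B)"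
    using ennreal_suminf_tail[of "\<lambda>i. hausdorff_measure (real n) (B \<inter> D i)" "ennreal (\<theta> * vol B)"] by blast
  have "B - {x. \<bar>f x - 0\<bar> \<le> real N} \<subseteq> (\<Union>i. B \<inter> D (i + N))"
  proof
    fix x assume x: "x \<in> B - {x. \<bar>f x - 0\<bar> \<le> real N}"
    define j where "j = nat \<lfloor>\<bar>f x\<bar>\<rfloor>"
    have j: "real j \<le> \<bar>f x\<bar>" "\<bar>f x\<bar> < real (Suc j)" unfolding j_def by linarith+
    have "N \<le> j" using x j by auto
    then obtain i where "j = i + N" using le_Suc_ex add.commute by metis
    then have "x \<in> B \<inter> D (i + N)" using x j unfolding D_def by simp
    then show "x \<in> (\<Union>i. B \<inter> D (i + N))" by blast
  qed
  then have "hausdorff_measure (real n) (B - {x. \<bar>f x - 0\<bar> \<le> real N}) \<le> hausdorff_measure (real n) (\<Union>i. B \<inter> D (i + N))"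
    by (rule hausdorff_measure_mono)
  also have "\<dots> \<le> (\<Sum>i. hausdorff_measure (real n) (B \<inter> D (i + N)))" by (rule hausdorff_measure_UN)
  finally have "hausdorff_measure (real n) (B - {x. \<bar>f x - 0\<bar> \<le> real N}) \<le> ennreal (\<theta> * vol B)" using N by simp
  then have "vol (B - {x. \<bar>f x - 0\<bar> \<le> real N}) \<le> \<theta> * vol B"
    unfolding vol_def[of "B - _"] by (rule enn2real_leI[rotated]) (use theta_bounds vB in simp)
  then have "\<bar>f z - 0\<bar> \<le> 3 * real N" if "z \<in> ball p (\<rho> / 4)" for z
    using steinhaus_bound[OF rho, of p 0 "real N" z] that unfolding B_def by simp
  then show ?thesis by (intro exI[of _ "3 * real N"]) auto
qed

text \<open>At a point and a scale where \<open>vol (ball p r) / r ^ n\<close> is almost maximal, homothetic copies of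
  the ball almost fill the smaller concentric balls, so that the oscillation of an affine function
  decays linearly with the radius.\<close>

lemma affine_lipschitz_somewhere:
  assumes meas: "hausdorff_measurable_fun (real n) f"
    and rho: "0 < \<rho>" "\<rho> \<le> R / 8"
    and C: "\<And>(q::'a) r. 0 < r \<Longrightarrow> ball q r \<subseteq> ball p \<rho> \<Longrightarrow> hausdorff_measure (real n) (ball q r) \<le> ennreal (C * r ^ n)"
  shows "\<exists>p0 \<delta> L. 0 < \<delta> \<and> 0 \<le> L \<and> (\<forall>u\<in>ball p0 \<delta>. lip_at f L u)"
proof -
  obtain M where M: "0 \<le> M" "\<And>z. z \<in> ball p \<rho> \<Longrightarrow> \<bar>f z\<bar> \<le> M"
  proof -
    obtain M where "0 \<le> M" "\<forall>z\<in>ball p (R / 2 / 4). \<bar>f z\<bar> \<le> M"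
      using affine_bounded_on_small_balls[OF meas, of "R / 2" p] R_pos by auto
    then show ?thesis using that[of M] rho by auto
  qed
  \<comment> \<open>Four factors \<open>1 - \<mu>\<close> will be lost: one by near-maximality, one
    by replacing \<open>p0\<close> by \<open>u\<close>, and one in each of two homotheties. Together
    they leave at least \<open>1 - 4 * \<mu> = 1 - \<theta>\<close>.\<close>
  define \<mu> where "\<mu> = \<theta> / 4"
  have mu: "0 < \<mu>" "\<mu> \<le> 1 / 16" unfolding \<mu>_def using theta_bounds by auto
  define r' where "r' = min (\<rho> / 2) (min 1 (\<mu> / (K * real n + 1)))"
  have Kn: "0 \<le> K * real n" using K_nonneg by simp
  have "0 < \<mu> / (K * real n + 1)" using mu Kn by simp
  then have r': "0 < r'" "r' \<le> \<rho> / 2" "r' \<le> 1" "r' \<le> \<mu> / (K * real n + 1)"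
    unfolding r'_def using rho by linarith+
  have Kr: "1 - \<mu> \<le> (1 - K * r\<^sup>2) ^ n" if "0 < r" "r \<le> r'" for r
  proof (rule one_minus_power_ge)
    have rR: "r \<le> R" using that r' rho R_pos by simp
    show "0 \<le> K * r\<^sup>2" "K * r\<^sup>2 \<le> 1" using K_small[of r] that rR by auto
    have "r * r \<le> r * 1" using that r' by (intro mult_left_mono) auto
    then have "real n * (K * r\<^sup>2) \<le> (K * real n) * r"
      using Kn mult_left_mono[of "r * r" r "K * real n"] by (simp add: power2_eq_square mult_ac)
    also have "\<dots> \<le> (K * real n + 1) * r" using that by (simp add: algebra_simps)
    also have "\<dots> \<le> (K * real n + 1) * (\<mu> / (K * real n + 1))" using that r' Kn by (intro mult_left_mono) auto
    also have "\<dots> = \<mu>" using Kn by simp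
    finally show "real n * (K * r\<^sup>2) \<le> \<mu>" .
  qed
  define Q where "Q q r = vol (ball q r) / r ^ n" for q r
  define T where "T = {Q q r | q r. dist p q < \<rho> / 2 \<and> 0 < r \<and> r \<le> r'}"
  have subp: "ball q r \<subseteq> ball p \<rho>" if "dist p q < \<rho> / 2" "r \<le> \<rho> / 2" for q r
  proof
    fix x assume "x \<in> ball q r"
    then show "x \<in> ball p \<rho>" using that dist_triangle[of p x q] by simp
  qed
  have QC: "Q q r \<le> max C 0" if "dist p q < \<rho> / 2" "0 < r" "r \<le> r'" for q r
  proof -
    have "hausdorff_measure (real n) (ball q r) \<le> ennreal (C * r ^ n)"
      using C subp that r' by simp
    also have "\<dots> \<le> ennreal (max C 0 * r ^ n)" using that by (intro ennreal_leI mult_right_mono) auto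
    finally have "vol (ball q r) \<le> max C 0 * r ^ n"
      unfolding vol_def by (rule enn2real_leI[rotated]) (use that in simp)
    then show ?thesis unfolding Q_def using that by (simp add: divide_le_eq)
  qed
  have bdd: "bdd_above T" unfolding T_def using QC by (intro bdd_aboveI[of _ "max C 0"]) auto
  have Tne: "Q p r' \<in> T" unfolding T_def using r' rho by (intro CollectI exI[of _ p] exI[of _ r']) auto
  define V where "V = Sup T"
  have QV: "Q q r \<le> V" if "dist p q < \<rho> / 2" "0 < r" "r \<le> r'" for q r
    unfolding V_def using that bdd by (intro cSup_upper) (auto simp: T_def)
  have half: "r' \<le> R / 2" using r' rho R_pos by simp
  have Qpos: "0 < Q q r" if "0 < r" "r \<le> r'" for q r
    unfolding Q_def using that half by (intro divide_pos_pos vol_ball_pos) auto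
  have V: "0 < V" using Qpos[of r' p] QV[of p r'] r' rho by simp
  have "(1 - \<mu>) * V < V" using mu V by simp
  then obtain p0 r0 where p0: "dist p p0 < \<rho> / 2" "0 < r0" "r0 \<le> r'" "(1 - \<mu>) * V < Q p0 r0"
  proof -
    have "T \<noteq> {}" using Tne by blast
    from less_cSup_iff[OF this bdd, of "(1 - \<mu>) * V"] obtain v where "v \<in> T" "(1 - \<mu>) * V < v"
      using \<open>(1 - \<mu>) * V < V\<close> unfolding V_def[symmetric] by blast
    then show ?thesis using that unfolding T_def by auto
  qed
  \<comment> \<open>The second bound makes \<open>(1 - \<tau>) ^ n\<close> at least
    \<open>1 - \<mu>\<close>; the third keeps every \<open>u\<close> close enough to
    \<open>p\<close> for the supremum \<open>V\<close> to apply at \<open>u\<close>.\<close>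
  define \<tau> where "\<tau> = min (1/2) (min (\<mu> / (real n + 1)) ((\<rho> / 2 - dist p p0) / r0))"
  have tau: "0 < \<tau>" "\<tau> \<le> 1/2" "\<tau> \<le> \<mu> / (real n + 1)" "\<tau> * r0 \<le> \<rho> / 2 - dist p p0"
  proof -
    have "0 < \<mu> / (real n + 1)" "0 < (\<rho> / 2 - dist p p0) / r0" using mu p0 by auto
    then show "0 < \<tau>" "\<tau> \<le> 1/2" "\<tau> \<le> \<mu> / (real n + 1)" unfolding \<tau>_def by linarith+
    have "\<tau> \<le> (\<rho> / 2 - dist p p0) / r0" unfolding \<tau>_def by simp
    then show "\<tau> * r0 \<le> \<rho> / 2 - dist p p0" using p0(2) by (simp add: pos_le_divide_eq)
  qed
  have taun: "1 - \<mu> \<le> (1 - \<tau>) ^ n"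
  proof (rule one_minus_power_ge)
    have "real n * \<tau> \<le> (real n + 1) * \<tau>" using tau by (simp add: algebra_simps)
    also have "\<dots> \<le> (real n + 1) * (\<mu> / (real n + 1))" using tau by (intro mult_left_mono) auto
    finally show "real n * \<tau> \<le> \<mu>" by simp
  qed (use tau in auto)
  \<comment> \<open>A point at distance \<open>d\<close> is treated with ratio
    \<open>t = 8 * d / r0\<close>, well inside the quarter ball, and oscillation
    \<open>6 * M * t\<close> gives the slope \<open>48 * M / r0\<close>. Points beyond
    \<open>r0 / 16\<close> are reached by affine extension.\<close>
  define L where "L = 48 * M / r0"
  have "lip_at f L u" if u: "u \<in> ball p0 (\<tau> * r0)" for u
  proof -
    have pu: "dist p u < \<rho> / 2" using dist_triangle[of p u p0] u tau(4) by simp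
    have volu: "(1 - \<mu>) ^ 3 * V * r0 ^ n \<le> vol (ball u r0)"
    proof -
      have "ball p0 ((1 - \<tau>) * r0) \<subseteq> ball u r0"
      proof
        fix x assume "x \<in> ball p0 ((1 - \<tau>) * r0)"
        then show "x \<in> ball u r0" using u dist_triangle[of u x p0] by (simp add: dist_commute algebra_simps)
      qed
      then have "vol (ball p0 ((1 - \<tau>) * r0)) \<le> vol (ball u r0)"
        using p0 half by (intro vol_mono fin_ball) auto
      moreover have "((1 - K * r0\<^sup>2) * (1 - \<tau>)) ^ n * vol (ball p0 r0) \<le> vol (ball p0 ((1 - \<tau>) * r0))"
        using tau p0 half by (intro vol_ball_scale) auto
      moreover have "(1 - \<mu>) * (1 - \<mu>) * ((1 - \<mu>) * V * r0 ^ n) \<le> ((1 - K * r0\<^sup>2) * (1 - \<tau>)) ^ n * vol (ball p0 r0)"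
        unfolding power_mult_distrib
      proof (intro mult_mono)
        show "(1 - \<mu>) * V * r0 ^ n \<le> vol (ball p0 r0)"
          using p0(4) p0(2) unfolding Q_def by (simp add: less_divide_eq)
      qed (use Kr[OF p0(2,3)] taun mu V p0 tau K_small[of r0] half R_pos in auto)
      ultimately show ?thesis by (simp add: power3_eq_cube mult.assoc)
    qed
    have osc: "\<bar>f z - f u\<bar> \<le> 6 * M * t" if t: "0 < t" "t < 1" and z: "z \<in> ball u (t * r0 / 4)" for t z
    proof -
      define A where "A = {x. \<bar>f x - f u\<bar> \<le> 2 * M * t}"
      define b where "b = vol (ball u (t * r0))"
      have tr: "0 < t * r0" "t * r0 \<le> r0" using t p0 by (auto simp: mult_left_le_one_le)
      have tr2: "t * r0 \<le> R / 2" "t * r0 \<le> r'" using tr p0 half by linarith+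
      have fb: "fin (ball u (t * r0))" using fin_ball tr2 by simp
      have sub: "homothetic t u (ball u r0) \<subseteq> ball u (t * r0) \<inter> A"
      proof
        fix m assume m: "m \<in> homothetic t u (ball u r0)"
        then obtain x where x: "x \<in> ball u r0" "between t u m x" unfolding homothetic_def by blast
        have "x \<in> ball p \<rho>" "u \<in> ball p \<rho>" using subp[OF pu, of r0] x p0 r' pu by auto
        then have "\<bar>f x\<bar> \<le> M" "\<bar>f u\<bar> \<le> M" using M(2) by auto
        then have "\<bar>f x - f u\<bar> \<le> 2 * M" by linarith
        moreover have "f m - f u = t * (f x - f u)" using aff[OF _ _ x(2)] t by (simp add: algebra_simps)
        ultimately have "\<bar>f m - f u\<bar> \<le> 2 * M * t" using t mult_left_mono[of "\<bar>f x - f u\<bar>" "2 * M" t]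
          by (simp add: abs_mult mult.commute)
        then show "m \<in> ball u (t * r0) \<inter> A"
          using homothetic_ball_subset[of t "ball u r0" u r0 "t * r0"] m t unfolding A_def by auto
      qed
      have "(1 - \<mu>) * t ^ n * ((1 - \<mu>) ^ 3 * V * r0 ^ n) \<le> ((1 - K * r0\<^sup>2) * t) ^ n * vol (ball u r0)"
        unfolding power_mult_distrib
        using Kr[OF p0(2,3)] volu mu V p0 t K_small[of r0] half R_pos by (intro mult_mono) auto
      also have "\<dots> \<le> vol (ball u (t * r0) \<inter> A)"
        using t p0 half R_pos fin_subset[OF fb]
        by (intro vol_homothetic[where v = u and S = "ball u r0", OF _ _ _ _ _ _ _ sub] fin_ball) auto
      finally have h1: "(1 - \<mu>) ^ 4 * (V * (t * r0) ^ n) \<le> vol (ball u (t * r0) \<inter> A)"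
        by (simp add: power_mult_distrib power3_eq_cube power4_eq_xxxx mult_ac)
      \<comment> \<open>The supremum supplies the upper bound for the smaller ball, so the copy of
        \<open>ball u r0\<close> can miss at most the fraction \<theta> of it.\<close>
      have "b \<le> V * (t * r0) ^ n"
        using QV[OF pu tr(1) tr2(2)] tr(1) unfolding Q_def b_def by (simp add: divide_le_eq)
      then have "(1 - \<mu>) ^ 4 * b \<le> vol (ball u (t * r0) \<inter> A)"
        by (rule order_trans[OF mult_left_mono h1]) simp
      moreover have "1 - 4 * \<mu> \<le> (1 - \<mu>) ^ 4" using one_minus_power_ge[of \<mu> 4 "4 * \<mu>"] mu by simp
      ultimately have h2: "(1 - \<theta>) * b \<le> vol (ball u (t * r0) \<inter> A)"
        using mult_right_mono[of "1 - 4 * \<mu>" "(1 - \<mu>) ^ 4" b] unfolding \<mu>_def b_def by simp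
      have A: "A = f -` {f u - 2 * M * t .. f u + 2 * M * t}" unfolding A_def by (auto simp: abs_le_iff)
      have "vol (ball u (t * r0) \<inter> A) + vol (ball u (t * r0) - A) = b"
        unfolding A b_def using measurable_split[OF meas _ fb] by simp
      then have "vol (ball u (t * r0) - A) \<le> \<theta> * b" using h2 by (simp add: algebra_simps)
      then have "\<bar>f z - f u\<bar> \<le> 3 * (2 * M * t)"
        using steinhaus_bound[OF tr(1) tr2(1), of u "f u" "2 * M * t" z] z unfolding A_def b_def by simp
      then show ?thesis by simp
    qed
    show ?thesis unfolding lip_at_def
    proof
      fix x
      show "\<bar>f x - f u\<bar> \<le> L * dist x u"
      proof (cases "x = u")
        case False
        define d where "d = dist u x"
        have d: "0 < d" unfolding d_def using False by simp
        show ?thesis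
        proof (cases "d < r0 / 16")
          case True
          have "\<bar>f x - f u\<bar> \<le> 6 * M * (8 * d / r0)"
            using d True p0 by (intro osc) (auto simp: d_def[symmetric])
          then show ?thesis unfolding L_def d_def by (simp add: dist_commute)
        next
          case False
          define s where "s = r0 / (16 * d)"
          have s: "0 < s" "s \<le> 1" "s * d = r0 / 16" unfolding s_def using d False p0 by (auto simp: field_simps)
          obtain z where z: "between s u z x" using between_ex[of s u x] s by auto
          have "dist u z = r0 / 16" using z s unfolding between_def d_def[symmetric] by simp
          then have "\<bar>f z - f u\<bar> \<le> 6 * M * (1/2)" using p0 by (intro osc) auto
          also have "\<dots> = s * (L * d)" using s p0 d unfolding L_def s_def by (simp add: field_simps)
          finally show ?thesis using affine_slope[OF s(1), of f z u x] aff[OF _ s(2) z] s(1) unfolding d_def by (simp add: dist_commute)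
        qed
      qed simp
    qed
  qed
  moreover have "0 < \<tau> * r0" "0 \<le> L" using tau p0 M unfolding L_def by auto
  ultimately show ?thesis by blast
qed

end

end

section \<open>Transport of the Lipschitz constant\<close>

context alexandrov_dim
begin

lemma homothetic_closed:
  assumes compl: "complete (UNIV :: 'a set)" and t: "0 < t" "t \<le> 1" and r: "0 \<le> r" "r \<le> R"
    and S: "closed S" "\<And>x. x \<in> S \<Longrightarrow> dist v x \<le> r"
  shows "closed (homothetic t v S)"
  unfolding closed_sequential_limits
proof (intro allI impI, elim conjE)
  fix w l assume w: "\<forall>k. w k \<in> homothetic t v S" and l: "w \<longlonglongrightarrow> l"
  then obtain u where u: "\<And>k. u k \<in> S" "\<And>k. between t v (w k) (u k)" unfolding homothetic_def by (auto simp: Bex_def) metis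
  define c where "c = (1 - K * r\<^sup>2) * t"
  have c: "0 < c" unfolding c_def using K_small[OF r] t by simp
  have ex: "c * dist (u i) (u j) \<le> dist (w i) (w j)" for i j
    unfolding c_def using homothety[OF _ t(2) r u(2) u(2)] t S(2)[OF u(1)] by simp
  have "Cauchy u"
  proof (rule metric_CauchyI)
    fix e :: real assume "0 < e"
    then obtain N where N: "\<And>i j. N \<le> i \<Longrightarrow> N \<le> j \<Longrightarrow> dist (w i) (w j) < c * e"
      using metric_CauchyD[OF LIMSEQ_imp_Cauchy[OF l], of "c * e"] c by (metis mult_pos_pos)
    have "dist (u i) (u j) < e" if "N \<le> i" "N \<le> j" for i j
    proof -
      have "c * dist (u i) (u j) < c * e" using ex[of i j] N[OF that] by linarith
      then show ?thesis using c by simp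
    qed
    then show "\<exists>N. \<forall>i\<ge>N. \<forall>j\<ge>N. dist (u i) (u j) < e" by blast
  qed
  then obtain y where y: "u \<longlonglongrightarrow> y" using compl unfolding complete_def by blast
  have "y \<in> S" using S(1) u(1) y unfolding closed_sequential_limits by blast
  moreover have "between t v l y" unfolding between_def
  proof
    have "(\<lambda>k. dist v (w k)) \<longlonglongrightarrow> dist v l" "(\<lambda>k. t * dist v (u k)) \<longlonglongrightarrow> t * dist v y"
      using l y by (auto intro!: tendsto_intros)
    moreover have "(\<lambda>k. dist v (w k)) = (\<lambda>k. t * dist v (u k))" using u(2) unfolding between_def by auto
    ultimately show "dist v l = t * dist v y" using LIMSEQ_unique by metis
    have "(\<lambda>k. dist (w k) (u k)) \<longlonglongrightarrow> dist l y" "(\<lambda>k. (1 - t) * dist v (u k)) \<longlonglongrightarrow> (1 - t) * dist v y"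
      using l y by (auto intro!: tendsto_intros)
    moreover have "(\<lambda>k. dist (w k) (u k)) = (\<lambda>k. (1 - t) * dist v (u k))" using u(2) unfolding between_def by auto
    ultimately show "dist l y = (1 - t) * dist v y" using LIMSEQ_unique by metis
  qed
  ultimately show "l \<in> homothetic t v S" unfolding homothetic_def by blast
qed

context
  fixes f :: "'a \<Rightarrow> real"
  assumes compl: "complete (UNIV :: 'a set)"
    and aff: "\<And>t x m y. 0 \<le> t \<Longrightarrow> t \<le> 1 \<Longrightarrow> between t x m y \<Longrightarrow> f m = (1 - t) * f x + t * f y"
begin

text \<open>A point \<open>q\<close> near a ball on which \<open>f\<close> is Lipschitz is a limit of centres of balls that are almost
  filled by homothetic copies of that ball, and on these copies \<open>f\<close> has almost the same Lipschitz constant.\<close>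

lemma lipschitz_dense_copies:
  assumes L: "0 \<le> L" "\<And>u. u \<in> cball p \<rho> \<Longrightarrow> lip_at f L u" and rho: "0 < \<rho>" and r: "dist p q + \<rho> \<le> r" "r \<le> R / 8"
    and th: "0 < \<theta>'" and d: "0 < \<delta>"
  shows "\<exists>W w s. w \<in> W \<and> 0 < s \<and> s < \<delta> \<and> dist q w \<le> \<delta> \<and> \<bar>f w - f q\<bar> \<le> \<delta> \<and>
    vol (ball w s - W) \<le> \<theta>' * vol (ball w s) \<and>
    (\<forall>x\<in>W. \<forall>y\<in>W. \<bar>f x - f y\<bar> \<le> L / (1 - K * r\<^sup>2) * dist x y)"
proof -
  have r0: "0 < r" "r \<le> R" using rho r zero_le_dist[of p q] R_pos by linarith+
  define c where "c = 1 - K * r\<^sup>2"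
  have c: "0 < c" "1/2 \<le> c" unfolding c_def using K_small[of r] r0 by auto
  \<comment> \<open>The ratio is so small that the copy lies within \<delta> of \<open>q\<close> and
    its values lie within \<delta> of \<open>f q\<close>.\<close>
  define t where "t = min 1 (\<delta> / ((L + 1) * r + \<delta>))"
  have pos: "0 < (L + 1) * r + \<delta>" using L(1) r0 d by (intro add_nonneg_pos mult_nonneg_nonneg) auto
  have t: "0 < t" "t \<le> 1" "t * ((L + 1) * r) \<le> \<delta>"
  proof -
    show "0 < t" "t \<le> 1" unfolding t_def using pos d by auto
    have "t * ((L + 1) * r + \<delta>) \<le> \<delta>" using pos unfolding t_def by (simp add: min_def pos_le_divide_eq[symmetric])
    moreover have "0 \<le> t * \<delta>" using \<open>0 < t\<close> d by simp
    ultimately show "t * ((L + 1) * r) \<le> \<delta>" by (simp add: distrib_left)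
  qed
  define W where "W = homothetic t q (cball p \<rho>)"
  have qu: "dist q u \<le> r" if "u \<in> cball p \<rho>" for u using dist_triangle[of q u p] that r by (simp add: dist_commute)
  have W: "dist q w \<le> t * r \<and> \<bar>f w - f q\<bar> \<le> t * (L * r)" if w: "w \<in> W" for w
  proof -
    obtain u where u: "u \<in> cball p \<rho>" "between t q w u" using w unfolding W_def homothetic_def by blast
    have "dist q w = t * dist q u" using u(2) unfolding between_def by simp
    moreover have "f w - f q = t * (f u - f q)" using aff[OF _ t(2) u(2)] t by (simp add: algebra_simps)
    moreover have "\<bar>f u - f q\<bar> \<le> L * r"
      using L(2)[OF u(1)] mult_left_mono[OF qu[OF u(1)] L(1)] unfolding lip_at_def
      by (metis abs_minus_commute order_trans)
    ultimately show ?thesis using t qu[OF u(1)] by (simp add: abs_mult)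
  qed
  have lip: "\<bar>f x - f y\<bar> \<le> L / c * dist x y" if xy: "x \<in> W" "y \<in> W" for x y
  proof -
    obtain u where u: "u \<in> cball p \<rho>" "between t q x u" using xy(1) unfolding W_def homothetic_def by blast
    obtain v where v: "v \<in> cball p \<rho>" "between t q y v" using xy(2) unfolding W_def homothetic_def by blast
    have "f x - f y = t * (f u - f v)"
      using aff[OF _ t(2) u(2)] aff[OF _ t(2) v(2)] t by (simp add: algebra_simps)
    moreover have "\<bar>f u - f v\<bar> \<le> L * dist u v" using L(2)[OF v(1)] unfolding lip_at_def by simp
    ultimately have "\<bar>f x - f y\<bar> \<le> t * (L * dist u v)" using t by (simp add: abs_mult)
    \<comment> \<open>Differences of \<open>f\<close> shrink by exactly \<open>t\<close>, distances
      by no more than \<open>c * t\<close>; the quotient \<open>1 / c\<close> is the only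
      loss.\<close>
    also have "\<dots> = L / c * (c * t * dist u v)" using c by simp
    also have "\<dots> \<le> L / c * dist x y"
      using homothety[OF _ t(2) _ r0(2) u(2) v(2)] t r0 qu u v L(1) c unfolding c_def by (intro mult_left_mono) auto
    finally show ?thesis .
  qed
  have tr: "t * r \<le> R / 8"
    using mult_right_mono[OF t(2), of r] r0 r by linarith
  have clo: "closed W" unfolding W_def using t r0 qu by (intro homothetic_closed[OF compl, where r = r]) auto
  have WB: "W \<subseteq> ball q (R / 4)" using W tr R_pos by force
  have fW: "fin W" by (rule fin_subset[OF fin_ball WB]) (use R_pos in simp)
  have rhoR: "\<rho> \<le> R / 8" using r zero_le_dist[of p q] by linarith
  have fc: "fin (cball p \<rho>)"
    by (rule fin_subset[OF fin_ball[of "R / 4" p]]) (use rhoR R_pos in auto)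
  have "0 < vol (ball p \<rho>)" using vol_ball_pos rho rhoR R_pos by simp
  also have "\<dots> \<le> vol (cball p \<rho>)" by (rule vol_mono[OF fc]) auto
  finally have "0 < ((1 - K * r\<^sup>2) * t) ^ n * vol (cball p \<rho>)" using c t unfolding c_def[symmetric] by simp
  also have "\<dots> \<le> vol W" using t r0 qu by (intro vol_homothetic[where v = q, OF _ _ _ _ _ fc fW]) (auto simp: W_def)
  finally have "0 < vol W" .
  then obtain s w where s: "0 < s" "s < \<delta>" "w \<in> W" "vol (ball w s - W) \<le> \<theta>' * vol (ball w s)"
    using density_ball[OF clo WB _ th d] by blast
  have "t * ((L + 1) * r) = t * (L * r) + t * r" by (simp add: algebra_simps)
  moreover have "0 \<le> t * (L * r)" "0 \<le> t * r" using t L(1) r0 by auto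
  ultimately have "dist q w \<le> \<delta>" "\<bar>f w - f q\<bar> \<le> \<delta>" using W[OF s(3)] t(3) by linarith+
  then show ?thesis using s lip unfolding c_def by blast
qed

text \<open>Continuity of \<open>f\<close> at \<open>q\<close> is still unknown, so convergence of
  the values \<open>f w\<close> to \<open>f q\<close> is part of the hypothesis.\<close>

lemma lip_at_limit:
  assumes c: "0 \<le> c" and ap: "\<And>\<delta>. 0 < \<delta> \<Longrightarrow> \<exists>w. dist q w \<le> \<delta> \<and> \<bar>f w - f q\<bar> \<le> \<delta> \<and> \<bar>f x - f w\<bar> \<le> c * dist w x"
  shows "\<bar>f x - f q\<bar> \<le> c * dist x q"
proof (rule field_le_epsilon)
  fix e :: real assume e: "0 < e"
  define \<delta> where "\<delta> = e / (c + 1)"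
  have d: "0 < \<delta>" "(c + 1) * \<delta> = e" unfolding \<delta>_def using e c by auto
  obtain w where w: "dist q w \<le> \<delta>" "\<bar>f w - f q\<bar> \<le> \<delta>" "\<bar>f x - f w\<bar> \<le> c * dist w x" using ap[OF d(1)] by blast
  have "c * dist w x \<le> c * (dist x q + \<delta>)"
    using w(1) dist_triangle[of w x q] c by (intro mult_left_mono) (auto simp: dist_commute)
  then show "\<bar>f x - f q\<bar> \<le> c * dist x q + e" using w d(2) by (simp add: algebra_simps)
qed

text \<open>On a ball of radius \<open>s\<close> almost filled by a copy, the midpoint argument
  bounds \<open>f - f w\<close> by \<open>3 * L' * s\<close> on the quarter ball. At distance
  \<open>s / 8\<close> from \<open>w\<close> this is slope 24 times \<open>L'\<close>. The constant
  is too large to iterate, but it gives continuity near \<open>q\<close>, which the sharp version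
  relies on.\<close>

lemma lipschitz_transport_crude:
  assumes L: "0 \<le> L" "\<And>u. u \<in> cball p \<rho> \<Longrightarrow> lip_at f L u" and rho: "0 < \<rho>" and r: "dist p q + \<rho> \<le> r" "r \<le> R / 8"
  shows "lip_at f (24 * (L / (1 - K * r\<^sup>2))) q"
  unfolding lip_at_def
proof
  fix x
  define L' where "L' = L / (1 - K * r\<^sup>2)"
  have r0: "0 < r" "r \<le> R" using rho r zero_le_dist[of p q] R_pos by linarith+
  have L': "0 \<le> L'" unfolding L'_def using L(1) K_small[of r] r0 by simp
  show "\<bar>f x - f q\<bar> \<le> 24 * (L / (1 - K * r\<^sup>2)) * dist x q"
  proof (cases "x = q")
    case False
    define D where "D = dist q x"
    have D: "0 < D" unfolding D_def using False by simp
    show ?thesis unfolding L'_def[symmetric]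
    proof (rule lip_at_limit)
      fix \<delta> :: real assume "0 < \<delta>"
      define \<delta>' where "\<delta>' = min \<delta> (min (D / 2) (R / 2))"
      have d': "0 < \<delta>'" "\<delta>' \<le> \<delta>" "\<delta>' \<le> D / 2" "\<delta>' \<le> R / 2" unfolding \<delta>'_def using \<open>0 < \<delta>\<close> D R_pos by auto
      obtain W w s where w: "w \<in> W" "0 < s" "s < \<delta>'" "dist q w \<le> \<delta>'" "\<bar>f w - f q\<bar> \<le> \<delta>'"
          "vol (ball w s - W) \<le> \<theta> * vol (ball w s)" "\<And>x y. x \<in> W \<Longrightarrow> y \<in> W \<Longrightarrow> \<bar>f x - f y\<bar> \<le> L' * dist x y"
        using lipschitz_dense_copies[OF L rho r theta_bounds(1) d'(1)] unfolding L'_def by blast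
      have wx: "D / 2 \<le> dist w x" using dist_triangle[of q x w] w(4) d' unfolding D_def by linarith
      then have dw: "0 < dist w x" "s \<le> dist w x" using w(2,3) d' D by linarith+
      have "W \<inter> ball w s \<subseteq> {x. \<bar>f x - f w\<bar> \<le> L' * s}"
      proof
        fix y assume y: "y \<in> W \<inter> ball w s"
        have "\<bar>f y - f w\<bar> \<le> L' * dist y w" using w(1,7) y by blast
        also have "\<dots> \<le> L' * s" using y L' by (intro mult_left_mono) (auto simp: dist_commute)
        finally show "y \<in> {x. \<bar>f x - f w\<bar> \<le> L' * s}" by simp
      qed
      then have "ball w s - {x. \<bar>f x - f w\<bar> \<le> L' * s} \<subseteq> ball w s - W" by blast
      then have "vol (ball w s - {x. \<bar>f x - f w\<bar> \<le> L' * s}) \<le> vol (ball w s - W)"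
        using w d' by (intro vol_mono fin_subset[OF fin_ball[of s w]]) auto
      then have st: "\<bar>f z - f w\<bar> \<le> 3 * (L' * s)" if "z \<in> ball w (s / 4)" for z
        using steinhaus_bound[where f = f and p = w and c = "f w" and M = "L' * s" and z = z, OF aff w(2)] w(3,6) d' that by simp
      define \<tau> where "\<tau> = s / (8 * dist w x)"
      have tau: "0 < \<tau>" "\<tau> \<le> 1" "\<tau> * dist w x = s / 8"
        unfolding \<tau>_def using w(2) dw by (auto simp: pos_divide_le_eq)
      obtain z where z: "between \<tau> w z x" using between_ex[of \<tau> w x] tau by auto
      have fz: "f z = (1 - \<tau>) * f w + \<tau> * f x" using aff[OF _ tau(2) z] tau(1) by simp
      have "dist w z = s / 8" using z tau unfolding between_def by simp
      then have "\<bar>f z - f w\<bar> \<le> 3 * (L' * s)" using st[of z] w(2) by simp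
      also have "\<dots> = \<tau> * (24 * L' * dist w x)" using tau(3) by simp
      finally have "\<bar>f x - f w\<bar> \<le> 24 * L' * dist w x" by (rule affine_slope[where f = f and z = z and p = w and x = x, OF tau(1) fz])
      then show "\<exists>w. dist q w \<le> \<delta> \<and> \<bar>f w - f q\<bar> \<le> \<delta> \<and> \<bar>f x - f w\<bar> \<le> 24 * L' * dist w x"
        using w(4,5) d'(2) by (intro exI[of _ w]) auto
    qed (use L' in simp)
  qed simp
qed

text \<open>Take a point \<open>z\<close> at distance \<open>s / 2\<close> from \<open>w\<close> on
  the way to \<open>x\<close>. If the ball is filled well enough, the copy has a point within
  \<open>\<epsilon> * s\<close> of \<open>z\<close>; the crude bound controls the error of replacing
  \<open>z\<close> by it, and \<epsilon> tends to 0. The strict inequality for \<open>r\<close>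
  leaves room for the crude bound around \<open>q\<close>.\<close>

lemma lipschitz_transport:
  assumes L: "0 \<le> L" "\<And>u. u \<in> cball p \<rho> \<Longrightarrow> lip_at f L u" and rho: "0 < \<rho>" and r: "dist p q + \<rho> < r" "r \<le> R / 8"
  shows "lip_at f (L / (1 - K * r\<^sup>2)) q"
  unfolding lip_at_def
proof
  fix x
  define L' where "L' = L / (1 - K * r\<^sup>2)"
  have r0: "0 < r" "r \<le> R" using rho r zero_le_dist[of p q] R_pos by linarith+
  have L': "0 \<le> L'" unfolding L'_def using L(1) K_small[of r] r0 by simp
  define r2 where "r2 = r - dist p q - \<rho>"
  have r2: "0 < r2" unfolding r2_def using r by simp
  have crude: "\<bar>f y - f z\<bar> \<le> 24 * L' * dist y z" if "dist q z < r2" for y z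
    using lipschitz_transport_crude[OF L rho, where q = z and r = r] dist_triangle[of p z q] that r
    unfolding r2_def L'_def lip_at_def by simp
  show "\<bar>f x - f q\<bar> \<le> L / (1 - K * r\<^sup>2) * dist x q"
  proof (cases "x = q")
    case False
    define D where "D = dist q x"
    have D: "0 < D" unfolding D_def using False by simp
    have eps: "\<bar>f x - f q\<bar> \<le> (L' * (1 + 2 * \<epsilon>) + 48 * L' * \<epsilon>) * dist x q" if e: "0 < \<epsilon>" "\<epsilon> \<le> 1/4" for \<epsilon>
    proof (rule lip_at_limit)
      show "0 \<le> L' * (1 + 2 * \<epsilon>) + 48 * L' * \<epsilon>" using L' e by simp
      fix \<delta> :: real assume "0 < \<delta>"
      define \<delta>' where "\<delta>' = min \<delta> (min (D / 2) (min (R / 4) (r2 / 2)))"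
      have d': "0 < \<delta>'" "\<delta>' \<le> \<delta>" "\<delta>' \<le> D / 2" "\<delta>' \<le> R / 4" "\<delta>' \<le> r2 / 2"
        unfolding \<delta>'_def using \<open>0 < \<delta>\<close> D R_pos r2 by auto
      \<comment> \<open>A ball of radius \<open>\<epsilon> * s\<close> inside
        \<open>ball w s\<close> has at least the fraction \<open>(\<epsilon> / 4) ^ n\<close> of its
        volume, by the homothety of ratio \<open>\<epsilon> / 2\<close> from radius
        \<open>2 * s\<close>. Half of this fraction cannot contain it.\<close>
      define \<theta>' where "\<theta>' = (\<epsilon> / 4) ^ n / 2"
      have th': "0 < \<theta>'" unfolding \<theta>'_def using e by simp
      obtain W w s where w: "w \<in> W" "0 < s" "s < \<delta>'" "dist q w \<le> \<delta>'" "\<bar>f w - f q\<bar> \<le> \<delta>'"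
          "vol (ball w s - W) \<le> \<theta>' * vol (ball w s)" "\<And>x y. x \<in> W \<Longrightarrow> y \<in> W \<Longrightarrow> \<bar>f x - f y\<bar> \<le> L' * dist x y"
        using lipschitz_dense_copies[OF L rho less_imp_le[OF r(1)] r(2) th' d'(1)] unfolding L'_def by blast
      have wx: "D / 2 \<le> dist w x" using dist_triangle[of q x w] w(4) d' unfolding D_def by linarith
      then have dw: "0 < dist w x" "s \<le> dist w x" using w(2,3) d' D by linarith+
      define \<tau> where "\<tau> = s / (2 * dist w x)"
      have tau: "0 < \<tau>" "\<tau> \<le> 1" "\<tau> * dist w x = s / 2"
        unfolding \<tau>_def using w(2) dw by (auto simp: pos_divide_le_eq)
      obtain z where z: "between \<tau> w z x" using between_ex[of \<tau> w x] tau by auto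
      have fz: "f z = (1 - \<tau>) * f w + \<tau> * f x" using aff[OF _ tau(2) z] tau(1) by simp
      have wz: "dist w z = s / 2" using z tau unfolding between_def by simp
      have es: "\<epsilon> * s \<le> 1/4 * s" using e w(2) by (intro mult_right_mono) auto
      have "ball z (\<epsilon> * s) \<inter> W \<noteq> {}"
      proof
        assume em: "ball z (\<epsilon> * s) \<inter> W = {}"
        have s4: "2 * s \<le> R / 2" using w(3) d' by simp
        have sub: "ball z (\<epsilon> * s) \<subseteq> ball w s - W"
        proof
          fix y assume y: "y \<in> ball z (\<epsilon> * s)"
          then have "dist z y < \<epsilon> * s" by simp
          then have "dist w y < s" using dist_triangle[of w y z] wz es w(2) by linarith
          then show "y \<in> ball w s - W" using y em by auto
        qed
        have "ball w s \<subseteq> ball z (2 * s)"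
        proof
          fix y assume "y \<in> ball w s"
          then show "y \<in> ball z (2 * s)" using dist_triangle[of z y w] wz w(2) by (simp add: dist_commute)
        qed
        then have "vol (ball w s) \<le> vol (ball z (2 * s))" using s4 by (intro vol_mono fin_ball) auto
        then have "(\<epsilon> / 4) ^ n * vol (ball w s) \<le> (\<epsilon> / 2 / 2) ^ n * vol (ball z (2 * s))"
          using e by (intro mult_mono) auto
        also have "\<dots> \<le> vol (ball z (\<epsilon> / 2 * (2 * s)))" using e w(2) s4 by (intro vol_ball_scale(2)) auto
        also have "\<dots> \<le> vol (ball w s - W)"
          using sub w(2) s4 by (intro vol_mono fin_subset[OF fin_ball[of s w]]) auto
        also have "\<dots> \<le> \<theta>' * vol (ball w s)" by (rule w(6))
        finally have "(\<epsilon> / 4) ^ n \<le> \<theta>'" using vol_ball_pos[of s w] w(2) s4 by simp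
        moreover have "0 < (\<epsilon> / 4) ^ n" using e by simp
        ultimately show False unfolding \<theta>'_def by linarith
      qed
      then obtain z' where z': "z' \<in> W" "dist z z' < \<epsilon> * s" by auto
      have "dist q z < r2" using dist_triangle[of q z w] wz w(3,4) d' w(2) by linarith
      then have "\<bar>f z' - f z\<bar> \<le> 24 * L' * dist z' z" by (rule crude)
      also have "\<dots> \<le> 24 * L' * (\<epsilon> * s)" using z' L' by (intro mult_left_mono) (auto simp: dist_commute)
      finally have h1: "\<bar>f z' - f z\<bar> \<le> 24 * L' * (\<epsilon> * s)" .
      have "\<bar>f z' - f w\<bar> \<le> L' * dist z' w" using w(1,7) z' by blast
      also have "\<dots> \<le> L' * (s / 2 + \<epsilon> * s)"
        using z' wz dist_triangle[of z' w z] L' by (intro mult_left_mono) (auto simp: dist_commute)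
      finally have "\<bar>f z - f w\<bar> \<le> L' * (s / 2 + \<epsilon> * s) + 24 * L' * (\<epsilon> * s)" using h1 by linarith
      also have "\<dots> = s / 2 * (L' * (1 + 2 * \<epsilon>) + 48 * L' * \<epsilon>)" by (simp add: algebra_simps)
      also have "\<dots> = \<tau> * ((L' * (1 + 2 * \<epsilon>) + 48 * L' * \<epsilon>) * dist w x)" unfolding tau(3)[symmetric] by simp
      finally have "\<bar>f x - f w\<bar> \<le> (L' * (1 + 2 * \<epsilon>) + 48 * L' * \<epsilon>) * dist w x" by (rule affine_slope[where f = f and z = z and p = w and x = x, OF tau(1) fz])
      then show "\<exists>w. dist q w \<le> \<delta> \<and> \<bar>f w - f q\<bar> \<le> \<delta> \<and> \<bar>f x - f w\<bar> \<le> (L' * (1 + 2 * \<epsilon>) + 48 * L' * \<epsilon>) * dist w x"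
        using w(4,5) d'(2) by (intro exI[of _ w]) auto
    qed
    have "((\<lambda>\<epsilon>. (L' * (1 + 2 * \<epsilon>) + 48 * L' * \<epsilon>) * dist x q) \<longlongrightarrow> (L' * (1 + 2 * 0) + 48 * L' * 0) * dist x q) (at_right 0)"
      by (intro tendsto_intros)
    moreover have "eventually (\<lambda>\<epsilon>. \<bar>f x - f q\<bar> \<le> (L' * (1 + 2 * \<epsilon>) + 48 * L' * \<epsilon>) * dist x q) (at_right 0)"
      using eps by (auto simp: eventually_at_right_field intro!: exI[of _ "1/4"])
    ultimately have "\<bar>f x - f q\<bar> \<le> (L' * (1 + 2 * 0) + 48 * L' * 0) * dist x q" by (intro tendsto_lowerbound) auto
    then show ?thesis unfolding L'_def by simp
  qed simp
qed

lemma lipschitz_propagates: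
  assumes L: "0 \<le> L" "\<And>u. u \<in> ball p \<delta> \<Longrightarrow> lip_at f L u" and d: "0 < \<delta>"
  shows "lip_at f L q"
proof -
  \<comment> \<open>The scale \<open>3 * h\<close> covers one step: \<open>h\<close> between the
    centres, \<open>h / 2\<close> for the new ball and at most \<open>h\<close> for the old
    radius.\<close>
  define \<kappa> where "\<kappa> h = 1 - 9 * K * h\<^sup>2" for h
  have kap: "0 < \<kappa> h" "9 * K * h\<^sup>2 \<le> 1" "\<kappa> h = 1 - K * (3 * h)\<^sup>2" if "0 < h" "24 * h \<le> R" for h
    using K_small[of "3 * h"] that unfolding \<kappa>_def by (auto simp: power_mult_distrib)
  have chain: "\<exists>\<rho>>0. \<forall>u\<in>cball q \<rho>. lip_at f (L / \<kappa> h ^ k) u"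
    if h: "0 < h" "24 * h \<le> R" and "dist p q \<le> real k * h" for h k q
    using that(3)
  proof (induction k arbitrary: q)
    case 0
    then have "p = q" by simp
    then show ?case using L(2) d by (intro exI[of _ "\<delta> / 2"]) auto
  next
    case (Suc k)
    define t where "t = real k / (real k + 1)"
    have t: "0 \<le> t" "t \<le> 1" unfolding t_def by auto
    obtain m where m: "between t p m q" using between_ex[OF t] by blast
    have "t * dist p q \<le> t * ((real k + 1) * h)" "(1 - t) * dist p q \<le> (1 - t) * ((real k + 1) * h)"
      by (rule mult_left_mono; use Suc.prems t in \<open>simp add: add.commute\<close>)+
    moreover have "t * ((real k + 1) * h) = real k * h" "(1 - t) * ((real k + 1) * h) = h"
      unfolding t_def by (auto simp: field_simps)
    ultimately have pm: "dist p m \<le> real k * h" and mq: "dist m q \<le> h" using m unfolding between_def by auto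
    obtain \<rho> where rho: "0 < \<rho>" "\<And>u. u \<in> cball m \<rho> \<Longrightarrow> lip_at f (L / \<kappa> h ^ k) u" using Suc.IH[OF pm] by blast
    have "lip_at f (L / \<kappa> h ^ Suc k) u" if u: "u \<in> cball q (h / 2)" for u
    proof -
      have "lip_at f (L / \<kappa> h ^ k / (1 - K * (3 * h)\<^sup>2)) u"
      proof (rule lipschitz_transport[where p = m and \<rho> = "min \<rho> h"])
        show "0 \<le> L / \<kappa> h ^ k" using L(1) kap(1)[OF h] by simp
        show "lip_at f (L / \<kappa> h ^ k) v" if "v \<in> cball m (min \<rho> h)" for v using rho(2) that by simp
        show "dist m u + min \<rho> h < 3 * h" using dist_triangle[of m u q] u mq h by simp
      qed (use rho h in auto)
      then show ?thesis using kap(3)[OF h] by (simp add: mult.commute)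
    qed
    then show ?case using h by (intro exI[of _ "h / 2"]) auto
  qed
  show ?thesis unfolding lip_at_def
  proof
    fix x
    \<comment> \<open>The summand 1 keeps the step length positive even for
      \<open>p = q\<close>.\<close>
    define D where "D = dist p q + 1"
    have D: "0 < D" unfolding D_def by (simp add: add_nonneg_pos)
    define c where "c = 9 * K * D\<^sup>2"
    have "(\<lambda>N. D / real N) \<longlonglongrightarrow> 0" by (rule lim_const_over_n)
    then have "eventually (\<lambda>N. D / real N < R / 24) sequentially" using R_pos by (intro order_tendstoD) auto
    then have ev: "eventually (\<lambda>N. \<bar>f x - f q\<bar> * (1 - c / real N) \<le> L * dist x q) sequentially"
      using eventually_gt_at_top[of 0]
    proof eventually_elim
      case (elim N)
      define h where "h = D / real N"
      have h: "0 < h" "24 * h \<le> R" using elim D unfolding h_def by (auto simp: mult.commute less_imp_le)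
      have "dist p q \<le> real N * h" using elim unfolding h_def D_def by simp
      then obtain \<rho> where "0 < \<rho>" "\<forall>u\<in>cball q \<rho>. lip_at f (L / \<kappa> h ^ N) u" using chain[OF h] by blast
      then have "lip_at f (L / \<kappa> h ^ N) q" by simp
      then have "\<bar>f x - f q\<bar> \<le> L / \<kappa> h ^ N * dist x q" unfolding lip_at_def by blast
      then have "\<bar>f x - f q\<bar> * \<kappa> h ^ N \<le> L * dist x q" using kap(1)[OF h] by (simp add: field_simps)
      moreover have "1 - c / real N \<le> \<kappa> h ^ N"
        unfolding \<kappa>_def
      proof (rule one_minus_power_ge)
        show "0 \<le> 9 * K * h\<^sup>2" "9 * K * h\<^sup>2 \<le> 1" using K_nonneg kap(2)[OF h] by auto
        show "real N * (9 * K * h\<^sup>2) \<le> c / real N" unfolding c_def h_def using elim by (simp add: power2_eq_square)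
      qed
      then have "\<bar>f x - f q\<bar> * (1 - c / real N) \<le> \<bar>f x - f q\<bar> * \<kappa> h ^ N" by (intro mult_left_mono) auto
      ultimately show ?case by linarith
    qed
    have "(\<lambda>N. \<bar>f x - f q\<bar> * (1 - c / real N)) \<longlonglongrightarrow> \<bar>f x - f q\<bar> * (1 - 0)"
      by (intro tendsto_intros lim_const_over_n)
    then have "\<bar>f x - f q\<bar> * (1 - 0) \<le> L * dist x q" using ev by (rule tendsto_upperbound) simp
    then show "\<bar>f x - f q\<bar> \<le> L * dist x q" by simp
  qed
qed

end

end

theorem theorem1p2:
  fixes f :: "'a::metric_space \<Rightarrow> real" and n :: nat and k :: real
  assumes "complete (UNIV :: 'a set)"
    and "geodesic_space TYPE('a)"
    and "hausdorff_dim (UNIV :: 'a set) = ereal (real n)"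
    and "curv_ge TYPE('a) k"
    and "affine_fun f"
    and "hausdorff_measurable_fun (real n) f"
  shows "\<exists>L. lipschitz_on L UNIV f"
proof -
  obtain K R where "alexandrov K R TYPE('a)" using curv_ge_alexandrov[OF assms(2,4)] by blast
  then interpret alexandrov K R "TYPE('a)" .
  obtain p :: 'a and \<rho> C where reg: "0 < \<rho>" "\<rho> \<le> R / 8" "0 < hausdorff_measure (real n) (ball p \<rho>)"
    "\<And>q r. 0 < r \<Longrightarrow> ball q r \<subseteq> ball p \<rho> \<Longrightarrow> hausdorff_measure (real n) (ball q r) \<le> ennreal (C * r ^ n)"
    apply (rule regular_ball_exists[OF assms(1,3)])
    subgoal for p \<rho> C by (rule that[of \<rho> p C])
    done
  have "hausdorff_measure (real n) (ball p \<rho>) < top"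
    using reg(4)[OF reg(1), of p] by (simp add: le_less_trans)
  then interpret alexandrov_dim K R "TYPE('a)" n by (rule alexandrov_dimI[OF reg(1-3)])
  have aff: "f m = (1 - t) * f x + t * f y" if "0 \<le> t" "t \<le> 1" "between t x m y" for t x m y
    using affine_fun_between[OF assms(2,5) that] .
  have "\<exists>p0 \<delta> L. 0 < \<delta> \<and> 0 \<le> L \<and> (\<forall>u\<in>ball p0 \<delta>. lip_at f L u)"
    by (rule affine_lipschitz_somewhere[OF _ assms(6) reg(1,2)]) (erule (2) aff, erule (1) reg(4))
  then obtain p0 \<delta> L where L: "0 < \<delta>" "0 \<le> L" "\<forall>u\<in>ball p0 \<delta>. lip_at f L u" by blast
  have "lip_at f L q" for q
    by (rule lipschitz_propagates[where f = f and p = p0, OF assms(1) _ L(2) _ L(1)]) (erule (2) aff, use L(3) in blast)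
  then have "lipschitz_on L UNIV f"
    unfolding lip_at_def lipschitz_on_def using L(2) by (simp add: dist_real_def)
  then show ?thesis by blast
qed

end
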